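(* Let $n\ge1$, $0<\sigma<1$ and $\varepsilon>0$. Let $v\in C^{0,2\sigma+\varepsilon}(\mathbb{T}^n)$ if $0<\sigma<1/2$ (where $2\sigma+\varepsilon\le1$), or $v\in C^{1,2\sigma+\varepsilon-1}(\mathbb{T}^n)$ if $1/2\le\sigma<1$ (where $2\sigma+\varepsilon-1\le1$). Then the distribution $(-\Delta_{\mathbb{T}^n})^\sigma v$ coincides with the continuous function on $\mathbb{T}^n$ given by $$(-\Delta_{\mathbb{T}^n})^\sigma v(x)=\mathrm{P.V.}\int_{\mathbb{T}^n}(v(x)-v(z))K_\sigma(x-z)\,dz=\lim_{\delta\to0^+}\int_{\{z\in\mathbb{T}^n:\,|x-z|>\delta\}}(v(x)-v(z))K_\sigma(x-z)\,dz,\quad x\in\mathbb{T}^n,$$ where, for $x\in\mathbb{T}^n$, $x\ne0$, $$K_\sigma(x)=\frac{4^\sigma\,\Gamma\left(\frac{n}{2}+\sigma\right)}{|\Gamma(-\sigma)|\,\pi^{n/2}}\sum_{k\in\mathbb{Z}^n}\frac{1}{|x+2\pi k|^{n+2\sigma}}.$$ In the case $0<\sigma<1/2$ the integral $\int_{\mathbb{T}^n}(v(x)-v(z))K_\sigma(x-z)\,dz$ is in fact absolutely convergent.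
   Context: $\mathbb{T}^n=\mathbb{R}^n/(2\pi\mathbb{Z}^n)$ is identified with $Q_n=(-\pi,\pi]^n$; integration $dz$ on $\mathbb{T}^n$ is Lebesgue integration over $Q_n$. Here $|x-z|$ in the domain of integration denotes the geodesic distance $\mathrm{dist}(x,z)$ on $\mathbb{T}^n$. For $\phi\in C^\infty(\mathbb{T}^n)$, $(-\Delta_{\mathbb{T}^n})^\sigma\phi(z)=\sum_{k\in\mathbb{Z}^n}|k|^{2\sigma}c_k(\phi)e^{ik\cdot z}$ with $c_k(\phi)=(2\pi)^{-n}\int_{Q_n}\phi(z)e^{-ik\cdot z}dz$. For an integrable function $v$ on $\mathbb{T}^n$, $(-\Delta_{\mathbb{T}^n})^\sigma v$ is the periodic distribution $\langle(-\Delta_{\mathbb{T}^n})^\sigma v,\phi\rangle=\int_{\mathbb{T}^n}v(z)(-\Delta_{\mathbb{T}^n})^\sigma\phi(z)\,dz$, $\phi\in C^\infty(\mathbb{T}^n)$; it coincides with a continuous function $h$ if $\langle(-\Delta_{\mathbb{T}^n})^\sigma v,\phi\rangle=\int_{\mathbb{T}^n}h\phi\,dz$ for all $\phi\in C^\infty(\mathbb{T}^n)$. For $0<\alpha\le1$ and $k\in\mathbb{N}_0$, a continuous $v:\mathbb{T}^n\to\mathbb{R}$ is in $C^{k,\alpha}(\mathbb{T}^n)$ if $v\in C^k(\mathbb{T}^n)$ and $\sup_{x\neq y}\frac{|D^\gamma v(x)-D^\gamma v(y)|}{\mathrm{dist}(x,y)^\alpha}<\infty$ for each multi-index $\gamma$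 with $|\gamma|=k$. *)

theory Defs
  imports "HOL-Analysis.Analysis"
begin

text \<open>
  Functions on the torus \<open>\<real>\<^sup>n / (2\<pi>\<int>\<^sup>n)\<close> are represented by \<open>2\<pi>\<int>\<^sup>n\<close>-periodic
  functions on \<open>real ^ 'n\<close>, with \<open>n = CARD('n)\<close>; \<open>torus_cell\<close> is the set of representatives
  \<open>(-\<pi>, \<pi>]\<^sup>n\<close>.
\<close>

definition int_to_real_vec :: "int ^ 'n \<Rightarrow> real ^ 'n"
  where "int_to_real_vec k = (\<chi> i. of_int (k $ i))"

definition torus_cell :: "(real ^ 'n) set"
  where "torus_cell = {x. \<forall>i. - pi < x $ i \<and> x $ i \<le> pi}"

definition torus_periodic :: "(real ^ 'n \<Rightarrow> 'b) \<Rightarrow> bool"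
  where "torus_periodic f \<longleftrightarrow> (\<forall>x k. f (x + (2 * pi) *\<^sub>R int_to_real_vec k) = f x)"

text \<open>The geodesic distance of the flat torus is the quotient distance.\<close>

definition torus_dist :: "real ^ 'n \<Rightarrow> real ^ 'n \<Rightarrow> real"
  where "torus_dist x y = (INF k. norm (x - y + (2 * pi) *\<^sub>R int_to_real_vec k))"

definition partial_deriv :: "'n \<Rightarrow> (real ^ 'n \<Rightarrow> 'b::real_normed_vector) \<Rightarrow> real ^ 'n \<Rightarrow> 'b"
  where "partial_deriv i f x = vector_derivative (\<lambda>t. f (x + t *\<^sub>R axis i 1)) (at 0)"

primrec C_k :: "nat \<Rightarrow> (real ^ 'n \<Rightarrow> 'b::real_normed_vector) \<Rightarrow> bool" where
  "C_k 0 f \<longleftrightarrow> continuous_on UNIV f"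
| "C_k (Suc k) f \<longleftrightarrow> continuous_on UNIV f \<and>
     (\<forall>i. (\<forall>x. (\<lambda>t. f (x + t *\<^sub>R axis i 1)) differentiable (at 0)) \<and> C_k k (partial_deriv i f))"

definition C_infinity_torus :: "(real ^ 'n \<Rightarrow> complex) set"
  where "C_infinity_torus = {\<phi>. torus_periodic \<phi> \<and> (\<forall>k. C_k k \<phi>)}"

text \<open>
  In the Hoelder space below, the multi-indices of order \<open>k\<close> are replaced by the lists of \<open>k\<close>
  coordinate directions: \<open>foldr partial_deriv [i\<^sub>1, \<dots>, i\<^sub>k] v\<close> is the iterated partial derivative,
  which for a \<open>C\<^sup>k\<close> function depends only on how often each direction occurs.
  The exponent is meant to satisfy \<open>0 < \<alpha> \<le> 1\<close>.
\<close>

definition Hoelder_torus :: "nat \<Rightarrow> real \<Rightarrow> (real ^ 'n \<Rightarrow> real) set"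
  where "Hoelder_torus k \<alpha> = {v. torus_periodic v \<and> C_k k v \<and>
    (\<forall>ds. length ds = k \<longrightarrow>
      bdd_above {\<bar>foldr partial_deriv ds v x - foldr partial_deriv ds v y\<bar> / torus_dist x y powr \<alpha> | x y.
        x \<in> torus_cell \<and> y \<in> torus_cell \<and> x \<noteq> y})}"

definition fourier_coeff :: "(real ^ 'n \<Rightarrow> complex) \<Rightarrow> int ^ 'n \<Rightarrow> complex"
  where "fourier_coeff \<phi> k =
    (LINT z:torus_cell|lebesgue. \<phi> z * exp (- \<i> * complex_of_real (int_to_real_vec k \<bullet> z)))
      / (2 * complex_of_real pi) ^ CARD('n)"

definition frac_laplacian_smooth ::
    "real \<Rightarrow> (real ^ 'n \<Rightarrow> complex) \<Rightarrow> real ^ 'n \<Rightarrow> complex"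
  where "frac_laplacian_smooth \<sigma> \<phi> z =
    (\<Sum>\<^sub>\<infinity>k. complex_of_real (norm (int_to_real_vec k) powr (2 * \<sigma>)) * fourier_coeff \<phi> k
             * exp (\<i> * complex_of_real (int_to_real_vec k \<bullet> z)))"

definition frac_laplacian_distr ::
    "real \<Rightarrow> (real ^ 'n \<Rightarrow> real) \<Rightarrow> (real ^ 'n \<Rightarrow> complex) \<Rightarrow> complex"
  where "frac_laplacian_distr \<sigma> v \<phi> =
    (LINT z:torus_cell|lebesgue. complex_of_real (v z) * frac_laplacian_smooth \<sigma> \<phi> z)"

definition distr_coincides_with ::
    "((real ^ 'n \<Rightarrow> complex) \<Rightarrow> complex) \<Rightarrow> (real ^ 'n \<Rightarrow> real) \<Rightarrow> bool"
  where "distr_coincides_with T h \<longleftrightarrow>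
    (\<forall>\<phi>\<in>C_infinity_torus. T \<phi> = (LINT z:torus_cell|lebesgue. complex_of_real (h z) * \<phi> z))"

text \<open>Only the values of the kernel off \<open>2\<pi>\<int>\<^sup>n\<close> are meaningful.\<close>

definition frac_kernel :: "real \<Rightarrow> real ^ 'n \<Rightarrow> real"
  where "frac_kernel \<sigma> x =
    4 powr \<sigma> * Gamma (real CARD('n) / 2 + \<sigma>) / (\<bar>Gamma (- \<sigma>)\<bar> * pi powr (real CARD('n) / 2))
    * (\<Sum>\<^sub>\<infinity>k. 1 / norm (x + (2 * pi) *\<^sub>R int_to_real_vec k) powr (real CARD('n) + 2 * \<sigma>))"

text \<open>
  \<open>has_pv_integral_torus f x l\<close>: the principal value integral of \<open>f\<close> over the torus, with
  singularity at \<open>x\<close>, exists and equals \<open>l\<close>. Integrability of the truncations is required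
  explicitly because \<open>LINT\<close> returns \<open>0\<close> for non-integrable functions.
\<close>

definition has_pv_integral_torus :: "(real ^ 'n \<Rightarrow> real) \<Rightarrow> real ^ 'n \<Rightarrow> real \<Rightarrow> bool"
  where "has_pv_integral_torus f x l \<longleftrightarrow>
    (\<forall>\<delta>>0. set_integrable lebesgue {z \<in> torus_cell. torus_dist x z > \<delta>} f) \<and>
    ((\<lambda>\<delta>. LINT z:{z \<in> torus_cell. torus_dist x z > \<delta>}|lebesgue. f z) \<longlongrightarrow> l) (at_right 0)"

end

theory Submission
  imports Defs "HOL-Probability.Probability"
begin

text \<open>
  Writing \<open>a(y) = |y|\<^bsup>-n-2\<sigma>\<^esup>\<close> and \<open>c\<close> for the constant of the kernel, put
  \<open>h(x) = c/2 \<integral> (2v(x) - v(x+y) - v(x-y)) a(y) dy\<close> over the whole space. The Hoelder hypothesis bounds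
  the second difference by a multiple of \<open>min 1 |y|\<^bsup>2\<sigma>+\<epsilon>\<^esup>\<close>, so the integral converges absolutely and
  dominated convergence yields the continuity of \<open>h\<close>. Unfolding the torus to \<open>\<real>\<^sup>n\<close> turns a truncated
  integral against the periodized kernel into one against \<open>a\<close>; symmetrizing in \<open>y\<close> and letting
  \<open>\<delta> \<rightarrow> 0\<close> gives the principal value. By Fubini and \<open>c \<integral> (1 - cos (k \<bullet> y)) a(y) dy = |k|\<^bsup>2\<sigma>\<^esup>\<close>
  (write \<open>a\<close> as a superposition of Gaussians), the Fourier coefficients of \<open>h\<close> are
  \<open>|k|\<^bsup>2\<sigma>\<^esup>\<close> times those of \<open>v\<close>. Hence the nonlocal operator only ever has to be applied to \<open>v\<close>: both sides of
  the distributional identity are expanded in the Fourier series of the test function.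
\<close>

section \<open>Gaussian integrals and the Fourier multiplier of the Riesz kernel\<close>

text \<open>The obstacle is the range \<sigma> \<ge> 1/2: there (v x - v z) |x - z|^(-n-2\<sigma>)
  need not be absolutely integrable near x, so neither Fubini nor dominated convergence applies to
  the principal value directly. In the second difference the linear Taylor terms cancel, which makes
  every later exchange absolutely convergent. Passing to it is legitimate because the truncation set
  is symmetric about x. The truncation uses the torus distance, so after unfolding it removes a ball
  around every lattice translate of x.

  The kernel constant can be read off factor by factor: Gamma(n/2 + \<sigma>) from the Gaussian
  superposition, pi^(n/2) from the Gaussian integral, 4^\<sigma> from the frequency scale |\<xi>|^2
  / 4, and |Gamma(-\<sigma>)| from the integral of s^(-\<sigma>-1) (1 - e^(-q s)).

  Expanding the test function needs Fourier inversion on the torus. It rests on rapid decay of the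
  coefficients and on uniqueness for continuous functions.\<close>

lemma lborel_integral_prod:
  fixes f :: "'a::euclidean_space \<Rightarrow> real \<Rightarrow> 'b::{real_normed_field,banach,second_countable_topology}"
  assumes "\<And>b. b \<in> Basis \<Longrightarrow> integrable lborel (f b)"
  shows "(LINT x|lborel. (\<Prod>b\<in>Basis. f b (x \<bullet> b))) = (\<Prod>b\<in>Basis. LINT t|lborel. f b t)"
proof -
  have [measurable]: "f b \<in> borel_measurable borel" if "b \<in> Basis" for b
    using assms[OF that] by auto
  interpret product_sigma_finite "\<lambda>_::'a. lborel :: real measure" by standard
  have "(LINT x|lborel. (\<Prod>b\<in>Basis. f b (x \<bullet> b)))
      = (LINT g|(\<Pi>\<^sub>M b\<in>(Basis::'a set). lborel). (\<Prod>b\<in>Basis. f b ((\<Sum>b\<in>Basis. g b *\<^sub>R b) \<bullet> b)))"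
    by (subst lborel_eq, subst integral_distr) measurable
  also have "\<dots> = (LINT g|(\<Pi>\<^sub>M b\<in>(Basis::'a set). lborel). (\<Prod>b\<in>Basis. f b (g b)))"
    by (intro Bochner_Integration.integral_cong prod.cong) (auto simp: inner_sum_left inner_Basis if_distrib cong: if_cong)
  also have "\<dots> = (\<Prod>b\<in>Basis. LINT t|lborel. f b t)"
    by (intro product_integral_prod assms) auto
  finally show ?thesis .
qed

lemma power2_norm_eq_sum_Basis: "(norm y)\<^sup>2 = (\<Sum>b\<in>Basis. (y \<bullet> b)\<^sup>2)"
  for y :: "'a::euclidean_space"
proof -
  have "(norm y)\<^sup>2 = y \<bullet> y" by (rule power2_norm_eq_inner)
  also have "\<dots> = (\<Sum>b\<in>Basis. (y \<bullet> b)\<^sup>2)" by (subst euclidean_inner) (simp add: power2_eq_square)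
  finally show ?thesis .
qed

text \<open>A rescaling of the characteristic function of the standard normal distribution.\<close>

lemma gaussian_fourier_1d:
  assumes "t > 0"
  shows "integrable lborel (\<lambda>s. exp (\<i> * complex_of_real (w * s)) * complex_of_real (exp (- t * s\<^sup>2)))"
    and "(LINT s|lborel. exp (\<i> * complex_of_real (w * s)) * complex_of_real (exp (- t * s\<^sup>2)))
       = complex_of_real (sqrt (pi / t) * exp (- w\<^sup>2 / (4 * t)))"
proof -
  \<comment> \<open>Chosen so that the substitution of \<open>sqrt (2 * t) * x\<close> for x turns
    exp (- x^2 / 2) into exp (- t x^2) and the phase \<open>?u * x\<close> into w x.\<close>
  let ?u = "w / sqrt (2 * t)"
  have tt: "sqrt (2 * t) > 0" using assms by simp
  have sq: "(sqrt (2*t))\<^sup>2 = 2 * t" using assms by simp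
  have "char std_normal_distribution ?u = complex_of_real (exp (- (?u\<^sup>2) / 2))"
    by (simp add: char_std_normal_distribution)
  moreover have "char std_normal_distribution ?u = (LINT x|lborel. std_normal_density x *\<^sub>R exp (\<i> * complex_of_real (?u * x)))"
    unfolding char_def by (subst integral_density) auto
  ultimately have 1: "(LINT x|lborel. std_normal_density x *\<^sub>R exp (\<i> * complex_of_real (?u * x))) = complex_of_real (exp (- (?u\<^sup>2) / 2))" by simp
  have i1: "integrable lborel (\<lambda>x. std_normal_density x *\<^sub>R exp (\<i> * complex_of_real (?u * x)))"
    by (rule Bochner_Integration.integrable_bound[OF integrable_normal_density[of 1 0]]) auto
  have i2: "integrable lborel (\<lambda>x. std_normal_density (0 + sqrt (2*t) * x) *\<^sub>R exp (\<i> * complex_of_real (?u * (0 + sqrt (2*t) * x))))"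
    using lborel_integrable_real_affine[OF i1, of "sqrt (2*t)" 0] tt by simp
  have eq: "std_normal_density (0 + sqrt (2*t) * x) *\<^sub>R exp (\<i> * complex_of_real (?u * (0 + sqrt (2*t) * x))) 
     = (1 / sqrt (2 * pi)) *\<^sub>R (exp (\<i> * complex_of_real (w * x)) * complex_of_real (exp (- t * x\<^sup>2)))" for x
    using tt sq by (simp add: std_normal_density_def power_mult_distrib scaleR_conv_of_real field_simps)
  define E where "E = (\<lambda>s. exp (\<i> * complex_of_real (w * s)) * complex_of_real (exp (- t * s\<^sup>2)))"
  have eq': "(\<lambda>x. std_normal_density (0 + sqrt (2*t) * x) *\<^sub>R exp (\<i> * complex_of_real (?u * (0 + sqrt (2*t) * x)))) = (\<lambda>x. (1 / sqrt (2 * pi)) *\<^sub>R E x)"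
    unfolding eq E_def ..
  have iE: "integrable lborel E"
    using integrable_scaleR_right[of "sqrt (2 * pi)", OF i2[unfolded eq']] by simp
  then show "integrable lborel (\<lambda>s. exp (\<i> * complex_of_real (w * s)) * complex_of_real (exp (- t * s\<^sup>2)))"
    unfolding E_def .
  have "complex_of_real (exp (- (?u\<^sup>2) / 2)) = (LINT x|lborel. std_normal_density x *\<^sub>R exp (\<i> * complex_of_real (?u * x)))"
    by (rule 1[symmetric])
  also have "\<dots> = \<bar>sqrt (2*t)\<bar> *\<^sub>R (LINT x|lborel. (1 / sqrt (2 * pi)) *\<^sub>R E x)"
    unfolding eq'[symmetric] using tt by (intro lborel_integral_real_affine) simp
  also have "\<dots> = (sqrt (2*t) / sqrt (2*pi)) *\<^sub>R (LINT x|lborel. E x)"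
    using tt by simp
  finally have e: "complex_of_real (exp (- (?u\<^sup>2) / 2)) = (sqrt (2*t) / sqrt (2*pi)) *\<^sub>R (LINT x|lborel. E x)" .
  have "(LINT x|lborel. E x) = (sqrt (2*pi) / sqrt (2*t)) *\<^sub>R complex_of_real (exp (- (?u\<^sup>2) / 2))"
    unfolding e using tt by simp
  also have "\<dots> = complex_of_real ((sqrt (2*pi) / sqrt (2*t)) * exp (- (?u\<^sup>2) / 2))"
    by (simp add: scaleR_conv_of_real)
  also have "(sqrt (2*pi) / sqrt (2*t)) = sqrt (pi / t)"
    by (simp flip: real_sqrt_divide)
  also have "- (?u\<^sup>2) / 2 = - w\<^sup>2 / (4 * t)"
    using assms by (simp add: power_divide)
  finally show "(LINT s|lborel. exp (\<i> * complex_of_real (w * s)) * complex_of_real (exp (- t * s\<^sup>2)))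
       = complex_of_real (sqrt (pi / t) * exp (- w\<^sup>2 / (4 * t)))" unfolding E_def .
qed

lemma gaussian_integrable:
  fixes t :: real
  assumes "t > 0"
  shows "integrable lborel (\<lambda>y::'a::euclidean_space. exp (- t * (norm y)\<^sup>2))"
proof -
  have eq: "exp (- t * (norm y)\<^sup>2) = (\<Prod>b\<in>Basis. exp (- t * (y \<bullet> b)\<^sup>2))" for y :: 'a
    by (simp add: exp_sum[symmetric] sum_distrib_left[symmetric] sum_negf power2_norm_eq_sum_Basis)
  have i: "integrable lborel (\<lambda>s. exp (- t * s\<^sup>2))"
    using gaussian_fourier_1d(1)[OF assms, of 0] by (simp flip: of_real_minus of_real_power of_real_mult add: complex_of_real_integrable_eq)
  have "(\<integral>\<^sup>+s. ennreal (exp (- t * s\<^sup>2)) \<partial>lborel) < \<infinity>"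
    using i unfolding integrable_iff_bounded by simp
  then have "(\<integral>\<^sup>+y. ennreal (exp (- t * (norm (y::'a))\<^sup>2)) \<partial>lborel) < \<infinity>"
    unfolding eq prod_ennreal[OF less_imp_le[OF exp_gt_zero], symmetric]
    by (subst nn_integral_lborel_prod) (auto simp: power_less_top_ennreal)
  then show ?thesis by (intro integrableI_nonneg) auto
qed

text \<open>The cosine of \<xi> \<bullet> y does not factor over the coordinates, but the complex
  exponential does. The product formula is therefore applied to the exponential and the real part is
  taken at the end.\<close>

lemma gaussian_fourier:
  fixes \<xi> :: "'a::euclidean_space"
  assumes "t > 0"
  shows "(LINT y|lborel. cos (\<xi> \<bullet> y) * exp (- t * (norm y)\<^sup>2))
     = (pi / t) powr (DIM('a) / 2) * exp (- (norm \<xi>)\<^sup>2 / (4 * t))"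
proof -
  have eq: "exp (\<i> * complex_of_real (\<xi> \<bullet> y)) * complex_of_real (exp (- t * (norm y)\<^sup>2))
     = (\<Prod>b\<in>Basis. exp (\<i> * complex_of_real ((\<xi> \<bullet> b) * (y \<bullet> b))) * complex_of_real (exp (- t * (y \<bullet> b)\<^sup>2)))" for y :: 'a
  proof -
    have "exp (\<i> * complex_of_real (\<xi> \<bullet> y)) = (\<Prod>b\<in>Basis. exp (\<i> * complex_of_real ((\<xi> \<bullet> b) * (y \<bullet> b))))"
      by (simp add: exp_sum[symmetric] sum_distrib_left[symmetric] euclidean_inner[of \<xi> y])
    moreover have "exp (- t * (norm y)\<^sup>2) = (\<Prod>b\<in>Basis. exp (- t * (y \<bullet> b)\<^sup>2))"
      by (simp add: exp_sum[symmetric] sum_distrib_left[symmetric] sum_negf power2_norm_eq_sum_Basis)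
    ultimately show ?thesis by (simp add: prod.distrib)
  qed
  have int: "integrable lborel (\<lambda>y. exp (\<i> * complex_of_real (\<xi> \<bullet> y)) * complex_of_real (exp (- t * (norm y)\<^sup>2)))"
    by (rule Bochner_Integration.integrable_bound[OF gaussian_integrable[OF assms, where 'a='a]]) (auto simp: norm_mult)
  have "(LINT y|lborel. exp (\<i> * complex_of_real (\<xi> \<bullet> y)) * complex_of_real (exp (- t * (norm y)\<^sup>2)))
     = (\<Prod>b\<in>Basis. complex_of_real (sqrt (pi / t) * exp (- (\<xi> \<bullet> b)\<^sup>2 / (4 * t))))"
    unfolding eq by (subst lborel_integral_prod[where f="\<lambda>b s. exp (\<i> * complex_of_real ((\<xi> \<bullet> b) * s)) * complex_of_real (exp (- t * s\<^sup>2))"]) (use gaussian_fourier_1d[OF assms] in auto)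
  also have "\<dots> = complex_of_real ((\<Prod>b\<in>(Basis::'a set). sqrt (pi / t)) * (\<Prod>b\<in>Basis. exp (- (\<xi> \<bullet> b)\<^sup>2 / (4 * t))))"
    by (simp add: prod.distrib)
  also have "(\<Prod>b\<in>Basis. exp (- (\<xi> \<bullet> b)\<^sup>2 / (4 * t))) = exp (- (norm \<xi>)\<^sup>2 / (4 * t))"
    by (simp add: exp_sum[symmetric] sum_divide_distrib[symmetric] sum_negf power2_norm_eq_sum_Basis)
  also have "(\<Prod>b\<in>(Basis::'a set). sqrt (pi / t)) = (pi / t) powr (DIM('a) / 2)"
    using assms by (simp add: powr_half_sqrt[symmetric] powr_realpow[symmetric] powr_powr)
  finally have "Re (LINT y|lborel. exp (\<i> * complex_of_real (\<xi> \<bullet> y)) * complex_of_real (exp (- t * (norm y)\<^sup>2)))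
    = (pi / t) powr (DIM('a) / 2) * exp (- (norm \<xi>)\<^sup>2 / (4 * t))" by simp
  then show ?thesis
    using int by (simp add: integral_Re[symmetric] Re_exp del: exp_of_real)
qed


section \<open>Euler integrals and the multiplier formula\<close>

text \<open>The substitution s = 1/t with Jacobian 1/t^2. It goes through the change of variables
  for absolutely integrable functions, hence the assumption of a finite value
  \<open>b\<close>.\<close>

lemma nn_integral_reciprocal:
  fixes f :: "real \<Rightarrow> real"
  assumes [measurable]: "f \<in> borel_measurable borel" and nn: "\<And>s. s > 0 \<Longrightarrow> f s \<ge> 0"
    and fin: "(\<integral>\<^sup>+s\<in>{0<..}. ennreal (f s) \<partial>lborel) = ennreal b" and "b \<ge> 0"
  shows "(\<integral>\<^sup>+t\<in>{0<..}. ennreal (f (1 / t) / t\<^sup>2) \<partial>lborel) = ennreal b"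
proof -
  have fin': "(\<integral>\<^sup>+s. ennreal (indicator {0<..} s * f s) \<partial>lborel) = ennreal b"
    unfolding fin[symmetric] by (intro nn_integral_cong) (auto simp: indicator_def)
  have hb: "has_bochner_integral lborel (\<lambda>s. indicator {0<..} s * f s) b"
    using fin' by (intro has_bochner_integral_nn_integral) (auto simp: indicator_def nn \<open>b \<ge> 0\<close>)
  have img: "(\<lambda>t::real. 1 / t) ` {0<..} = {0<..}"
    by (auto simp: image_iff intro!: bexI[of _ "1 / _"])
  have "set_integrable lborel {0<..} f"
    using hb by (simp add: set_integrable_def has_bochner_integral_iff)
  then have ai: "f absolutely_integrable_on {0<..}"
    unfolding set_integrable_def by (intro integrable_completion[THEN iffD2]) auto
  have "set_lebesgue_integral lebesgue {0<..} f = b"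
    using hb by (simp add: set_lebesgue_integral_def has_bochner_integral_iff integral_completion)
  then have "integral {0<..} f = b"
    using set_lebesgue_integral_eq_integral(2)[OF ai] by simp
  have "(\<lambda>t. \<bar>- (1 / t\<^sup>2)\<bar> * f (1 / t)) absolutely_integrable_on {0<..} \<and> integral {0<..} (\<lambda>t. \<bar>- (1 / t\<^sup>2)\<bar> * f (1 / t)) = b"
  proof (rule has_absolute_integral_change_of_variables_1'[where g="\<lambda>t. 1 / t" and S="{0<..}" and g'="\<lambda>t. - (1 / t\<^sup>2)" and f=f, THEN iffD2])
    show "((\<lambda>t::real. 1 / t) has_field_derivative - (1 / x\<^sup>2)) (at x within {0<..})" if "x \<in> {0<..}" for x
      using that by (auto intro!: derivative_eq_intros simp: power2_eq_square)
  qed (use ai \<open>integral {0<..} f = b\<close> img in \<open>auto intro: inj_onI\<close>)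
  then have A: "(\<lambda>t. f (1 / t) / t\<^sup>2) absolutely_integrable_on {0<..}" and B: "integral {0<..} (\<lambda>t. f (1 / t) / t\<^sup>2) = b"
    by (simp_all add: field_simps)
  have "(\<lambda>t. indicator {0<..} t * (f (1 / t) / t\<^sup>2)) \<in> borel_measurable borel" by measurable
  then have "integrable lborel (\<lambda>t. indicator {0<..} t * (f (1 / t) / t\<^sup>2))" "(LINT t|lborel. indicator {0<..} t * (f (1 / t) / t\<^sup>2)) = b"
    using A B set_lebesgue_integral_eq_integral(2)[OF A]
    by (auto simp: set_integrable_def set_lebesgue_integral_def integrable_completion integral_completion)
  then have "(\<integral>\<^sup>+t. ennreal (indicator {0<..} t * (f (1 / t) / t\<^sup>2)) \<partial>lborel) = ennreal b"
    by (subst nn_integral_eq_integral) (auto simp: indicator_def nn)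
  moreover have "(\<integral>\<^sup>+t\<in>{0<..}. ennreal (f (1 / t) / t\<^sup>2) \<partial>lborel) = (\<integral>\<^sup>+t. ennreal (indicator {0<..} t * (f (1 / t) / t\<^sup>2)) \<partial>lborel)"
    by (intro nn_integral_cong) (auto simp: indicator_def)
  ultimately show ?thesis by simp
qed

text \<open>Euler's integral after rescaling t by u. With u = |y|^2 it exhibits |y|^(-2p) as a
  superposition of Gaussians in y.\<close>

lemma nn_integral_Gamma_scaled:
  fixes p u :: real
  assumes "p > 0" "u > 0"
  shows "(\<integral>\<^sup>+t\<in>{0<..}. ennreal (t powr (p - 1) * exp (- u * t)) \<partial>lborel) = ennreal (Gamma p * u powr (- p))"
proof -
  have "ennreal (Gamma p) = (\<integral>\<^sup>+t. ennreal (indicator {0..} t * t powr (p - 1) / exp t) \<partial>lborel)"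
    using assms by (intro Gamma_conv_nn_integral_real) auto
  also have "\<dots> = ennreal \<bar>u\<bar> * (\<integral>\<^sup>+t. ennreal (indicator {0..} (0 + u * t) * (0 + u * t) powr (p - 1) / exp (0 + u * t)) \<partial>lborel)"
    using assms by (intro nn_integral_real_affine) auto
  also have "\<dots> = ennreal u * (\<integral>\<^sup>+t. ennreal (u powr (p - 1)) * (ennreal (t powr (p - 1) * exp (- u * t)) * indicator {0<..} t) \<partial>lborel)"
    using assms AE_lborel_singleton[of "0::real"]
    by (intro arg_cong2[of _ _ _ _ "(*)"] nn_integral_cong_AE)
      (auto simp: indicator_def powr_mult exp_minus field_simps ennreal_mult'[symmetric] zero_le_mult_iff)
  also have "\<dots> = ennreal (u powr p) * (\<integral>\<^sup>+t\<in>{0<..}. ennreal (t powr (p - 1) * exp (- u * t)) \<partial>lborel)"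
    using assms by (subst nn_integral_cmult) (auto simp: mult.assoc[symmetric] ennreal_mult'[symmetric] powr_diff)
  finally have "ennreal (u powr - p) * ennreal (Gamma p) = ennreal (u powr - p) * (ennreal (u powr p) * (\<integral>\<^sup>+t\<in>{0<..}. ennreal (t powr (p - 1) * exp (- u * t)) \<partial>lborel))" by simp
  then show ?thesis
    using assms by (simp add: mult.assoc[symmetric] ennreal_mult'[symmetric] powr_add[symmetric] Gamma_real_nonneg mult.commute)
qed

text \<open>The representation of q^\<sigma> as a Bernstein function. Write 1 - e^(-q s) as the
  integral of s e^(-u s) over u in [0, q]. After Tonelli the s-integral is Euler's, with value
  Gamma(1 - \<sigma>) u^(\<sigma> - 1), and integrating this power over u gives the claim.\<close>

lemma nn_integral_one_minus_exp:
  fixes q \<sigma> :: real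
  assumes "0 < \<sigma>" "\<sigma> < 1" "q \<ge> 0"
  shows "(\<integral>\<^sup>+s\<in>{0<..}. ennreal (s powr (- \<sigma> - 1) * (1 - exp (- q * s))) \<partial>lborel)
    = ennreal (Gamma (1 - \<sigma>) / \<sigma> * q powr \<sigma>)"
proof -
  have I: "(\<integral>\<^sup>+u\<in>{0..q}. ennreal (exp (- u * s) * s) \<partial>lborel) = ennreal (1 - exp (- q * s))" if "s > 0" for s
  proof -
    have "(\<integral>\<^sup>+u\<in>{0..q}. ennreal (exp (- u * s) * s) \<partial>lborel) = ennreal ((- exp (- q * s)) - (- exp (- 0 * s)))"
      using that assms by (intro nn_integral_FTC_Icc) (auto intro!: derivative_eq_intros)
    then show ?thesis by simp
  qed
  have "(\<integral>\<^sup>+s\<in>{0<..}. ennreal (s powr (- \<sigma> - 1) * (1 - exp (- q * s))) \<partial>lborel)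
    = (\<integral>\<^sup>+s. \<integral>\<^sup>+u. ennreal (s powr (- \<sigma>) * exp (- u * s)) * indicator {0..q} u * indicator {0<..} s \<partial>lborel \<partial>lborel)"
  proof (rule nn_integral_cong)
    fix s :: real
    show "ennreal (s powr (- \<sigma> - 1) * (1 - exp (- q * s))) * indicator {0<..} s =
      (\<integral>\<^sup>+u. ennreal (s powr (- \<sigma>) * exp (- u * s)) * indicator {0..q} u * indicator {0<..} s \<partial>lborel)"
    proof (cases "s > 0")
      case True
      have "ennreal (s powr (- \<sigma> - 1) * (1 - exp (- q * s))) = ennreal (s powr (- \<sigma> - 1)) * ennreal (1 - exp (- q * s))"
        by (simp add: ennreal_mult')
      also have "\<dots> = (\<integral>\<^sup>+u. ennreal (s powr (- \<sigma> - 1)) * (ennreal (exp (- u * s) * s) * indicator {0..q} u) \<partial>lborel)"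
        unfolding I[OF True, symmetric] by (subst nn_integral_cmult) auto
      also have "\<dots> = (\<integral>\<^sup>+u. ennreal (s powr (- \<sigma>) * exp (- u * s)) * indicator {0..q} u * indicator {0<..} s \<partial>lborel)"
        using True by (intro nn_integral_cong) (auto simp: indicator_def ennreal_mult'[symmetric] powr_diff)
      finally show ?thesis using True by simp
    qed simp
  qed
  also have "\<dots> = (\<integral>\<^sup>+u. \<integral>\<^sup>+s. ennreal (s powr (- \<sigma>) * exp (- u * s)) * indicator {0..q} u * indicator {0<..} s \<partial>lborel \<partial>lborel)"
    by (rule lborel_pair.Fubini') measurable
  also have "\<dots> = (\<integral>\<^sup>+u\<in>{0..q}. ennreal (Gamma (1 - \<sigma>) * u powr (\<sigma> - 1)) \<partial>lborel)"
  \<comment> \<open>The point u = 0 has to be left out: the inner integral is infinite there, while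
    \<open>0 powr (\<sigma> - 1)\<close> is 0.\<close>
  proof (rule nn_integral_cong_AE, use AE_lborel_singleton[of "0::real"] in eventually_elim)
    fix u :: real assume "u \<noteq> 0"
    show "(\<integral>\<^sup>+s. ennreal (s powr (- \<sigma>) * exp (- u * s)) * indicator {0..q} u * indicator {0<..} s \<partial>lborel) = ennreal (Gamma (1 - \<sigma>) * u powr (\<sigma> - 1)) * indicator {0..q} u"
      using nn_integral_Gamma_scaled[of "1 - \<sigma>" u] assms \<open>u \<noteq> 0\<close> by (auto simp: indicator_def)
  qed
  also have "\<dots> = ennreal (Gamma (1 - \<sigma>) / \<sigma> * q powr \<sigma>)"
  proof (cases "q = 0")
    case True
    then have "(\<integral>\<^sup>+u\<in>{0..q}. ennreal (Gamma (1 - \<sigma>) * u powr (\<sigma> - 1)) \<partial>lborel) = (\<integral>\<^sup>+(u::real). 0 \<partial>lborel)"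
      using AE_lborel_singleton[of "0::real"] by (intro nn_integral_cong_AE) (auto simp: indicator_def)
    then show ?thesis using True by simp
  next
    case False
    have "((\<lambda>u. u powr (\<sigma> - 1)) has_integral (q powr (\<sigma> - 1 + 1) / (\<sigma> - 1 + 1))) {0..q}"
      using assms by (intro has_integral_powr_from_0) auto
    then have "((\<lambda>u. Gamma (1 - \<sigma>) * u powr (\<sigma> - 1)) has_integral (Gamma (1 - \<sigma>) / \<sigma> * q powr \<sigma>)) {0..q}"
      using has_integral_mult_right[of "\<lambda>u. u powr (\<sigma> - 1)" "q powr (\<sigma> - 1 + 1) / (\<sigma> - 1 + 1)" _ "Gamma (1 - \<sigma>)"] by simp
    then show ?thesis
      using nn_integral_has_integral_lebesgue[of "{0..q}" "\<lambda>u. Gamma (1 - \<sigma>) * u powr (\<sigma> - 1)"] assms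
      by (simp add: ennreal_mult' ennreal_indicator mult.commute)
  qed
  finally show ?thesis .
qed

text \<open>The functional equation at -\<sigma>, which lies strictly between the poles -1 and 0. It
  identifies the factor in the kernel constant with the value that the Bernstein integral
  produces.\<close>

lemma abs_Gamma_minus:
  fixes \<sigma> :: real
  assumes "0 < \<sigma>" "\<sigma> < 1"
  shows "\<bar>Gamma (- \<sigma>)\<bar> = Gamma (1 - \<sigma>) / \<sigma>"
proof -
  have "- \<sigma> \<notin> \<int>\<^sub>\<le>\<^sub>0"
  proof
    assume "- \<sigma> \<in> \<int>\<^sub>\<le>\<^sub>0"
    then obtain k :: int where "- \<sigma> = of_int k" by (elim nonpos_Ints_cases) auto
    then have "real_of_int (- 1) < real_of_int k" "real_of_int k < real_of_int 0" using assms by simp_all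
    then have "- 1 < k" "k < 0" by (simp_all only: of_int_less_iff)
    then show False by simp
  qed
  then have "Gamma (1 - \<sigma>) = - \<sigma> * Gamma (- \<sigma>)"
    using Gamma_plus1[of "- \<sigma>"] assms by (simp add: nonpos_Ints_def add.commute)
  then have "Gamma (- \<sigma>) = - (Gamma (1 - \<sigma>) / \<sigma>)" using assms by (simp add: field_simps)
  then show ?thesis using assms by simp
qed

text \<open>Insert the Gaussian superposition of |y|^(-2p) and integrate over y first: the Gaussian
  with parameter t contributes (pi/t)^(n/2) (1 - e^(-q/t)). All integrands are nonnegative, so
  Tonelli needs no integrability, and finiteness comes out as part of the result.\<close>

theorem nn_integral_one_minus_cos:
  fixes \<xi> :: "'a::euclidean_space" and \<sigma> :: real
  assumes "0 < \<sigma>" "\<sigma> < 1"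
  defines "p \<equiv> DIM('a) / 2 + \<sigma>"
  shows "(\<integral>\<^sup>+y. ennreal ((1 - cos (\<xi> \<bullet> y)) / norm y powr (2 * p)) \<partial>lborel)
    = ennreal (norm \<xi> powr (2 * \<sigma>) * (\<bar>Gamma (- \<sigma>)\<bar> * pi powr (DIM('a) / 2)) / (4 powr \<sigma> * Gamma p))"
proof -
  have p: "p > 0" using assms by (simp add: add_nonneg_pos)
  define q where "q = (norm \<xi>)\<^sup>2 / 4"
  have q0: "q \<ge> 0" by (simp add: q_def)
  have qs: "q powr \<sigma> = norm \<xi> powr (2 * \<sigma>) / 4 powr \<sigma>"
    by (cases "\<xi> = 0") (simp_all add: q_def powr_divide powr_powr[symmetric])
  have 1: "ennreal (Gamma p) * ennreal ((1 - cos (\<xi> \<bullet> y)) / norm y powr (2 * p))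
    = (\<integral>\<^sup>+t. ennreal (t powr (p - 1) * ((1 - cos (\<xi> \<bullet> y)) * exp (- t * (norm y)\<^sup>2))) * indicator {0<..} t \<partial>lborel)" for y :: 'a
  \<comment> \<open>At the origin both sides are 0, because 1 - cos 0 = 0.\<close>
  proof (cases "y = 0")
    case False
    have "((norm y)\<^sup>2) powr (- p) = (norm y powr 2) powr (- p)" using False by simp
    also have "\<dots> = 1 / norm y powr (2 * p)" unfolding powr_powr by (simp add: powr_minus_divide)
    finally have n: "((norm y)\<^sup>2) powr (- p) = 1 / norm y powr (2 * p)" .
    have "ennreal (Gamma p) * ennreal ((1 - cos (\<xi> \<bullet> y)) / norm y powr (2 * p))
       = ennreal (1 - cos (\<xi> \<bullet> y)) * ennreal (Gamma p * ((norm y)\<^sup>2) powr (- p))"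
      using p False unfolding n by (simp add: ennreal_mult'[symmetric] field_simps)
    also have "\<dots> = (\<integral>\<^sup>+t. ennreal (1 - cos (\<xi> \<bullet> y)) * (ennreal (t powr (p - 1) * exp (- ((norm y)\<^sup>2) * t)) * indicator {0<..} t) \<partial>lborel)"
      using p False by (subst nn_integral_Gamma_scaled[symmetric]) (auto simp: nn_integral_cmult)
    also have "\<dots> = (\<integral>\<^sup>+t. ennreal (t powr (p - 1) * ((1 - cos (\<xi> \<bullet> y)) * exp (- t * (norm y)\<^sup>2))) * indicator {0<..} t \<partial>lborel)"
      by (intro nn_integral_cong) (auto simp: ennreal_mult'[symmetric] mult_ac indicator_def)
    finally show ?thesis .
  qed simp
  have 2: "(\<integral>\<^sup>+y. ennreal ((1 - cos (\<xi> \<bullet> y)) * exp (- t * (norm y)\<^sup>2)) \<partial>lborel)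
      = ennreal ((pi / t) powr (DIM('a) / 2) * (1 - exp (- q / t)))" if "t > 0" for t
  proof -
    have i1: "integrable lborel (\<lambda>y. exp (- t * (norm (y::'a))\<^sup>2))"
      by (rule gaussian_integrable[OF that])
    have i2: "integrable lborel (\<lambda>y. cos (\<xi> \<bullet> y) * exp (- t * (norm y)\<^sup>2))"
      by (rule Bochner_Integration.integrable_bound[OF i1]) (auto simp: abs_mult mult_left_le_one_le)
    have 3: "(1 - cos (\<xi> \<bullet> y)) * exp (- t * (norm y)\<^sup>2) = exp (- t * (norm y)\<^sup>2) - cos (\<xi> \<bullet> y) * exp (- t * (norm y)\<^sup>2)" for y
      by (simp add: algebra_simps)
    have "(LINT y|lborel. (1 - cos (\<xi> \<bullet> y)) * exp (- t * (norm y)\<^sup>2))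
       = (LINT y|lborel. exp (- t * (norm (y::'a))\<^sup>2)) - (LINT y|lborel. cos (\<xi> \<bullet> y) * exp (- t * (norm y)\<^sup>2))"
      unfolding 3 by (intro Bochner_Integration.integral_diff i1 i2)
    also have "\<dots> = (pi / t) powr (DIM('a) / 2) * (1 - exp (- q / t))"
      using gaussian_fourier[OF that, of \<xi>] gaussian_fourier[OF that, of "0::'a"]
      by (simp add: q_def algebra_simps)
    finally have 4: "(LINT y|lborel. (1 - cos (\<xi> \<bullet> y)) * exp (- t * (norm y)\<^sup>2)) = (pi / t) powr (DIM('a) / 2) * (1 - exp (- q / t))" .
    have "integrable lborel (\<lambda>y. (1 - cos (\<xi> \<bullet> y)) * exp (- t * (norm y)\<^sup>2))"
      unfolding 3 by (intro Bochner_Integration.integrable_diff i1 i2)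
    then show ?thesis
      unfolding 4[symmetric] by (rule nn_integral_eq_integral) simp
  qed
  \<comment> \<open>With s = 1/t the powers left over are t^(p-1) t^(-n/2) = t^(\<sigma>-1) =
    s^(-\<sigma>-1) / t^2, so the t-integral is the Bernstein integral in s.\<close>
  have R: "(\<integral>\<^sup>+t. ennreal ((1 / t) powr (- \<sigma> - 1) * (1 - exp (- q * (1 / t))) / t\<^sup>2) * indicator {0<..} t \<partial>lborel)
     = ennreal (Gamma (1 - \<sigma>) / \<sigma> * q powr \<sigma>)"
    by (rule nn_integral_reciprocal[where f="\<lambda>s. s powr (- \<sigma> - 1) * (1 - exp (- q * s))"], measurable)
      (use assms q0 nn_integral_one_minus_exp[of \<sigma> q] in auto)
  have "ennreal (Gamma p) * (\<integral>\<^sup>+y. ennreal ((1 - cos (\<xi> \<bullet> y)) / norm y powr (2 * p)) \<partial>lborel)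
    = (\<integral>\<^sup>+y. ennreal (Gamma p) * ennreal ((1 - cos (\<xi> \<bullet> y)) / norm y powr (2 * p)) \<partial>lborel)"
    by (subst nn_integral_cmult) auto
  also have "\<dots> = (\<integral>\<^sup>+y. \<integral>\<^sup>+t. ennreal (t powr (p - 1) * ((1 - cos (\<xi> \<bullet> y)) * exp (- t * (norm y)\<^sup>2))) * indicator {0<..} t \<partial>lborel \<partial>lborel)"
    by (simp only: 1)
  also have "\<dots> = (\<integral>\<^sup>+t. \<integral>\<^sup>+y. ennreal (t powr (p - 1) * ((1 - cos (\<xi> \<bullet> y)) * exp (- t * (norm y)\<^sup>2))) * indicator {0<..} t \<partial>lborel \<partial>lborel)"
    by (rule lborel_pair.Fubini') measurable
  also have "\<dots> = (\<integral>\<^sup>+t. ennreal (pi powr (DIM('a) / 2)) * (ennreal ((1 / t) powr (- \<sigma> - 1) * (1 - exp (- q * (1 / t))) / t\<^sup>2) * indicator {0<..} t) \<partial>lborel)"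
  proof (rule nn_integral_cong)
    fix t :: real
    show "(\<integral>\<^sup>+y. ennreal (t powr (p - 1) * ((1 - cos (\<xi> \<bullet> y)) * exp (- t * (norm y)\<^sup>2))) * indicator {0<..} t \<partial>lborel)
      = ennreal (pi powr (DIM('a) / 2)) * (ennreal ((1 / t) powr (- \<sigma> - 1) * (1 - exp (- q * (1 / t))) / t\<^sup>2) * indicator {0<..} t)"
    proof (cases "t > 0")
      case True
      have "(\<integral>\<^sup>+y. ennreal (t powr (p - 1) * ((1 - cos (\<xi> \<bullet> y)) * exp (- t * (norm y)\<^sup>2))) \<partial>lborel)
         = ennreal (t powr (p - 1)) * (\<integral>\<^sup>+y. ennreal ((1 - cos (\<xi> \<bullet> y)) * exp (- t * (norm y)\<^sup>2)) \<partial>lborel)"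
        by (subst nn_integral_cmult[symmetric]) (auto simp: ennreal_mult')
      also have "\<dots> = ennreal (t powr (p - 1) * ((pi / t) powr (DIM('a) / 2) * (1 - exp (- q / t))))"
        by (simp only: 2[OF True] ennreal_mult'[symmetric] powr_ge_zero)
      also have "t powr (p - 1) * ((pi / t) powr (DIM('a) / 2) * (1 - exp (- q / t))) = pi powr (DIM('a) / 2) * ((1 / t) powr (- \<sigma> - 1) * (1 - exp (- q * (1 / t))) / t\<^sup>2)"
      proof -
        have "t powr (p - 1) = t powr (DIM('a) / 2) * t powr (\<sigma> - 1)"
          by (simp add: p_def powr_add[symmetric] add_diff_eq)
        moreover have "(pi / t) powr (DIM('a) / 2) = pi powr (DIM('a) / 2) / t powr (DIM('a) / 2)"
          using True by (simp add: powr_divide)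
        moreover have "(1 / t) powr (- \<sigma> - 1) = t powr (\<sigma> - 1) * t\<^sup>2"
        proof -
          have "(1 / t) powr (- \<sigma> - 1) = t powr (\<sigma> + 1)" 
            using True by (simp add: powr_divide powr_minus_divide[of t "\<sigma> + 1", symmetric] powr_minus_divide[of t "- \<sigma> - 1", symmetric] add.commute)
          also have "\<dots> = t powr (\<sigma> - 1) * t powr 2" by (simp add: powr_add[symmetric] add.commute)
          finally show ?thesis using True by simp
        qed
        ultimately show ?thesis using True by simp
      qed
      finally show ?thesis using True by (simp add: ennreal_mult'[symmetric])
    qed simp
  qed
  also have "\<dots> = ennreal (pi powr (DIM('a) / 2)) * ennreal (Gamma (1 - \<sigma>) / \<sigma> * q powr \<sigma>)"
    by (subst nn_integral_cmult, measurable) (simp only: R)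
  finally have "ennreal (1 / Gamma p) * (ennreal (Gamma p) * (\<integral>\<^sup>+y. ennreal ((1 - cos (\<xi> \<bullet> y)) / norm y powr (2 * p)) \<partial>lborel))
     = ennreal (1 / Gamma p) * (ennreal (pi powr (DIM('a) / 2)) * ennreal (Gamma (1 - \<sigma>) / \<sigma> * q powr \<sigma>))" by simp
  then have "(\<integral>\<^sup>+y. ennreal ((1 - cos (\<xi> \<bullet> y)) / norm y powr (2 * p)) \<partial>lborel)
     = ennreal (1 / Gamma p * (pi powr (DIM('a) / 2) * (Gamma (1 - \<sigma>) / \<sigma> * q powr \<sigma>)))"
    using Gamma_real_pos[OF p] assms(1,2) by (simp add: mult.assoc[symmetric] ennreal_mult'[symmetric])
  also have "1 / Gamma p * (pi powr (DIM('a) / 2) * (Gamma (1 - \<sigma>) / \<sigma> * q powr \<sigma>)) = norm \<xi> powr (2 * \<sigma>) * (\<bar>Gamma (- \<sigma>)\<bar> * pi powr (DIM('a) / 2)) / (4 powr \<sigma> * Gamma p)"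
    using assms(1,2) by (simp add: abs_Gamma_minus qs mult_ac)
  finally show ?thesis .
qed

section \<open>Unfolding integrals over the torus\<close>

definition torus_period :: "int ^ 'n \<Rightarrow> real ^ 'n"
  where "torus_period k = (2 * pi) *\<^sub>R int_to_real_vec k"

lemma torus_period_nth [simp]: "torus_period k $ i = 2 * pi * of_int (k $ i)"
  by (simp add: torus_period_def int_to_real_vec_def)

lemma torus_period_0 [simp]: "torus_period 0 = 0"
  by (simp add: vec_eq_iff)

lemma torus_period_add: "torus_period (k + l) = torus_period k + torus_period l"
  by (simp add: vec_eq_iff distrib_left)

lemma torus_period_minus: "torus_period (- k) = - torus_period k"
  by (simp add: vec_eq_iff)

lemma torus_period_diff: "torus_period (k - l) = torus_period k - torus_period l"
  by (simp add: vec_eq_iff right_diff_distrib)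

lemma torus_periodic_iff: "torus_periodic f \<longleftrightarrow> (\<forall>x k. f (x + torus_period k) = f x)"
  by (simp add: torus_periodic_def torus_period_def)

lemma torus_periodicD: "torus_periodic f \<Longrightarrow> f (x + torus_period k) = f x"
  by (simp add: torus_periodic_iff)

text \<open>Each coordinate determines its integer as a ceiling, since the right face belongs to the
  cell and the left one does not.\<close>

lemma ex1_period_cell: "\<exists>!k. z - torus_period k \<in> torus_cell" for z :: "real ^ 'n"
proof -
  have "z - torus_period k \<in> torus_cell \<longleftrightarrow> k = (\<chi> i. \<lceil>(z $ i - pi) / (2 * pi)\<rceil>)" for k
  proof -
    have "- pi < z $ i - 2 * pi * m \<and> z $ i - 2 * pi * m \<le> pi \<longleftrightarrow> \<lceil>(z $ i - pi) / (2 * pi)\<rceil> = m" for i and m :: int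
      by (simp add: ceiling_eq_iff field_simps)
    then show ?thesis
      by (auto simp: torus_cell_def vec_eq_iff)
  qed
  then show ?thesis by auto
qed

lemma torus_cell_borel [measurable]: "torus_cell \<in> sets (borel :: (real ^ 'n) measure)"
proof -
  have [measurable]: "(\<lambda>x::real^'n. x $ i) \<in> borel_measurable borel" for i
    by (intro borel_measurable_continuous_onI continuous_intros)
  have "{x \<in> space borel. \<forall>i. - pi < x $ i \<and> x $ i \<le> pi} \<in> sets (borel :: (real ^ 'n) measure)"
    by measurable
  then show ?thesis by (simp add: torus_cell_def)
qed

lemma torus_cell_subset: "torus_cell \<subseteq> cbox (\<chi> i. - pi) (\<chi> i. pi)"
  by (auto simp: torus_cell_def mem_box_cart less_imp_le)

lemma box_subset_torus_cell: "box (\<chi> i. - pi) (\<chi> i. pi) \<subseteq> torus_cell"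
  by (auto simp: torus_cell_def mem_box_cart less_imp_le)

lemma emeasure_torus_cell_finite: "emeasure lborel (torus_cell :: (real ^ 'n) set) < \<infinity>"
proof -
  have "emeasure lborel (torus_cell :: (real ^ 'n) set) \<le> emeasure lborel (cbox (\<chi> i. - pi) (\<chi> i. pi) :: (real ^ 'n) set)"
    by (intro emeasure_mono torus_cell_subset) auto
  then show ?thesis using emeasure_lborel_cbox_finite by (rule order_le_less_trans)
qed

text \<open>The half-open cell lies between the open and the closed box, whose volumes
  agree.\<close>

lemma measure_torus_cell: "measure lborel (torus_cell :: (real ^ 'n) set) = (2 * pi) ^ CARD('n)"
proof -
  have 1: "measure lborel (cbox (\<chi> i. - pi) (\<chi> i. pi) :: (real ^ 'n) set) = (2 * pi) ^ CARD('n)"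
    by (simp add: content_cbox_cart interval_eq_empty_cart)
  have 2: "measure lborel (box (\<chi> i. - pi) (\<chi> i. pi) :: (real ^ 'n) set) = (2 * pi) ^ CARD('n)"
    using 1 by (simp only: measure_lborel_box_eq measure_lborel_cbox_eq)
  have "measure lborel (torus_cell :: (real ^ 'n) set) \<le> (2 * pi) ^ CARD('n)"
    unfolding 1[symmetric] by (intro measure_mono_fmeasurable torus_cell_subset) auto
  moreover have "measure lborel (torus_cell :: (real ^ 'n) set) \<ge> (2 * pi) ^ CARD('n)"
    unfolding 2[symmetric] by (intro measure_mono_fmeasurable box_subset_torus_cell)
      (auto simp: fmeasurable_def emeasure_torus_cell_finite[unfolded infinity_ennreal_def])
  ultimately show ?thesis by simp
qed

lemma nn_integral_lborel_shift:
  fixes F :: "'a::euclidean_space \<Rightarrow> ennreal"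
  assumes [measurable]: "F \<in> borel_measurable borel"
  shows "(\<integral>\<^sup>+z. F (z + c) \<partial>lborel) = (\<integral>\<^sup>+z. F z \<partial>lborel)"
proof -
  have "(\<integral>\<^sup>+z. F z \<partial>lborel) = (\<integral>\<^sup>+z. F z \<partial>distr lborel borel ((+) c))"
    by (simp add: lborel_distr_plus)
  also have "\<dots> = (\<integral>\<^sup>+z. F (z + c) \<partial>lborel)"
    by (subst nn_integral_distr) (auto simp: add.commute)
  finally show ?thesis ..
qed

text \<open>The translates of the cell tile the space: after exchanging sum and integral each term
  is shifted back, and the indicators of the translated cells then add up to 1 at every
  point.\<close>

lemma nn_integral_unfold:
  fixes F :: "real ^ 'n \<Rightarrow> ennreal"
  assumes [measurable]: "F \<in> borel_measurable borel"
  shows "(\<integral>\<^sup>+z\<in>torus_cell. (\<integral>\<^sup>+k. F (z + torus_period k) \<partial>count_space UNIV) \<partial>lborel) = (\<integral>\<^sup>+z. F z \<partial>lborel)"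
proof -
  have "(\<integral>\<^sup>+z\<in>torus_cell. (\<integral>\<^sup>+k. F (z + torus_period k) \<partial>count_space UNIV) \<partial>lborel)
     = (\<integral>\<^sup>+z. (\<integral>\<^sup>+k. F (z + torus_period k) * indicator torus_cell z \<partial>count_space UNIV) \<partial>lborel)"
    by (intro nn_integral_cong) (auto simp: indicator_def)
  also have "\<dots> = (\<integral>\<^sup>+k. (\<integral>\<^sup>+z. F (z + torus_period k) * indicator torus_cell z \<partial>lborel) \<partial>count_space UNIV)"
    by (rule nn_integral_count_space_nn_integral) auto
  also have "\<dots> = (\<integral>\<^sup>+k. (\<integral>\<^sup>+z. F z * indicator torus_cell (z - torus_period k) \<partial>lborel) \<partial>count_space UNIV)"
  proof (rule nn_integral_cong)
    fix k :: "int ^ 'n"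
    show "(\<integral>\<^sup>+z. F (z + torus_period k) * indicator torus_cell z \<partial>lborel) = (\<integral>\<^sup>+z. F z * indicator torus_cell (z - torus_period k) \<partial>lborel)"
      using nn_integral_lborel_shift[of "\<lambda>z. F z * indicator torus_cell (z - torus_period k)" "torus_period k"] by simp
  qed
  also have "\<dots> = (\<integral>\<^sup>+z. (\<integral>\<^sup>+k. F z * indicator torus_cell (z - torus_period k) \<partial>count_space UNIV) \<partial>lborel)"
    by (rule nn_integral_count_space_nn_integral[symmetric]) auto
  also have "\<dots> = (\<integral>\<^sup>+z. F z \<partial>lborel)"
  proof (rule nn_integral_cong)
    fix z :: "real ^ 'n"
    obtain k where k: "\<And>l. z - torus_period l \<in> torus_cell \<longleftrightarrow> l = k"
      using ex1_period_cell[of z] by blast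
    have "(\<integral>\<^sup>+k. F z * indicator torus_cell (z - torus_period k) \<partial>count_space UNIV) = (\<integral>\<^sup>+l. F z * indicator {k} l \<partial>count_space UNIV)"
      by (intro nn_integral_cong) (auto simp: indicator_def k)
    then show "(\<integral>\<^sup>+k. F z * indicator torus_cell (z - torus_period k) \<partial>count_space UNIV) = F z"
      by simp
  qed
  finally show ?thesis .
qed

lemma nn_integral_count_space_infsum:
  fixes a :: "'a \<Rightarrow> real"
  assumes "a summable_on A" "\<And>x. x \<in> A \<Longrightarrow> a x \<ge> 0"
  shows "(\<integral>\<^sup>+x. ennreal (a x) \<partial>count_space A) = ennreal (infsum a A)"
proof -
  have "(\<lambda>x. norm (a x)) summable_on A"
    using assms by (subst summable_on_cong[of A _ a]) auto
  then have "Infinite_Set_Sum.abs_summable_on a A"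
    using abs_summable_equivalent by blast
  then show ?thesis
    using nn_integral_conv_infsetsum infsetsum_infsum assms by metis
qed

text \<open>\<open>infsum\<close> is a limit along the net of finite sets, for which measurability
  is not automatic. A nonnegative sum is also an integral against counting measure, and over a
  countable index type that integral is measurable in the parameter.\<close>

lemma borel_measurable_infsum_nonneg:
  fixes f :: "'k::countable \<Rightarrow> 'a \<Rightarrow> real"
  assumes [measurable]: "\<And>k. f k \<in> borel_measurable M"
    and "\<And>k x. f k x \<ge> 0" "\<And>x. (\<lambda>k. f k x) summable_on UNIV"
  shows "(\<lambda>x. \<Sum>\<^sub>\<infinity>k. f k x) \<in> borel_measurable M"
proof -
  have "(\<Sum>\<^sub>\<infinity>k. f k x) = enn2real (\<integral>\<^sup>+k. ennreal (f k x) \<partial>count_space UNIV)" for x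
    using assms by (subst nn_integral_count_space_infsum) (auto simp: infsum_nonneg)
  moreover have "(\<lambda>x. \<integral>\<^sup>+k. ennreal (f k x) \<partial>count_space UNIV) \<in> borel_measurable M"
  proof (rule sigma_finite_measure.borel_measurable_nn_integral)
    show "sigma_finite_measure (count_space (UNIV :: 'k set))" by (rule sigma_finite_measure_count_space)
    show "(\<lambda>(x, k). ennreal (f k x)) \<in> borel_measurable (M \<Otimes>\<^sub>M count_space UNIV)"
      by (rule measurable_pair_swap[of "\<lambda>(k, x). ennreal (f k x)", simplified]) (auto intro!: measurable_pair_measure_countable1)
  qed
  ultimately show ?thesis by simp
qed

lemma nn_integral_periodic_unfold:
  fixes w a :: "real ^ 'n \<Rightarrow> real"
  assumes [measurable]: "w \<in> borel_measurable borel" "a \<in> borel_measurable borel"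
    and w: "torus_periodic w" "\<And>z. w z \<ge> 0"
    and a: "\<And>z. a z \<ge> 0" "\<And>z. (\<lambda>k. a (z + torus_period k)) summable_on UNIV"
  shows "(\<integral>\<^sup>+z\<in>torus_cell. ennreal (w z * (\<Sum>\<^sub>\<infinity>k. a (z + torus_period k))) \<partial>lborel) = (\<integral>\<^sup>+z. ennreal (w z * a z) \<partial>lborel)"
proof -
  have "(\<integral>\<^sup>+z. ennreal (w z * a z) \<partial>lborel) = (\<integral>\<^sup>+z\<in>torus_cell. (\<integral>\<^sup>+k. ennreal (w (z + torus_period k) * a (z + torus_period k)) \<partial>count_space UNIV) \<partial>lborel)"
    by (rule nn_integral_unfold[symmetric]) measurable
  also have "\<dots> = (\<integral>\<^sup>+z\<in>torus_cell. ennreal (w z * (\<Sum>\<^sub>\<infinity>k. a (z + torus_period k))) \<partial>lborel)"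
  proof (rule nn_integral_cong)
    fix z :: "real ^ 'n"
    have "(\<integral>\<^sup>+k. ennreal (w (z + torus_period k) * a (z + torus_period k)) \<partial>count_space UNIV)
      = (\<integral>\<^sup>+k. ennreal (w z) * ennreal (a (z + torus_period k)) \<partial>count_space UNIV)"
      by (simp add: torus_periodicD[OF w(1)] ennreal_mult' w(2))
    also have "\<dots> = ennreal (w z) * ennreal (\<Sum>\<^sub>\<infinity>k. a (z + torus_period k))"
      using a by (subst nn_integral_cmult) (auto simp: nn_integral_count_space_infsum)
    finally show "(\<integral>\<^sup>+k. ennreal (w (z + torus_period k) * a (z + torus_period k)) \<partial>count_space UNIV) * indicator torus_cell z
      = ennreal (w z * (\<Sum>\<^sub>\<infinity>k. a (z + torus_period k))) * indicator torus_cell z"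
      by (simp add: ennreal_mult' w(2))
  qed
  finally show ?thesis ..
qed

text \<open>The signed version: the absolute value of the weight gives integrability, and its
  positive and negative parts give the value.\<close>

lemma integral_periodic_unfold:
  fixes w a :: "real ^ 'n \<Rightarrow> real"
  assumes [measurable]: "w \<in> borel_measurable borel" "a \<in> borel_measurable borel"
    and w: "torus_periodic w"
    and a: "\<And>z. a z \<ge> 0" "\<And>z. (\<lambda>k. a (z + torus_period k)) summable_on UNIV"
    and int: "integrable lborel (\<lambda>z. w z * a z)"
  shows "set_integrable lborel torus_cell (\<lambda>z. w z * (\<Sum>\<^sub>\<infinity>k. a (z + torus_period k)))"
    and "(LINT z:torus_cell|lborel. w z * (\<Sum>\<^sub>\<infinity>k. a (z + torus_period k))) = (LINT z|lborel. w z * a z)"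
proof -
  define A where "A = (\<lambda>z. \<Sum>\<^sub>\<infinity>k. a (z + torus_period k))"
  have [measurable]: "A \<in> borel_measurable borel"
    unfolding A_def by (rule borel_measurable_infsum_nonneg) (use a in auto)
  have A0: "A z \<ge> 0" for z
    unfolding A_def by (intro infsum_nonneg a)
  \<comment> \<open>One statement serves three times, with \<open>g\<close> the absolute value, the
    positive part and the negative part.\<close>
  have *: "(\<integral>\<^sup>+z. ennreal (indicator torus_cell z * (g (w z) * A z)) \<partial>lborel) = (\<integral>\<^sup>+z. ennreal (g (w z) * a z) \<partial>lborel)"
    if [measurable]: "g \<in> borel_measurable borel" and "\<And>t. g t \<ge> 0" for g
  proof -
    have "torus_periodic (\<lambda>z. g (w z))" using w by (simp add: torus_periodic_iff)
    then have "(\<integral>\<^sup>+z\<in>torus_cell. ennreal (g (w z) * A z) \<partial>lborel) = (\<integral>\<^sup>+z. ennreal (g (w z) * a z) \<partial>lborel)"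
      unfolding A_def by (intro nn_integral_periodic_unfold a) (use that in auto)
    moreover have "(\<integral>\<^sup>+z\<in>torus_cell. ennreal (g (w z) * A z) \<partial>lborel) = (\<integral>\<^sup>+z. ennreal (indicator torus_cell z * (g (w z) * A z)) \<partial>lborel)"
      by (intro nn_integral_cong) (auto simp: indicator_def)
    ultimately show ?thesis by simp
  qed
  have nrm: "norm (indicator torus_cell z *\<^sub>R (w z * A z)) = indicator torus_cell z * (\<bar>w z\<bar> * A z)" for z
    using A0 by (auto simp: indicator_def abs_mult)
  have I: "integrable lborel (\<lambda>z. indicator torus_cell z *\<^sub>R (w z * A z))"
    unfolding integrable_iff_bounded nrm
  proof
    have "(\<integral>\<^sup>+z. ennreal (indicator torus_cell z * (\<bar>w z\<bar> * A z)) \<partial>lborel) = (\<integral>\<^sup>+z. ennreal (norm (w z * a z)) \<partial>lborel)"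
      using *[of abs] a by (simp add: abs_mult)
    also have "\<dots> < \<infinity>" using int unfolding integrable_iff_bounded by simp
    finally show "(\<integral>\<^sup>+z. ennreal (indicator torus_cell z * (\<bar>w z\<bar> * A z)) \<partial>lborel) < \<infinity>" .
  qed measurable
  then show "set_integrable lborel torus_cell (\<lambda>z. w z * (\<Sum>\<^sub>\<infinity>k. a (z + torus_period k)))"
    unfolding set_integrable_def A_def .
  have pos: "ennreal (indicator torus_cell z *\<^sub>R (w z * A z)) = ennreal (indicator torus_cell z * (max 0 (w z) * A z))" for z
    using A0[of z] by (cases "w z \<ge> 0") (auto simp: indicator_def max_def ennreal_neg mult_nonpos_nonneg)
  have neg: "ennreal (- (indicator torus_cell z *\<^sub>R (w z * A z))) = ennreal (indicator torus_cell z * (max 0 (- w z) * A z))" for z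
    using A0[of z] by (cases "w z \<ge> 0") (auto simp: indicator_def max_def ennreal_neg mult_nonpos_nonneg)
  have pos': "ennreal (w z * a z) = ennreal (max 0 (w z) * a z)" and neg': "ennreal (- (w z * a z)) = ennreal (max 0 (- w z) * a z)" for z
    using a(1)[of z] by (cases "w z \<ge> 0"; auto simp: max_def ennreal_neg mult_nonpos_nonneg)+
  have "(LINT z:torus_cell|lborel. w z * A z) = (LINT z|lborel. w z * a z)"
    unfolding set_lebesgue_integral_def real_lebesgue_integral_def[OF I] real_lebesgue_integral_def[OF int] pos neg pos' neg'
    by (simp only: *[of "\<lambda>t. max 0 t", simplified] *[of "\<lambda>t. max 0 (- t)", simplified])
  then show "(LINT z:torus_cell|lborel. w z * (\<Sum>\<^sub>\<infinity>k. a (z + torus_period k))) = (LINT z|lborel. w z * a z)"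
    unfolding A_def .
qed

section \<open>Integrability of the kernel and lattice sums\<close>

lemma suminf_geometric_powr_finite:
  fixes c d :: real
  assumes "c \<ge> 0" "d > 0"
  shows "(\<Sum>j. ennreal (c * 2 powr (- (real j * d)))) < \<infinity>"
proof -
  have eq: "2 powr (- (real j * d)) = (2 powr (- d)) ^ j" for j
    by (simp add: powr_realpow[symmetric] powr_powr mult.commute)
  have "summable (\<lambda>j. c * 2 powr (- (real j * d)))"
    unfolding eq using assms by (intro summable_mult summable_geometric) (auto simp: powr_less_one)
  then show ?thesis
    using assms by (intro ennreal_suminf_neq_top[THEN top.not_eq_extremum[THEN iffD1], folded infinity_ennreal_def]) auto
qed

lemma ennreal_le_suminf: "f j \<le> (\<Sum>j. f j)" for f :: "nat \<Rightarrow> ennreal"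
  using sum_le_suminf[of f "{j}"] by simp

text \<open>Dyadic shells, each enlarged to a ball. For |y| about 2^j the integrand is at most
  2^(-j(n+\<gamma>)), and the ball volume leaves a geometric series in 2^(-\<gamma>). For |y| about
  2^(-j) the numerator contributes 2^(-j\<beta>), which leaves a geometric series in
  2^(-(\<beta>-\<gamma>)). The two hypotheses are exactly the convergence of these series.\<close>

lemma nn_integral_min_power_finite:
  fixes \<beta> \<gamma> :: real
  assumes "0 < \<gamma>" "\<gamma> < \<beta>"
  shows "(\<integral>\<^sup>+y. ennreal (min 1 (norm y powr \<beta>) / norm (y::'a::euclidean_space) powr (DIM('a) + \<gamma>)) \<partial>lborel) < \<infinity>"
proof -
  let ?n = "real DIM('a)"
  let ?f = "\<lambda>y::'a. min 1 (norm y powr \<beta>) / norm y powr (?n + \<gamma>)"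
  let ?c = "\<lambda>j. 2 powr (- (real j * (?n + \<gamma>)))"
  let ?d = "\<lambda>j. 2 powr (- (real j * \<beta>) + (real j + 1) * (?n + \<gamma>))"
  have pt: "ennreal (?f y) \<le> (\<Sum>j. ennreal (?c j) * indicator (ball 0 (2 powr (real j + 1))) y)
      + (\<Sum>j. ennreal (?d j) * indicator (ball 0 (2 powr (- real j))) y)" for y :: 'a
  proof (cases "y = 0")
    case False
    define l where "l = log 2 (norm y)"
    have ny: "norm y = 2 powr l" using False by (simp add: l_def)
    show ?thesis
    proof (cases "l \<ge> 0")
      case True
      define j where "j = nat \<lfloor>l\<rfloor>"
      have j: "real j \<le> l" "l < real j + 1" using True unfolding j_def by linarith+
      have "?f y \<le> 1 / norm y powr (?n + \<gamma>)" by (intro divide_right_mono) auto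
      also have "\<dots> = 2 powr (- (l * (?n + \<gamma>)))" by (simp only: ny powr_powr powr_minus_divide)
      also have "\<dots> \<le> ?c j"
        using j assms by (intro powr_mono) (auto intro!: mult_right_mono)
      finally have "ennreal (?f y) \<le> ennreal (?c j)" by (rule ennreal_leI)
      also have "\<dots> = ennreal (?c j) * indicator (ball 0 (2 powr (real j + 1))) y"
        using j by (simp add: ny)
      also have "\<dots> \<le> (\<Sum>j. ennreal (?c j) * indicator (ball 0 (2 powr (real j + 1))) y)"
        by (rule ennreal_le_suminf)
      finally show ?thesis by (simp add: add_increasing2)
    next
      case False
      \<comment> \<open>The ceiling minus one, and not the floor, because the ball of radius 2^(-j)
        is open: |y| < 2^(-j) has to be strict.\<close>
      define j where "j = nat (\<lceil>- l\<rceil> - 1)"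
      have j: "- (real j + 1) \<le> l" "l < - real j" using False unfolding j_def by linarith+
      have "?f y \<le> norm y powr \<beta> / norm y powr (?n + \<gamma>)" by (intro divide_right_mono) auto
      also have "\<dots> = 2 powr (l * \<beta> + (- l) * (?n + \<gamma>))"
        by (simp only: ny powr_powr powr_diff[symmetric]) simp
      also have "\<dots> \<le> ?d j"
      proof (intro powr_mono add_mono)
        show "l * \<beta> \<le> - (real j * \<beta>)" using j assms mult_right_mono[of l "- real j" \<beta>] by simp
        show "- l * (?n + \<gamma>) \<le> (real j + 1) * (?n + \<gamma>)" using j assms by (intro mult_right_mono) auto
      qed simp
      finally have "ennreal (?f y) \<le> ennreal (?d j)" by (rule ennreal_leI)
      also have "\<dots> = ennreal (?d j) * indicator (ball 0 (2 powr (- real j))) y"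
        using j by (simp add: ny)
      also have "\<dots> \<le> (\<Sum>j. ennreal (?d j) * indicator (ball 0 (2 powr (- real j))) y)"
        by (rule ennreal_le_suminf)
      finally show ?thesis by (simp add: add_increasing)
    qed
  qed simp
  define \<omega> where "\<omega> = unit_ball_vol ?n"
  have \<omega>: "\<omega> \<ge> 0" by (simp add: \<omega>_def)
  have "(\<integral>\<^sup>+y. ennreal (?f y) \<partial>lborel) \<le> (\<integral>\<^sup>+y. ((\<Sum>j. ennreal (?c j) * indicator (ball 0 (2 powr (real j + 1))) y)
      + (\<Sum>j. ennreal (?d j) * indicator (ball 0 (2 powr (- real j))) (y::'a))) \<partial>lborel)"
    by (intro nn_integral_mono pt)
  also have "\<dots> = (\<Sum>j. ennreal (?c j) * emeasure lborel (ball (0::'a) (2 powr (real j + 1))))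
     + (\<Sum>j. ennreal (?d j) * emeasure lborel (ball (0::'a) (2 powr (- real j))))"
    proof -
    have M: "(\<lambda>y. ennreal (c j) * indicator (ball (0::'a) (r j)) y) \<in> borel_measurable lborel" for c r :: "nat \<Rightarrow> real" and j
      by (intro borel_measurable_times_ennreal borel_measurable_indicator borel_measurable_const) simp
    have S: "(\<lambda>y. \<Sum>j. ennreal (c j) * indicator (ball (0::'a) (r j)) y) \<in> borel_measurable lborel" for c r :: "nat \<Rightarrow> real"
      by (intro borel_measurable_suminf_order M)
    have "(\<integral>\<^sup>+y. (\<Sum>j. ennreal (c j) * indicator (ball (0::'a) (r j)) y) \<partial>lborel) = (\<Sum>j. ennreal (c j) * emeasure lborel (ball (0::'a) (r j)))" for c r :: "nat \<Rightarrow> real"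
    proof -
      have "(\<integral>\<^sup>+y. (\<Sum>j. ennreal (c j) * indicator (ball (0::'a) (r j)) y) \<partial>lborel)
        = (\<Sum>j. \<integral>\<^sup>+y. ennreal (c j) * indicator (ball (0::'a) (r j)) y \<partial>lborel)"
        by (rule nn_integral_suminf) (rule M)
      then show ?thesis by (simp add: nn_integral_cmult_indicator)
    qed
    then show ?thesis by (subst nn_integral_add, intro S, intro S) simp
  qed
  also have "\<dots> = (\<Sum>j. ennreal (\<omega> * 2 powr ?n * 2 powr (- (real j * \<gamma>)))) + (\<Sum>j. ennreal (\<omega> * 2 powr (?n + \<gamma>) * 2 powr (- (real j * (\<beta> - \<gamma>)))))"
  proof (intro arg_cong2[of _ _ _ _ "(+)"] arg_cong[of _ _ suminf] ext)
    fix j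
    have ball: "ennreal c * emeasure lborel (ball (0::'a) r) = ennreal (\<omega> * (c * r powr ?n))" if "c \<ge> 0" "r > 0" for c r
      using that \<omega> by (simp add: emeasure_ball \<omega>_def[symmetric] ennreal_mult'[symmetric] powr_realpow mult_ac)
    have e: "- (real j * (?n + \<gamma>)) + (real j + 1) * ?n = ?n + - (real j * \<gamma>)"
      by (simp add: algebra_simps)
    have "\<omega> * (?c j * (2 powr (real j + 1)) powr ?n) = \<omega> * 2 powr ?n * 2 powr (- (real j * \<gamma>))"
      unfolding powr_powr powr_add[symmetric] e mult.assoc ..
    then show "ennreal (?c j) * emeasure lborel (ball (0::'a) (2 powr (real j + 1))) = ennreal (\<omega> * 2 powr ?n * 2 powr (- (real j * \<gamma>)))"
      by (subst ball) (auto simp: mult.assoc)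
    have e: "(- (real j * \<beta>) + (real j + 1) * (?n + \<gamma>)) + (- real j) * ?n = (?n + \<gamma>) + - (real j * (\<beta> - \<gamma>))"
      by (simp add: algebra_simps)
    have "\<omega> * (?d j * (2 powr (- real j)) powr ?n) = \<omega> * 2 powr (?n + \<gamma>) * 2 powr (- (real j * (\<beta> - \<gamma>)))"
      unfolding powr_powr powr_add[symmetric] e mult.assoc ..
    then show "ennreal (?d j) * emeasure lborel (ball (0::'a) (2 powr (- real j))) = ennreal (\<omega> * 2 powr (?n + \<gamma>) * 2 powr (- (real j * (\<beta> - \<gamma>))))"
      by (subst ball) (auto simp: mult.assoc)
  qed
  also have "\<dots> < \<infinity>"
  proof -
    have "(\<Sum>j. ennreal (\<omega> * 2 powr ?n * 2 powr (- (real j * \<gamma>)))) < \<infinity>" (is "?A < \<infinity>")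
      by (rule suminf_geometric_powr_finite) (use \<omega> assms in auto)
    moreover have "(\<Sum>j. ennreal (\<omega> * 2 powr (?n + \<gamma>) * 2 powr (- (real j * (\<beta> - \<gamma>))))) < \<infinity>" (is "?B < \<infinity>")
      by (rule suminf_geometric_powr_finite) (use \<omega> assms in auto)
    ultimately show "?A + ?B < \<infinity>" by (simp only: infinity_ennreal_def ennreal_add_less_top)
  qed
  finally show ?thesis .
qed

lemma integrable_min_power:
  fixes \<beta> \<gamma> :: real
  assumes "0 < \<gamma>" "\<gamma> < \<beta>"
  shows "integrable lborel (\<lambda>y::'a::euclidean_space. min 1 (norm y powr \<beta>) / norm y powr (DIM('a) + \<gamma>))"
  by (rule integrableI_nonneg) (use nn_integral_min_power_finite[OF assms, where 'a='a] in auto)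

lemma norm_torus_period_ge: "2 * pi \<le> norm (torus_period k)" if "k \<noteq> 0"
proof -
  obtain i where "k $ i \<noteq> 0" using \<open>k \<noteq> 0\<close> by (auto simp: vec_eq_iff)
  then have "1 \<le> \<bar>real_of_int (k $ i)\<bar>" by linarith
  then have "2 * pi * 1 \<le> \<bar>torus_period k $ i\<bar>"
    unfolding torus_period_nth abs_mult by (intro mult_mono) auto
  also have "\<dots> \<le> norm (torus_period k)" by (rule component_le_norm_cart)
  finally show ?thesis by simp
qed

text \<open>Lattice points are at least 2 pi apart, so at most one translate of x comes closer than
  pi to the origin. The gap is the norm of that translate, or pi if there is none or if it is the
  origin itself.\<close>

lemma torus_period_gap:
  obtains \<rho> where "\<rho> > 0" "\<And>k. x + torus_period k \<noteq> 0 \<Longrightarrow> \<rho> \<le> norm (x + torus_period k)"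
proof (cases "\<exists>k. norm (x + torus_period k) < pi")
  case False
  then show ?thesis by (intro that[of pi]) (auto simp: not_less)
next
  case True
  then obtain k where k: "norm (x + torus_period k) < pi" by blast
  have far: "pi \<le> norm (x + torus_period l)" if "l \<noteq> k" for l
  proof -
    have "x + torus_period l = (x + torus_period k) + torus_period (l - k)"
      by (simp add: torus_period_diff)
    then have "norm (torus_period (l - k)) \<le> norm (x + torus_period l) + norm (x + torus_period k)"
      using norm_triangle_ineq4[of "x + torus_period l" "x + torus_period k"] by simp
    then show ?thesis using norm_torus_period_ge[of "l - k"] k that by simp
  qed
  define \<rho> where "\<rho> = (if x + torus_period k = 0 then pi else norm (x + torus_period k))"
  show ?thesis
  proof (rule that[of \<rho>])
    show "\<rho> > 0" by (auto simp: \<rho>_def)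
    fix l assume "x + torus_period l \<noteq> 0"
    then show "\<rho> \<le> norm (x + torus_period l)"
      using far[of l] k by (cases "l = k") (auto simp: \<rho>_def)
  qed
qed

text \<open>Averaging replaces the counting of lattice points. The integral over the cell of the
  periodized function \<open>g\<close> equals the integral of \<open>g\<close> over the whole space,
  which is finite, so the lattice sum is finite at some point \<open>z0\<close>. A termwise
  comparison carries this from \<open>z0\<close> to x.\<close>

lemma lattice_sum_summable:
  fixes x :: "real ^ 'n" and s :: real
  assumes "s > CARD('n)"
  shows "(\<lambda>k. 1 / norm (x + torus_period k) powr s) summable_on UNIV"
proof -
  \<comment> \<open>The 1 in the denominator removes the singularity at the origin, which for s > n
    would not be integrable.\<close>
  define g where "g = (\<lambda>y::real^'n. 1 / (1 + norm y) powr s)"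
  have s0: "s > 0" using assms of_nat_0_le_iff[of "CARD('n)"] by linarith
  have [measurable]: "g \<in> borel_measurable borel" unfolding g_def by measurable
  have "CARD('n) > 0" by simp
  have gle: "g y \<le> min 1 (norm y powr s) / norm y powr s" if "y \<noteq> 0" for y
  proof -
    have "max 1 (norm y powr s) \<le> (1 + norm y) powr s"
      using s0 by (auto intro!: powr_mono2 ge_one_powr_ge_zero)
    then have "g y \<le> 1 / max 1 (norm y powr s)" unfolding g_def by (intro frac_le) auto
    also have "\<dots> = min 1 (norm y powr s) / norm y powr s" using that by (auto simp: max_def min_def)
    finally show ?thesis .
  qed
  have "(\<integral>\<^sup>+y. ennreal (g y) \<partial>lborel) \<le> (\<integral>\<^sup>+(y::real^'n). ennreal (min 1 (norm y powr s) / norm y powr s) \<partial>lborel)"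
    using AE_lborel_singleton[of "0::real^'n"]
    by (intro nn_integral_mono_AE) (auto elim!: eventually_mono intro!: ennreal_leI gle)
  also have "\<dots> < \<infinity>"
    using nn_integral_min_power_finite[of "s - CARD('n)" s, where 'a="real^'n"] assms by simp
  finally have fin: "(\<integral>\<^sup>+z\<in>torus_cell. (\<integral>\<^sup>+k. ennreal (g (z + torus_period k)) \<partial>count_space UNIV) \<partial>lborel) < \<infinity>"
    by (subst nn_integral_unfold) auto
  have "\<exists>z0. (\<integral>\<^sup>+k. ennreal (g (z0 + torus_period k)) \<partial>count_space UNIV) < \<infinity>"
  proof (rule ccontr)
    assume "\<not> ?thesis"
    then have "(\<integral>\<^sup>+k. ennreal (g (z + torus_period k)) \<partial>count_space UNIV) = \<infinity>" for z
      using top.not_eq_extremum by auto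
    then have "(\<integral>\<^sup>+z\<in>torus_cell. (\<integral>\<^sup>+k. ennreal (g (z + torus_period k)) \<partial>count_space UNIV) \<partial>lborel) = \<infinity> * emeasure lborel (torus_cell :: (real^'n) set)"
      by (simp add: nn_integral_cmult)
    also have "emeasure lborel (torus_cell :: (real^'n) set) \<noteq> 0"
    proof
      assume "emeasure lborel (torus_cell :: (real^'n) set) = 0"
      then have "measure lborel (torus_cell :: (real^'n) set) = 0" by (simp add: measure_def)
      then show False unfolding measure_torus_cell by simp
    qed
    then have "\<infinity> * emeasure lborel (torus_cell :: (real^'n) set) = \<infinity>" by (simp add: ennreal_top_mult)
    finally show False using fin by (simp only: less_irrefl)
  qed
  then obtain z0 where z0: "(\<integral>\<^sup>+k. ennreal (g (z0 + torus_period k)) \<partial>count_space UNIV) < \<infinity>" by blast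
  have "Infinite_Set_Sum.abs_summable_on (\<lambda>k. g (z0 + torus_period k)) UNIV"
    unfolding Infinite_Set_Sum.abs_summable_on_def using z0 by (intro integrableI_nonneg) (auto simp: g_def)
  then have sg: "(\<lambda>k. norm (g (z0 + torus_period k))) summable_on UNIV"
    unfolding abs_summable_equivalent[symmetric] .
  obtain \<rho> where \<rho>: "\<rho> > 0" "\<And>k. x + torus_period k \<noteq> 0 \<Longrightarrow> \<rho> \<le> norm (x + torus_period k)"
    using torus_period_gap[of x] by blast
  define d where "d = 1 + norm (z0 - x)"
  \<comment> \<open>A nonzero term has r \<ge> \<open>\<rho>\<close>, hence d \<le> d r / \<rho> and
    d + r \<le> (1 + d / \<rho>) r. A term with r = 0 is harmless because
    \<open>1 / 0 = 0\<close>.\<close>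
  define C where "C = 1 + d / \<rho>"
  have d: "d > 0" by (simp add: d_def add_pos_nonneg)
  have C: "C > 0" using d \<rho> by (simp add: C_def add_pos_pos)
  show ?thesis
  proof (rule summable_on_comparison_test)
    show "(\<lambda>k. C powr s * norm (g (z0 + torus_period k))) summable_on UNIV"
      by (intro summable_on_cmult_right sg)
    fix k :: "int ^ 'n"
    let ?r = "norm (x + torus_period k)"
    show "1 / ?r powr s \<le> C powr s * norm (g (z0 + torus_period k))"
    proof (cases "?r = 0")
      case False
      have "1 + norm (z0 + torus_period k) \<le> d + ?r"
        using norm_triangle_ineq[of "z0 - x" "x + torus_period k"] by (simp add: d_def)
      also have "d \<le> d * (?r / \<rho>)" using d \<rho> False by (simp add: field_simps)
      then have "d + ?r \<le> C * ?r" by (simp add: C_def algebra_simps)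
      finally have "(1 + norm (z0 + torus_period k)) powr s \<le> (C * ?r) powr s"
        using s0 by (intro powr_mono2) auto
      also have "\<dots> = C powr s * ?r powr s" using C by (simp add: powr_mult)
      finally have *: "(1 + norm (z0 + torus_period k)) powr s \<le> C powr s * ?r powr s" .
      have "1 + norm (z0 + torus_period k) > 0" by (simp add: add_pos_nonneg)
      then have "(1 + norm (z0 + torus_period k)) powr s > 0" by simp
      then show ?thesis using * False by (simp add: g_def field_simps)
    qed (simp add: g_def)
  qed auto
qed

section \<open>The quotient distance of the torus\<close>

lemma torus_dist_eq: "torus_dist x y = (INF k. norm (x - y + torus_period k))"
  by (simp add: torus_dist_def torus_period_def)

lemma torus_dist_le: "torus_dist x y \<le> norm (x - y + torus_period k)"
  unfolding torus_dist_eq by (intro cINF_lower) (auto intro!: bdd_belowI[of _ 0])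

lemma torus_dist_le_norm: "torus_dist x y \<le> norm (x - y)"
  using torus_dist_le[of x y 0] by simp

lemma torus_dist_ge: "(\<And>k. d \<le> norm (x - y + torus_period k)) \<Longrightarrow> d \<le> torus_dist x y"
  unfolding torus_dist_eq by (intro cINF_greatest) auto

lemma torus_dist_shift_right: "torus_dist x (y + torus_period k) = torus_dist x y"
proof (rule antisym; rule torus_dist_ge)
  fix l show "torus_dist x (y + torus_period k) \<le> norm (x - y + torus_period l)"
    using torus_dist_le[of x "y + torus_period k" "l + k"] by (simp add: torus_period_add algebra_simps)
  show "torus_dist x y \<le> norm (x - (y + torus_period k) + torus_period l)"
    using torus_dist_le[of x y "l - k"] by (simp add: torus_period_diff algebra_simps)
qed

lemma torus_dist_commute: "torus_dist x y = torus_dist y x"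
proof -
  have "torus_dist x y \<le> torus_dist y x" for x y :: "real ^ 'n"
  proof (rule torus_dist_ge)
    fix k show "torus_dist x y \<le> norm (y - x + torus_period k)"
      using torus_dist_le[of x y "- k"] norm_minus_commute[of "y + torus_period k" x] by (simp add: torus_period_minus algebra_simps)
  qed
  then show ?thesis by (intro antisym)
qed

lemma torus_dist_pos:
  assumes "\<And>k. x - y + torus_period k \<noteq> 0"
  shows "torus_dist x y > 0"
proof -
  obtain \<rho> where "\<rho> > 0" "\<And>k. x - y + torus_period k \<noteq> 0 \<Longrightarrow> \<rho> \<le> norm (x - y + torus_period k)"
    using torus_period_gap[of "x - y"] by blast
  then have "\<rho> \<le> torus_dist x y" using assms by (intro torus_dist_ge) auto
  then show ?thesis using \<open>\<rho> > 0\<close> by simp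
qed

text \<open>An infimum of 1-Lipschitz functions is 1-Lipschitz, hence continuous.\<close>

lemma torus_dist_borel [measurable]: "(\<lambda>z. torus_dist x z) \<in> borel_measurable borel"
proof (rule borel_measurable_continuous_onI)
  have le: "torus_dist x z \<le> torus_dist x z' + norm (z - z')" for z z'
  proof -
    have "torus_dist x z - norm (z - z') \<le> torus_dist x z'"
    proof (rule torus_dist_ge)
      fix k
      have "norm (x - z + torus_period k) \<le> norm (x - z' + torus_period k) + norm (z - z')"
        using norm_triangle_ineq[of "x - z' + torus_period k" "z' - z"] by (simp add: algebra_simps norm_minus_commute)
      then show "torus_dist x z - norm (z - z') \<le> norm (x - z' + torus_period k)"
        using torus_dist_le[of x z k] by simp
    qed
    then show ?thesis by simp
  qed
  show "continuous_on UNIV (\<lambda>z. torus_dist x z)"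
    unfolding continuous_on_iff
  proof (intro ballI allI impI)
    fix z and e :: real assume "e > 0"
    have "dist (torus_dist x z') (torus_dist x z) \<le> dist z' z" for z'
      using le[of z z'] le[of z' z] by (simp add: dist_norm norm_minus_commute abs_le_iff)
    then show "\<exists>d>0. \<forall>z'\<in>UNIV. dist z' z < d \<longrightarrow> dist (torus_dist x z') (torus_dist x z) < e"
      using \<open>e > 0\<close> by (intro exI[of _ e]) (auto intro: le_less_trans)
  qed
qed

section \<open>Fourier series on the torus\<close>

abbreviation torus_integral :: "(real ^ 'n \<Rightarrow> 'b::{banach, second_countable_topology}) \<Rightarrow> 'b"
  where "torus_integral f \<equiv> (LINT z:torus_cell|lborel. f z)"

definition torus_char :: "int ^ 'n \<Rightarrow> real ^ 'n \<Rightarrow> complex"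
  where "torus_char k z = exp (\<i> * complex_of_real (int_to_real_vec k \<bullet> z))"

lemma torus_char_add_arg: "torus_char k (x + y) = torus_char k x * torus_char k y"
  by (simp add: torus_char_def inner_add_right distrib_left exp_add)

lemma torus_char_add: "torus_char (k + l) z = torus_char k z * torus_char l z"
  by (simp add: torus_char_def int_to_real_vec_def inner_vec_def distrib_left distrib_right sum.distrib exp_add)

lemma torus_char_0 [simp]: "torus_char 0 z = 1" "torus_char k 0 = 1"
  by (simp_all add: torus_char_def int_to_real_vec_def inner_vec_def)

lemma torus_char_minus_arg: "torus_char k (- z) = torus_char (- k) z"
  by (simp add: torus_char_def int_to_real_vec_def inner_vec_def)

lemma torus_char_minus_mult: "torus_char k z * torus_char (- k) z = 1"
  using torus_char_add[of k "- k" z] by simp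

lemma norm_torus_char [simp]: "norm (torus_char k z) = 1"
  by (simp add: torus_char_def)

lemma continuous_torus_char [continuous_intros]:
  "continuous_on A f \<Longrightarrow> continuous_on A (\<lambda>z. torus_char k (f z))"
  unfolding torus_char_def by (intro continuous_intros)

lemma torus_char_borel [measurable]: "torus_char k \<in> borel_measurable borel"
  by (intro borel_measurable_continuous_onI continuous_intros)

lemma torus_char_periodic: "torus_periodic (torus_char k)"
proof -
  have "torus_char k (torus_period l) = 1" for l
  proof -
    have "int_to_real_vec k \<bullet> torus_period l = of_int (\<Sum>i\<in>UNIV. k $ i * l $ i) * (2 * pi)"
      by (simp add: int_to_real_vec_def inner_vec_def sum_distrib_left mult_ac)
    then show ?thesis
      unfolding torus_char_def exp_eq_1
      by (auto intro!: exI[of _ "\<Sum>i\<in>UNIV. k $ i * l $ i"] simp del: of_int_sum)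
  qed
  then show ?thesis by (simp add: torus_periodic_iff torus_char_add_arg)
qed

lemma continuous_periodic_bounded:
  fixes f :: "real ^ 'n \<Rightarrow> 'b::real_normed_vector"
  assumes "continuous_on UNIV f" "torus_periodic f"
  obtains M where "M > 0" "\<And>z. norm (f z) \<le> M"
proof -
  have "compact (f ` cbox (\<chi> i. - pi) (\<chi> i. pi))"
    by (intro compact_continuous_image continuous_on_subset[OF assms(1)]) auto
  then obtain M where "M > 0" "\<And>z. z \<in> cbox (\<chi> i. - pi) (\<chi> i. pi) \<Longrightarrow> norm (f z) \<le> M"
    using compact_imp_bounded bounded_pos by (metis image_eqI)
  moreover have "norm (f z) \<le> M" for z
  proof -
    obtain k where "z - torus_period k \<in> torus_cell" using ex1_period_cell[of z] by blast
    then have "norm (f (z - torus_period k)) \<le> M" using calculation(2) torus_cell_subset by blast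
    then show ?thesis using torus_periodicD[OF assms(2), of "z - torus_period k" k] by simp
  qed
  ultimately show ?thesis using that by blast
qed

lemma set_integrable_torus_continuous:
  fixes f :: "real ^ 'n \<Rightarrow> 'b::{banach, second_countable_topology}"
  assumes "continuous_on UNIV f"
  shows "set_integrable lborel torus_cell f"
proof -
  have "compact (f ` cbox (\<chi> i. - pi) (\<chi> i. pi))"
    by (intro compact_continuous_image continuous_on_subset[OF assms(1)]) auto
  then obtain M where "\<And>z. z \<in> cbox (\<chi> i. - pi) (\<chi> i. pi) \<Longrightarrow> norm (f z) \<le> M"
    using compact_imp_bounded bounded_iff by (metis image_eqI)
  then have "\<And>z. z \<in> torus_cell \<Longrightarrow> norm (f z) \<le> M" using torus_cell_subset by blast
  then show ?thesis
    unfolding set_integrable_def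
    by (intro integrableI_bounded_set_indicator[where B=M])
      (use borel_measurable_continuous_onI[OF assms] emeasure_torus_cell_finite in auto)
qed

lemma norm_torus_integral_le:
  fixes f :: "real ^ 'n \<Rightarrow> 'b::{banach, second_countable_topology}"
  assumes "\<And>z. norm (f z) \<le> M"
  shows "norm (torus_integral f) \<le> M * (2 * pi) ^ CARD('n)"
proof -
  have M: "M \<ge> 0" using assms[of 0] norm_ge_zero order_trans by blast
  have "norm (torus_integral f) \<le> (LINT z|lborel. norm (indicator torus_cell z *\<^sub>R f z))"
    unfolding set_lebesgue_integral_def by (rule integral_norm_bound)
  also have "\<dots> \<le> (LINT z|lborel. indicator (torus_cell :: (real ^ 'n) set) z * M)"
  proof (rule integral_mono')
    show "integrable lborel (\<lambda>z. indicator (torus_cell :: (real ^ 'n) set) z * M)"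
      by (intro integrable_mult_left integrable_real_indicator) (use emeasure_torus_cell_finite in auto)
  qed (use M assms in \<open>auto simp: indicator_def\<close>)
  also have "\<dots> = M * (2 * pi) ^ CARD('n)" by (simp add: measure_torus_cell)
  finally show ?thesis .
qed

text \<open>The theorem speaks of \<open>lebesgue\<close>, while Fubini and translations are used
  for \<open>lborel\<close>. For Borel integrands the completion does not change the
  integral.\<close>

lemma torus_integral_lebesgue:
  fixes f :: "real ^ 'n \<Rightarrow> 'b::{banach, second_countable_topology}"
  assumes "f \<in> borel_measurable borel" and [measurable]: "A \<in> sets borel"
  shows "(LINT z:A|lebesgue. f z) = (LINT z:A|lborel. f z)"
  unfolding set_lebesgue_integral_def by (rule integral_completion) (use assms in measurable)

lemma cell_indicator_has_sum:
  "((\<lambda>k. indicator torus_cell (z + torus_period k)) has_sum (1::real)) UNIV" for z :: "real ^ 'n"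
proof -
  obtain k where k: "\<And>l. z - torus_period l \<in> torus_cell \<longleftrightarrow> l = k"
    using ex1_period_cell[of z] by blast
  have k': "z + torus_period l \<in> torus_cell \<longleftrightarrow> l = - k" for l
    using k[of "- l"] by (auto simp: torus_period_minus)
  show ?thesis
    by (rule has_sum_finite_neutralI[of "{- k}"]) (auto simp: indicator_def k')
qed

text \<open>The indicator of the cell translated by y has periodization 1, so inserting it under the
  integral changes nothing. Unfolding then gives an integral over the whole space, where translation
  is free.\<close>

lemma torus_integral_shift_real:
  fixes f :: "real ^ 'n \<Rightarrow> real"
  assumes c: "continuous_on UNIV f" and p: "torus_periodic f"
  shows "torus_integral (\<lambda>z. f (z + y)) = torus_integral f"
proof -
  have [measurable]: "f \<in> borel_measurable borel" by (rule borel_measurable_continuous_onI[OF c])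
  let ?a = "\<lambda>z. indicator torus_cell (z - y) :: real"
  have hs: "((\<lambda>k. ?a (z + torus_period k)) has_sum 1) UNIV" for z
    using cell_indicator_has_sum[of "z - y"] by (simp add: algebra_simps)
  have s1: "set_integrable lborel torus_cell (\<lambda>z. f (z + y))"
    by (rule set_integrable_torus_continuous) (intro continuous_on_compose2[OF c] continuous_intros, auto)
  have sh: "distr lborel borel ((+) y) = (lborel :: (real ^ 'n) measure)"
    by (rule lborel_distr_plus)
  have i: "integrable (distr lborel borel ((+) y)) (\<lambda>z. f z * ?a z)"
    by (subst integrable_distr_eq) (use s1 in \<open>auto simp: set_integrable_def mult.commute add.commute\<close>)
  have "torus_integral f = torus_integral (\<lambda>z. f z * (\<Sum>\<^sub>\<infinity>k. ?a (z + torus_period k)))"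
    using hs[THEN infsumI] by simp
  also have "\<dots> = (LINT z|lborel. f z * ?a z)"
    by (rule integral_periodic_unfold(2)) (use p i sh hs in \<open>auto simp: summable_on_def\<close>)
  also have "\<dots> = (LINT z|distr lborel borel ((+) y). f z * ?a z)" by (simp add: sh)
  also have "\<dots> = torus_integral (\<lambda>z. f (z + y))"
    unfolding set_lebesgue_integral_def by (subst integral_distr) (auto simp: mult.commute add.commute)
  finally show ?thesis ..
qed

lemma Re_torus_integral:
  "continuous_on UNIV f \<Longrightarrow> Re (torus_integral f) = torus_integral (\<lambda>z. Re (f z))"
  and Im_torus_integral:
  "continuous_on UNIV f \<Longrightarrow> Im (torus_integral f) = torus_integral (\<lambda>z. Im (f z))"
proof -
  assume "continuous_on UNIV f"
  then have i: "integrable lborel (\<lambda>z. indicator torus_cell z *\<^sub>R f z)"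
    using set_integrable_torus_continuous by (auto simp: set_integrable_def)
  show "Re (torus_integral f) = torus_integral (\<lambda>z. Re (f z))"
    unfolding set_lebesgue_integral_def integral_Re[OF i, symmetric] by simp
  show "Im (torus_integral f) = torus_integral (\<lambda>z. Im (f z))"
    unfolding set_lebesgue_integral_def integral_Im[OF i, symmetric] by simp
qed

lemma torus_integral_shift:
  fixes f :: "real ^ 'n \<Rightarrow> complex"
  assumes c: "continuous_on UNIV f" and p: "torus_periodic f"
  shows "torus_integral (\<lambda>z. f (z + y)) = torus_integral f"
proof -
  have c': "continuous_on UNIV (\<lambda>z. f (z + y))"
    by (intro continuous_on_compose2[OF c] continuous_intros) auto
  have "torus_integral (\<lambda>z. Re (f (z + y))) = torus_integral (\<lambda>z. Re (f z))"
    by (rule torus_integral_shift_real) (use p in \<open>auto intro!: continuous_intros c simp: torus_periodic_iff\<close>)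
  moreover have "torus_integral (\<lambda>z. Im (f (z + y))) = torus_integral (\<lambda>z. Im (f z))"
    by (rule torus_integral_shift_real) (use p in \<open>auto intro!: continuous_intros c simp: torus_periodic_iff\<close>)
  ultimately show ?thesis
    by (intro complex_eqI) (simp_all only: Re_torus_integral[OF c] Re_torus_integral[OF c'] Im_torus_integral[OF c] Im_torus_integral[OF c'])
qed

text \<open>For m \<noteq> 0 some translation multiplies the character by -1, so by invariance the
  integral equals its own negative.\<close>

lemma torus_integral_char:
  "torus_integral (torus_char (m :: int ^ 'n)) = (if m = 0 then (2 * pi) ^ CARD('n) else 0)"
proof (cases "m = 0")
  case True
  have "torus_integral (torus_char (0 :: int ^ 'n)) = complex_of_real (measure lborel (torus_cell :: (real ^ 'n) set))"
    using emeasure_torus_cell_finite[where 'n='n]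
    by (simp add: set_lebesgue_integral_def scaleR_conv_of_real flip: integral_complex_of_real)
  then show ?thesis using True by (simp add: measure_torus_cell)
next
  case False
  then obtain i where i: "m $ i \<noteq> 0" by (auto simp: vec_eq_iff)
  define y :: "real ^ 'n" where "y = axis i (pi / m $ i)"
  have "int_to_real_vec m \<bullet> y = pi"
    using i by (simp add: y_def inner_axis int_to_real_vec_def)
  then have y: "torus_char m y = - 1" by (simp add: torus_char_def)
  have "torus_integral (torus_char m) = torus_integral (\<lambda>z. torus_char m (z + y))"
    by (rule torus_integral_shift[symmetric]) (intro continuous_intros torus_char_periodic)+
  also have "\<dots> = - torus_integral (torus_char m)"
    by (simp add: torus_char_add_arg y set_lebesgue_integral_def)
  finally show ?thesis using False by simp
qed

text \<open>Uniform convergence along the net of finite index sets: this is the tool for exchanging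
  Fourier series with integrals over the torus.\<close>

lemma Weierstrass_torus:
  fixes f :: "'k \<Rightarrow> real ^ 'n \<Rightarrow> complex"
  assumes c: "\<And>k. continuous_on UNIV (f k)" and b: "\<And>k z. norm (f k z) \<le> b k" and s: "b summable_on UNIV"
  shows "continuous_on UNIV (\<lambda>z. \<Sum>\<^sub>\<infinity>k. f k z)"
    and "((\<lambda>k. torus_integral (f k)) has_sum torus_integral (\<lambda>z. \<Sum>\<^sub>\<infinity>k. f k z)) UNIV"
proof -
  let ?S = "\<lambda>z. \<Sum>\<^sub>\<infinity>k. f k z"
  have ul: "uniform_limit UNIV (\<lambda>X z. \<Sum>k\<in>X. f k z) ?S (finite_subsets_at_top UNIV)"
    by (rule Weierstrass_m_test_general) (use b s in auto)
  show cS: "continuous_on UNIV ?S"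
    by (rule uniform_limit_theorem[OF _ ul]) (auto intro!: always_eventually continuous_intros c)
  have eq: "(\<Sum>k\<in>X. torus_integral (f k)) = torus_integral (\<lambda>z. \<Sum>k\<in>X. f k z)" for X
    using set_integrable_torus_continuous[OF c]
    unfolding set_lebesgue_integral_def set_integrable_def by (simp add: scaleR_sum_right)
  \<comment> \<open>The volume of the cell plus 1, so that the final estimate is strict.\<close>
  define V where "V = (2 * pi) ^ CARD('n) + 1"
  have V: "V > 0" by (simp add: V_def add_nonneg_pos)
  show "((\<lambda>k. torus_integral (f k)) has_sum torus_integral ?S) UNIV"
    unfolding has_sum_def eq
  proof (rule tendstoI)
    fix e :: real assume "e > 0"
    then have "e / V > 0" using V by simp
    note ul[unfolded uniform_limit_iff, rule_format, OF this]
    then show "\<forall>\<^sub>F X in finite_subsets_at_top UNIV. dist (torus_integral (\<lambda>z. \<Sum>k\<in>X. f k z)) (torus_integral ?S) < e"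
    proof eventually_elim
      case (elim X)
      have cX: "continuous_on UNIV (\<lambda>z. \<Sum>k\<in>X. f k z)" by (intro continuous_intros c)
      have "norm (torus_integral (\<lambda>z. (\<Sum>k\<in>X. f k z) - ?S z)) \<le> e / V * (2 * pi) ^ CARD('n)"
        by (rule norm_torus_integral_le) (use elim in \<open>auto simp: dist_norm less_imp_le\<close>)
      also have "\<dots> < e / V * V" using \<open>e > 0\<close> V by (intro mult_strict_left_mono) (auto simp: V_def)
      also have "\<dots> = e" using V by simp
      also have "torus_integral (\<lambda>z. (\<Sum>k\<in>X. f k z) - ?S z) = torus_integral (\<lambda>z. \<Sum>k\<in>X. f k z) - torus_integral ?S"
        by (intro set_integral_diff set_integrable_torus_continuous cX cS)
      finally show ?case by (simp add: dist_norm)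
    qed
  qed
qed

text \<open>Unnormalized and over \<open>lborel\<close>; it differs from
  \<open>fourier_coeff\<close> by the volume factor.\<close>

definition torus_fourier :: "(real ^ 'n \<Rightarrow> complex) \<Rightarrow> int ^ 'n \<Rightarrow> complex"
  where "torus_fourier f k = torus_integral (\<lambda>z. f z * torus_char (- k) z)"

lemma fourier_coeff_eq:
  fixes f :: "real ^ 'n \<Rightarrow> complex"
  assumes "continuous_on UNIV f"
  shows "fourier_coeff f k = torus_fourier f k / (2 * pi) ^ CARD('n)"
proof -
  have [measurable]: "f \<in> borel_measurable borel" by (rule borel_measurable_continuous_onI[OF assms])
  have "exp (- \<i> * complex_of_real (int_to_real_vec k \<bullet> z)) = torus_char (- k) z" for z
    by (simp add: torus_char_def int_to_real_vec_def inner_vec_def sum_negf)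
  then show ?thesis
    unfolding fourier_coeff_def torus_fourier_def by (subst torus_integral_lebesgue) auto
qed

section \<open>Derivatives and the decay of Fourier coefficients\<close>

lemma partial_deriv_has_vector_derivative:
  fixes f :: "real ^ 'n \<Rightarrow> 'b::real_normed_vector"
  assumes "\<And>x. (\<lambda>t. f (x + t *\<^sub>R axis i 1)) differentiable (at 0)"
  shows "((\<lambda>t. f (x + t *\<^sub>R axis i 1)) has_vector_derivative partial_deriv i f (x + s *\<^sub>R axis i 1)) (at s)"
proof -
  let ?y = "x + s *\<^sub>R axis i 1"
  have 1: "((\<lambda>t. f (?y + t *\<^sub>R axis i 1)) has_vector_derivative partial_deriv i f ?y) (at (s - s))"
    using assms[of ?y] unfolding partial_deriv_def by (simp add: vector_derivative_works)
  have "((\<lambda>t. t - s) has_vector_derivative 1) (at s)"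
    by (auto intro!: derivative_eq_intros simp flip: has_real_derivative_iff_has_vector_derivative)
  from vector_diff_chain_at[OF this 1]
  show ?thesis by (simp add: o_def algebra_simps)
qed

text \<open>The mean value inequality. It provides the constant that dominates the difference
  quotients of a translated function.\<close>

lemma norm_diff_le_partial_deriv:
  fixes f :: "real ^ 'n \<Rightarrow> 'b::real_inner"
  assumes d: "\<And>x. (\<lambda>t. f (x + t *\<^sub>R axis i 1)) differentiable (at 0)"
    and M: "\<And>z. norm (partial_deriv i f z) \<le> M" and "t > 0"
  shows "norm (f (x + t *\<^sub>R axis i 1) - f x) \<le> M * t"
proof -
  note D = partial_deriv_has_vector_derivative[OF d]
  have "\<exists>s\<in>{0<..<t}. norm (f (x + t *\<^sub>R axis i 1) - f (x + 0 *\<^sub>R axis i 1)) \<le> norm ((t - 0) *\<^sub>R partial_deriv i f (x + s *\<^sub>R axis i 1))"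
  proof (rule mvt_general[OF \<open>t > 0\<close>, of "\<lambda>t. f (x + t *\<^sub>R axis i 1)" "\<lambda>s h. h *\<^sub>R partial_deriv i f (x + s *\<^sub>R axis i 1)"])
    show "continuous_on {0..t} (\<lambda>t. f (x + t *\<^sub>R axis i 1))"
      using D by (meson continuous_at_imp_continuous_on has_vector_derivative_continuous)
    show "((\<lambda>t. f (x + t *\<^sub>R axis i 1)) has_derivative (\<lambda>h. h *\<^sub>R partial_deriv i f (x + s *\<^sub>R axis i 1))) (at s)" for s
      using D by (simp add: has_vector_derivative_def)
  qed
  then obtain s where s: "norm (f (x + t *\<^sub>R axis i 1) - f x) \<le> norm (t *\<^sub>R partial_deriv i f (x + s *\<^sub>R axis i 1))"
    by auto
  also have "\<dots> \<le> M * t"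
    using M[of "x + s *\<^sub>R axis i 1"] \<open>t > 0\<close> by (simp add: mult.commute)
  finally show ?thesis .
qed

text \<open>The derivative as a sequential limit, the form required by dominated
  convergence.\<close>

lemma has_vector_derivative_seq:
  assumes "(g has_vector_derivative d) (at 0)"
  shows "(\<lambda>n. (g (1 / real (Suc n)) - g 0) /\<^sub>R (1 / real (Suc n))) \<longlonglongrightarrow> d"
proof -
  have "((\<lambda>y. norm (g (0 + y) - g 0 - y *\<^sub>R d) / norm y) \<longlongrightarrow> 0) (at 0)"
    using assms unfolding has_vector_derivative_def has_derivative_at by blast
  moreover have F: "filterlim (\<lambda>n. 1 / real (Suc n)) (at 0) sequentially"
    using LIMSEQ_inverse_real_of_nat by (simp add: filterlim_at inverse_eq_divide)
  ultimately have "(\<lambda>n. norm (g (0 + 1 / real (Suc n)) - g 0 - (1 / real (Suc n)) *\<^sub>R d) / norm (1 / real (Suc n))) \<longlonglongrightarrow> 0"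
    by (rule filterlim_compose)
  moreover have "norm (g (0 + 1 / real (Suc n)) - g 0 - (1 / real (Suc n)) *\<^sub>R d) / norm (1 / real (Suc n))
     = norm ((g (1 / real (Suc n)) - g 0) /\<^sub>R (1 / real (Suc n)) - d)" for n
  proof -
    let ?t = "1 / real (Suc n)"
    have "(g ?t - g 0) /\<^sub>R ?t - d = (g ?t - g 0 - ?t *\<^sub>R d) /\<^sub>R ?t"
      by (simp add: scaleR_diff_right)
    then show ?thesis by (simp only: norm_scaleR) (simp add: mult.commute)
  qed
  ultimately show ?thesis
    by (simp only: tendsto_norm_zero_iff LIM_zero_iff)
qed

lemma torus_periodic_partial_deriv:
  assumes "torus_periodic f"
  shows "torus_periodic (partial_deriv i f)"
proof -
  have "f (x + torus_period k + t *\<^sub>R axis i 1) = f (x + t *\<^sub>R axis i 1)" for x k t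
    using torus_periodicD[OF assms, of "x + t *\<^sub>R axis i 1" k] by (simp add: algebra_simps)
  then show ?thesis by (simp add: torus_periodic_iff partial_deriv_def)
qed

text \<open>Instead of integrating by parts, differentiate the translates of \<open>f\<close>, whose Fourier
  coefficients are known multiples of those of \<open>f\<close>.\<close>

lemma torus_fourier_partial_deriv:
  fixes f :: "real ^ 'n \<Rightarrow> complex"
  assumes C: "C_k (Suc 0) f" and p: "torus_periodic f"
  shows "torus_fourier (partial_deriv i f) k = \<i> * of_int (k $ i) * torus_fourier f k"
proof -
  have c: "continuous_on UNIV f" and d: "\<And>x. (\<lambda>t. f (x + t *\<^sub>R axis i 1)) differentiable (at 0)"
    and cd: "continuous_on UNIV (partial_deriv i f)"
    using C by auto
  have pd: "torus_periodic (partial_deriv i f)" by (rule torus_periodic_partial_deriv[OF p])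
  obtain M where M: "M > 0" "\<And>z. norm (partial_deriv i f z) \<le> M"
    using continuous_periodic_bounded[OF cd pd] by blast
  define t where "t n = 1 / real (Suc n)" for n
  have t: "t n > 0" for n by (simp add: t_def)
  let ?e = "axis i 1 :: real ^ 'n"
  define D where "D n x = (f (x + t n *\<^sub>R ?e) - f x) /\<^sub>R t n * torus_char (- k) x" for n x
  have c1: "continuous_on UNIV (\<lambda>x. f (x + y) * torus_char (- k) x)" for y
    by (intro continuous_intros continuous_on_compose2[OF c]) auto
  have int: "torus_integral (\<lambda>x. f (x + y) * torus_char (- k) x) = torus_char k y * torus_fourier f k" for y
  proof -
    have "torus_integral (\<lambda>x. f x * torus_char (- k) x) = torus_integral (\<lambda>x. f (x + y) * torus_char (- k) (x + y))"
      by (rule torus_integral_shift[symmetric]) (use p torus_char_periodic[of "- k"] in \<open>auto intro!: continuous_intros c simp: torus_periodic_iff\<close>)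
    also have "\<dots> = torus_char (- k) y * torus_integral (\<lambda>x. f (x + y) * torus_char (- k) x)"
      by (simp add: torus_char_add_arg set_lebesgue_integral_def mult_ac flip: integral_mult_right_zero)
    finally have "torus_char k y * torus_fourier f k = (torus_char k y * torus_char (- k) y) * torus_integral (\<lambda>x. f (x + y) * torus_char (- k) x)"
      by (simp add: torus_fourier_def mult_ac)
    then show ?thesis by (simp add: torus_char_minus_mult)
  qed
  have "(\<lambda>n. torus_integral (D n)) \<longlonglongrightarrow> torus_integral (\<lambda>x. partial_deriv i f x * torus_char (- k) x)"
    unfolding set_lebesgue_integral_def
  proof (rule integral_dominated_convergence[where w="\<lambda>x. indicator torus_cell x * M"])
    have [measurable]: "f \<in> borel_measurable borel" "partial_deriv i f \<in> borel_measurable borel"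
      by (auto intro: borel_measurable_continuous_onI c cd)
    show "(\<lambda>x. indicator torus_cell x *\<^sub>R (partial_deriv i f x * torus_char (- k) x)) \<in> borel_measurable lborel"
      by measurable
    show "(\<lambda>x. indicator torus_cell x *\<^sub>R D n x) \<in> borel_measurable lborel" for n
      unfolding D_def by measurable
    show "integrable lborel (\<lambda>x. indicator (torus_cell :: (real ^ 'n) set) x * M)"
      by (intro integrable_mult_left integrable_real_indicator) (use emeasure_torus_cell_finite in auto)
    show "AE x in lborel. (\<lambda>n. indicator torus_cell x *\<^sub>R D n x) \<longlonglongrightarrow> indicator torus_cell x *\<^sub>R (partial_deriv i f x * torus_char (- k) x)"
    proof (intro AE_I2 tendsto_scaleR tendsto_const)
      fix x
      show "(\<lambda>n. D n x) \<longlonglongrightarrow> partial_deriv i f x * torus_char (- k) x"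
        unfolding D_def t_def
        using has_vector_derivative_seq[of "\<lambda>t. f (x + t *\<^sub>R ?e)" "partial_deriv i f x"]
          partial_deriv_has_vector_derivative[OF d, of x 0]
        by (intro tendsto_mult tendsto_const) simp
    qed
    show "AE x in lborel. norm (indicator torus_cell x *\<^sub>R D n x) \<le> indicator torus_cell x * M" for n
    proof (intro AE_I2)
      fix x
      have "norm (D n x) = norm (f (x + t n *\<^sub>R ?e) - f x) / t n"
        using t[of n] by (simp add: D_def norm_mult divide_inverse mult.commute)
      also have "\<dots> \<le> M"
        using norm_diff_le_partial_deriv[of f i M "t n" x, OF d M(2) t] t[of n] by (simp add: pos_divide_le_eq)
      finally show "norm (indicator torus_cell x *\<^sub>R D n x) \<le> indicator torus_cell x * M"
        by (auto simp: indicator_def)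
    qed
  qed
  moreover have "torus_integral (D n) = (torus_char k (t n *\<^sub>R ?e) - 1) /\<^sub>R t n * torus_fourier f k" for n
  proof -
    have "D n = (\<lambda>x. inverse (t n) *\<^sub>R (f (x + t n *\<^sub>R ?e) * torus_char (- k) x - f (x + 0) * torus_char (- k) x))"
      by (auto simp: D_def algebra_simps)
    then have "torus_integral (D n) = inverse (t n) *\<^sub>R torus_integral (\<lambda>x. f (x + t n *\<^sub>R ?e) * torus_char (- k) x - f (x + 0) * torus_char (- k) x)"
      by simp
    also have "torus_integral (\<lambda>x. f (x + t n *\<^sub>R ?e) * torus_char (- k) x - f (x + 0) * torus_char (- k) x)
      = torus_char k (t n *\<^sub>R ?e) * torus_fourier f k - torus_char k 0 * torus_fourier f k"
      by (subst set_integral_diff) (intro set_integrable_torus_continuous c1, intro set_integrable_torus_continuous c1, simp only: int)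
    finally show ?thesis by (simp add: algebra_simps)
  qed
  moreover have "(\<lambda>n. (torus_char k (t n *\<^sub>R ?e) - 1) /\<^sub>R t n * torus_fourier f k) \<longlonglongrightarrow> (\<i> * of_int (k $ i)) * torus_fourier f k"
  proof (intro tendsto_mult tendsto_const)
    have e: "torus_char k (t *\<^sub>R ?e) = exp (t *\<^sub>R (\<i> * of_int (k $ i)))" for t
    proof -
      have "int_to_real_vec k \<bullet> (t *\<^sub>R ?e) = t * of_int (k $ i)"
        by (simp add: int_to_real_vec_def inner_axis)
      then show ?thesis by (simp add: torus_char_def scaleR_conv_of_real mult_ac)
    qed
    have "((\<lambda>t. exp (t *\<^sub>R (\<i> * of_int (k $ i)))) has_vector_derivative exp (0 *\<^sub>R (\<i> * of_int (k $ i))) * (\<i> * of_int (k $ i))) (at 0)"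
      by (rule exp_scaleR_has_vector_derivative_right)
    from has_vector_derivative_seq[OF this]
    show "(\<lambda>n. (torus_char k (t n *\<^sub>R ?e) - 1) /\<^sub>R t n) \<longlonglongrightarrow> (\<i> * of_int (k $ i))"
      by (simp add: t_def e)
  qed
  ultimately show ?thesis
    unfolding torus_fourier_def using LIMSEQ_unique by force
qed

lemma C_infinity_torusD:
  assumes "f \<in> C_infinity_torus"
  shows "torus_periodic f" "continuous_on UNIV f" "C_k n f"
  using assms unfolding C_infinity_torus_def by (auto dest: spec[of _ 0])

lemma C_infinity_torus_partial_deriv:
  assumes "f \<in> C_infinity_torus"
  shows "partial_deriv i f \<in> C_infinity_torus"
proof -
  have "C_k n (partial_deriv i f)" for n
    using C_infinity_torusD(3)[OF assms, of "Suc n"] by simp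
  then show ?thesis
    using torus_periodic_partial_deriv[OF C_infinity_torusD(1)[OF assms]] by (simp add: C_infinity_torus_def)
qed

text \<open>Each factor k_i is traded for one derivative in direction i, which is again smooth and
  periodic; the induction ends with the bound by the supremum.\<close>

lemma torus_fourier_coordinate_decay:
  fixes f :: "real ^ 'n \<Rightarrow> complex"
  assumes "f \<in> C_infinity_torus"
  shows "\<exists>C. \<forall>k. \<bar>of_int (k $ i)\<bar> ^ m * norm (torus_fourier f k) \<le> C"
  using assms
proof (induction m arbitrary: f)
  case 0
  obtain M where M: "\<And>z. norm (f z) \<le> M"
    using continuous_periodic_bounded C_infinity_torusD[OF 0] by metis
  have "norm (torus_fourier f k) \<le> M * (2 * pi) ^ CARD('n)" for k
    unfolding torus_fourier_def by (rule norm_torus_integral_le) (simp add: norm_mult M)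
  then show ?case by auto
next
  case (Suc m)
  obtain C where C: "\<And>k. \<bar>of_int (k $ i)\<bar> ^ m * norm (torus_fourier (partial_deriv i f) k) \<le> C"
    using Suc.IH[OF C_infinity_torus_partial_deriv[OF Suc.prems]] by blast
  have "torus_fourier (partial_deriv i f) k = \<i> * of_int (k $ i) * torus_fourier f k" for k
    by (rule torus_fourier_partial_deriv) (rule C_infinity_torusD[OF Suc.prems])+
  with C have "\<bar>of_int (k $ i)\<bar> ^ Suc m * norm (torus_fourier f k) \<le> C" for k
    by (simp add: norm_mult mult_ac)
  then show ?case by blast
qed

lemma norm_torus_period: "norm (torus_period k) = 2 * pi * norm (int_to_real_vec k)"
  by (simp add: torus_period_def)

lemma norm_int_to_real_vec_ge_1: "1 \<le> norm (int_to_real_vec k)" if "k \<noteq> 0"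
  using norm_torus_period_ge[OF that] by (simp add: norm_torus_period)

lemma int_to_real_vec_0 [simp]: "int_to_real_vec 0 = 0"
  by (simp add: int_to_real_vec_def vec_eq_iff)

text \<open>The weight 1 + |k|^p yields at once the summability of the coefficients themselves and
  that of |k|^p times them.\<close>

lemma torus_fourier_decay:
  fixes f :: "real ^ 'n \<Rightarrow> complex"
  assumes f: "f \<in> C_infinity_torus" and "p \<ge> 0"
  shows "(\<lambda>k. (1 + norm (int_to_real_vec k) powr p) * norm (torus_fourier f k)) summable_on UNIV"
proof -
  define n where "n = real CARD('n)"
  \<comment> \<open>Of the m powers of |k|, p are spent on the weight; at least n + 1 remain, and n
    + 1 exceeds the threshold n of the lattice sum.\<close>
  obtain m :: nat where m: "p + n + 1 \<le> real m" using real_arch_simple by blast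
  obtain B where B: "\<And>i k. \<bar>of_int (k $ i)\<bar> ^ m * norm (torus_fourier f k) \<le> B i"
    using torus_fourier_coordinate_decay[OF f, of _ m] by metis
  have Bi: "B i \<ge> 0" for i
    using B[of 0 i] norm_ge_zero[of "torus_fourier f 0"] by (meson abs_ge_zero mult_nonneg_nonneg norm_ge_zero order_trans zero_le_power)
  define C where "C = n ^ m * (\<Sum>i\<in>UNIV. B i)"
  have C: "norm (int_to_real_vec k) ^ m * norm (torus_fourier f k) \<le> C" for k
  proof -
    \<comment> \<open>A coordinate of largest modulus, for which |k| \<le> n |k_i|; so decay in
      single coordinates controls decay in |k|.\<close>
    define i where "i = (ARG_MAX (\<lambda>i. \<bar>k $ i\<bar>) i. True)"
    have i: "\<bar>k $ j\<bar> \<le> \<bar>k $ i\<bar>" for j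
    proof -
      obtain i0 where i0: "\<bar>k $ i0\<bar> = Max (range (\<lambda>i. \<bar>k $ i\<bar>))"
        using Max_in[of "range (\<lambda>i. \<bar>k $ i\<bar>)"] by fastforce
      have "is_arg_max (\<lambda>i. \<bar>k $ i\<bar>) (\<lambda>_. True) i0"
        by (auto simp: is_arg_max_def i0 not_less)
      then have "is_arg_max (\<lambda>i. \<bar>k $ i\<bar>) (\<lambda>_. True) i"
        unfolding i_def arg_max_def by (rule someI)
      then show ?thesis by (auto simp: is_arg_max_def not_less)
    qed
    have "norm (int_to_real_vec k) \<le> (\<Sum>j\<in>UNIV. \<bar>int_to_real_vec k $ j\<bar>)" by (rule norm_le_l1_cart)
    also have "\<dots> \<le> (\<Sum>j\<in>(UNIV :: 'n set). \<bar>of_int (k $ i)\<bar>)"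
      by (rule sum_mono) (use i in \<open>simp add: int_to_real_vec_def flip: of_int_abs\<close>)
    finally have "norm (int_to_real_vec k) \<le> n * \<bar>of_int (k $ i)\<bar>" by (simp add: n_def)
    then have "norm (int_to_real_vec k) ^ m * norm (torus_fourier f k) \<le> (n * \<bar>of_int (k $ i)\<bar>) ^ m * norm (torus_fourier f k)"
      by (intro mult_right_mono power_mono) auto
    also have "\<dots> = n ^ m * (\<bar>of_int (k $ i)\<bar> ^ m * norm (torus_fourier f k))"
      by (simp add: power_mult_distrib mult_ac)
    also have "\<dots> \<le> C"
      unfolding C_def using B[of k i] member_le_sum[of i UNIV B] Bi by (intro mult_left_mono) (auto simp: n_def intro: order_trans)
    finally show ?thesis .
  qed
  define s where "s = n + 1"
  have sum: "(\<lambda>k::int^'n. 1 / norm (0 + torus_period k) powr s) summable_on UNIV"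
    by (rule lattice_sum_summable) (simp add: s_def n_def)
  have sum0: "(\<lambda>k::int^'n. indicator {0} k :: real) summable_on UNIV"
    unfolding summable_on_def by (rule exI[of _ 1], rule has_sum_finite_neutralI[of "{0}"]) auto
  have C0: "C \<ge> 0" using C[of 0] by (meson mult_nonneg_nonneg norm_ge_zero order_trans zero_le_power)
  \<comment> \<open>The frequency 0 needs its own term, since the comparison sum contributes
    \<open>1 / 0 = 0\<close> there.\<close>
  define K where "K = norm (torus_fourier f 0)"
  define A where "A = 2 * C * (2 * pi) powr s"
  show ?thesis
  proof (rule summable_on_comparison_test)
    show "(\<lambda>k::int^'n. 2 * K * indicator {0} k + A * (1 / norm (0 + torus_period k) powr s)) summable_on UNIV"
      by (intro summable_on_add summable_on_cmult_right sum sum0)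
    fix k :: "int ^ 'n"
    show "(1 + norm (int_to_real_vec k) powr p) * norm (torus_fourier f k) \<le> 2 * K * indicator {0} k + A * (1 / norm (0 + torus_period k) powr s)"
    proof (cases "k = 0")
      case True
      then show ?thesis by (simp add: K_def)
    next
      case False
      let ?r = "norm (int_to_real_vec k)"
      have r: "?r \<ge> 1" by (rule norm_int_to_real_vec_ge_1[OF False])
      then have r0: "?r > 0" by linarith
      have "(1 + ?r powr p) * ?r powr s \<le> (2 * ?r powr p) * ?r powr s"
        using r assms by (intro mult_right_mono) (auto simp: ge_one_powr_ge_zero)
      also have "\<dots> = 2 * ?r powr (p + s)" by (simp add: powr_add)
      also have "\<dots> \<le> 2 * ?r powr real m" using r m by (auto intro!: powr_mono simp: s_def)
      also have "\<dots> = 2 * ?r ^ m" using r0 by (simp add: powr_realpow)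
      finally have "(1 + ?r powr p) * ?r powr s * norm (torus_fourier f k) \<le> 2 * ?r ^ m * norm (torus_fourier f k)"
        by (intro mult_right_mono) auto
      also have "\<dots> \<le> 2 * C" using C[of k] by simp
      finally have "(1 + ?r powr p) * norm (torus_fourier f k) \<le> 2 * C / ?r powr s"
        using r0 by (simp add: pos_le_divide_eq mult_ac)
      also have "\<dots> = A * (1 / norm (0 + torus_period k) powr s)"
        using r0 by (simp add: A_def norm_torus_period powr_mult)
      finally show ?thesis using False by simp
    qed
  qed auto
qed

section \<open>Uniqueness of Fourier coefficients and Fourier inversion\<close>

lemma torus_fourier_mult_char:
  fixes f :: "real ^ 'n \<Rightarrow> complex"
  shows "torus_fourier (\<lambda>z. f z * torus_char l z) k = torus_fourier f (k - l)"
proof -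
  have "torus_char l z * torus_char (- k) z = torus_char (- (k - l)) z" for z :: "real ^ 'n"
    by (simp add: torus_char_add[symmetric])
  then show ?thesis by (simp add: torus_fourier_def mult.assoc)
qed

text \<open>The product of cos^2 (z_i / 2), with values in [0, 1]; for S = \<open>UNIV\<close> the
  value 1 is taken exactly on the period lattice. Its powers are, up to normalization, kernels of de
  la Vallee-Poussin type. The set S allows induction over the coordinates.\<close>

definition cos_kernel :: "'n set \<Rightarrow> real ^ 'n \<Rightarrow> complex"
  where "cos_kernel S z = (\<Prod>i\<in>S. complex_of_real ((1 + cos (z $ i)) / 2))"

definition null_fourier :: "(real ^ 'n \<Rightarrow> complex) \<Rightarrow> bool"
  where "null_fourier f \<longleftrightarrow> continuous_on UNIV f \<and> (\<forall>k. torus_fourier f k = 0)"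

text \<open>A character only shifts the frequencies. Together with linearity this makes the class
  stable under multiplication by trigonometric polynomials.\<close>

lemma null_fourier_mult_char: "null_fourier f \<Longrightarrow> null_fourier (\<lambda>z. f z * torus_char l z)"
  by (auto simp: null_fourier_def torus_fourier_mult_char intro!: continuous_intros)

lemma null_fourier_add:
  assumes "null_fourier f" "null_fourier g"
  shows "null_fourier (\<lambda>z. f z + g z)"
proof -
  have "torus_fourier (\<lambda>z. f z + g z) k = torus_fourier f k + torus_fourier g k" for k
    unfolding torus_fourier_def distrib_right using assms
    by (intro set_integral_add set_integrable_torus_continuous continuous_intros) (auto simp: null_fourier_def)
  then show ?thesis using assms by (auto simp: null_fourier_def intro!: continuous_intros)
qed

lemma null_fourier_cmult: "null_fourier f \<Longrightarrow> null_fourier (\<lambda>z. c * f z)"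
  by (auto simp: null_fourier_def torus_fourier_def set_lebesgue_integral_def mult.assoc
      simp flip: mult_scaleR_right intro!: continuous_intros)

lemma null_fourier_mult_cos:
  fixes f :: "real ^ 'n \<Rightarrow> complex"
  assumes "null_fourier f"
  shows "null_fourier (\<lambda>z. f z * complex_of_real ((1 + cos (z $ i)) / 2))"
proof -
  have e: "int_to_real_vec (axis i 1) \<bullet> z = z $ i" for z :: "real ^ 'n"
  proof -
    have "int_to_real_vec (axis i 1) = axis i (1::real)"
      by (auto simp: int_to_real_vec_def axis_def vec_eq_iff)
    then show ?thesis by (simp add: inner_axis')
  qed
  have cc: "complex_of_real (cos (z $ i)) = (torus_char (axis i 1) z + torus_char (- axis i 1) z) / 2" for z
    unfolding torus_char_minus_arg[symmetric] by (simp add: torus_char_def e cos_exp_eq cos_of_real[symmetric])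
  have eq: "(\<lambda>z. f z * complex_of_real ((1 + cos (z $ i)) / 2))
      = (\<lambda>z. (1/2) * f z + ((1/4) * (f z * torus_char (axis i 1) z) + (1/4) * (f z * torus_char (- axis i 1) z)))"
    by (simp only: of_real_divide of_real_add of_real_1 of_real_numeral cc) (simp add: field_simps)
  show ?thesis unfolding eq
    by (intro null_fourier_add null_fourier_cmult null_fourier_mult_char assms)
qed

lemma null_fourier_mult_cos_kernel:
  assumes "null_fourier f" "finite S"
  shows "null_fourier (\<lambda>z. f z * cos_kernel S z)"
  using assms(2)
proof induction
  case empty
  then show ?case using assms by (simp add: cos_kernel_def)
next
  case (insert i S)
  then have "(\<lambda>z. f z * cos_kernel (insert i S) z) = (\<lambda>z. (f z * cos_kernel S z) * complex_of_real ((1 + cos (z $ i)) / 2))"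
    by (auto simp: cos_kernel_def mult_ac)
  then show ?case using null_fourier_mult_cos[OF insert.IH, of i] by simp
qed

lemma null_fourier_mult_cos_kernel_power:
  fixes f :: "real ^ 'n \<Rightarrow> complex"
  assumes "null_fourier f"
  shows "null_fourier (\<lambda>z. f z * cos_kernel UNIV z ^ N)"
proof (induction N)
  case (Suc N)
  have "(\<lambda>z. f z * cos_kernel UNIV z ^ Suc N) = (\<lambda>z. (f z * cos_kernel UNIV z ^ N) * cos_kernel UNIV z)"
    by (simp add: mult_ac)
  then show ?case using null_fourier_mult_cos_kernel[OF Suc.IH, of UNIV] by simp
qed (use assms in simp)

text \<open>The powers of the trigonometric polynomial \<open>cos_kernel UNIV\<close> concentrate at the origin, so
  testing \<open>f\<close> against them detects the sign of \<open>Re (f 0)\<close>.\<close>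

lemma null_fourier_Re_at_0:
  fixes f :: "real ^ 'n \<Rightarrow> complex"
  assumes nf: "null_fourier f" and p: "torus_periodic f"
  shows "Re (f 0) \<le> 0"
proof (rule ccontr)
  assume "\<not> Re (f 0) \<le> 0"
  then have A0: "Re (f 0) > 0" by simp
  define A where "A = Re (f 0) / 2"
  have A: "A > 0" using A0 by (simp add: A_def)
  have c: "continuous_on UNIV f" using nf by (simp add: null_fourier_def)
  obtain M where M: "M > 0" "\<And>z. norm (f z) \<le> M"
    using continuous_periodic_bounded[OF c p] by blast
  define q where "q z = (\<Prod>i\<in>UNIV. (1 + cos (z $ i)) / 2)" for z :: "real ^ 'n"
  have f1: "(1 + cos t) / 2 \<le> 1" for t :: real using cos_le_one[of t] by simp
  have f2: "0 \<le> (1 + cos t) / 2" for t :: real using cos_ge_minus_one[of t] by (simp, linarith)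
  have q0: "q z \<ge> 0" for z unfolding q_def by (intro prod_nonneg f2)
  have cq: "continuous_on UNIV q" unfolding q_def by (intro continuous_intros) auto
  have kq: "cos_kernel UNIV z = complex_of_real (q z)" for z by (simp add: cos_kernel_def q_def)
  have "continuous_on UNIV (\<lambda>z. Re (f z))" by (intro continuous_intros c)
  then obtain d0 where d0: "d0 > 0" "\<And>z. dist z 0 < d0 \<Longrightarrow> dist (Re (f z)) (Re (f 0)) < A"
    using A unfolding continuous_on_iff by (metis UNIV_I)
  have near: "Re (f z) \<ge> A" if "norm z < d0" for z
  proof -
    have "\<bar>Re (f z) - Re (f 0)\<bar> < A" using d0(2)[of z] that by (simp add: dist_norm)
    then show ?thesis unfolding A_def by linarith
  qed
  \<comment> \<open>Since n d < d0, the box of half-width d lies where Re f \<ge> A. Since d \<le> 1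
    < pi, it lies in the cell and in the range where the cosine decreases.\<close>
  define d where "d = min (d0 / (real CARD('n) + 1)) 1"
  have d: "d > 0" "d \<le> 1" "d < pi" using d0 pi_gt3 by (auto simp: d_def add_nonneg_pos)
  have nearbox: "norm z < d0" if "\<And>i. \<bar>z $ i\<bar> \<le> d" for z :: "real ^ 'n"
  proof -
    have "norm z \<le> (\<Sum>i\<in>UNIV. \<bar>z $ i\<bar>)" by (rule norm_le_l1_cart)
    also have "\<dots> \<le> real CARD('n) * d" using sum_mono[of UNIV "\<lambda>i. \<bar>z $ i\<bar>" "\<lambda>_. d"] that by simp
    also have "\<dots> < (real CARD('n) + 1) * d" using d by simp
    also have "\<dots> \<le> (real CARD('n) + 1) * (d0 / (real CARD('n) + 1))" by (intro mult_left_mono) (auto simp: d_def)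
    also have "\<dots> = d0" by (simp add: add_nonneg_pos order_less_imp_not_eq2)
    finally show ?thesis .
  qed
  define \<rho> where "\<rho> = (1 + cos d) / 2"
  have "cos d < 1" using cos_monotone_0_pi[of 0 d] d by simp
  moreover have "cos d > -1" using cos_monotone_0_pi[of d pi] d by simp
  ultimately have \<rho>: "0 < \<rho>" "\<rho> < 1" by (auto simp: \<rho>_def)
  have far: "q z \<le> \<rho>" if z: "z \<in> torus_cell" and i: "\<not> \<bar>z $ i\<bar> \<le> d" for z i
  proof -
    have "q z = (1 + cos (z $ i)) / 2 * (\<Prod>j\<in>UNIV - {i}. (1 + cos (z $ j)) / 2)"
      unfolding q_def by (rule prod.remove) auto
    also have "\<dots> \<le> (1 + cos (z $ i)) / 2 * 1"
      by (intro mult_left_mono prod_le_1) (use f1 f2 in auto)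
    also have "cos (z $ i) = cos \<bar>z $ i\<bar>" by (simp add: abs_if)
    also have "cos \<bar>z $ i\<bar> \<le> cos d"
    proof -
      have "- pi < z $ i" "z $ i \<le> pi" using z by (auto simp: torus_cell_def)
      then show ?thesis by (intro cos_monotone_0_pi_le) (use i d in linarith)+
    qed
    finally show ?thesis by (simp add: \<rho>_def)
  qed
  \<comment> \<open>Outside the box the kernel is at most \<rho>. Any level strictly between \<rho>
    and 1 is exceeded on a small ball at the origin, and its N-th power eventually dominates
    \<rho>^N.\<close>
  define \<rho>' where "\<rho>' = (1 + \<rho>) / 2"
  have \<rho>': "\<rho> < \<rho>'" "\<rho>' < 1" using \<rho> by (auto simp: \<rho>'_def)
  have "q 0 = 1" by (simp add: q_def)
  then obtain e0 where e0: "e0 > 0" "\<And>z. dist z 0 < e0 \<Longrightarrow> dist (q z) 1 < 1 - \<rho>'"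
    using cq \<rho>' unfolding continuous_on_iff by (metis UNIV_I diff_gt_0_iff_gt)
  define e where "e = min e0 d"
  have e: "e > 0" "e \<le> e0" "e \<le> d" using e0 d by (auto simp: e_def)
  have peak: "q z \<ge> \<rho>'" "\<bar>z $ i\<bar> \<le> d" if "z \<in> ball 0 e" for z i
  proof -
    have "norm z < e" using that by simp
    then have "\<bar>q z - 1\<bar> < 1 - \<rho>'" using e0(2)[of z] e by (simp add: dist_norm)
    then show "q z \<ge> \<rho>'" by linarith
    show "\<bar>z $ i\<bar> \<le> d" using component_le_norm_cart[of z i] \<open>norm z < e\<close> e by linarith
  qed
  have ballcell: "ball 0 e \<subseteq> (torus_cell :: (real ^ 'n) set)"
  proof
    fix z :: "real ^ 'n" assume "z \<in> ball 0 e"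
    then have "- pi < z $ i \<and> z $ i \<le> pi" for i using peak(2)[of z i] d by linarith
    then show "z \<in> torus_cell" by (simp add: torus_cell_def)
  qed
  define V where "V = measure lborel (ball (0::real^'n) e)"
  have V: "V > 0" using e by (simp add: V_def content_ball_pos)
  have iV: "integrable lborel (\<lambda>z. indicator (ball (0::real^'n) e) z * x)" for x :: real
    by (intro integrable_mult_left integrable_real_indicator) (use emeasure_lborel_ball_finite[of "0::real^'n" e] in auto)
  have iC: "integrable lborel (\<lambda>z. indicator (torus_cell :: (real^'n) set) z * x)" for x :: real
    by (intro integrable_mult_left integrable_real_indicator) (use emeasure_torus_cell_finite in auto)
  have bound: "A * \<rho>' ^ N * V \<le> M * \<rho> ^ N * (2 * pi) ^ CARD('n)" for N
  proof -
    have "null_fourier (\<lambda>z. f z * cos_kernel UNIV z ^ N)" by (rule null_fourier_mult_cos_kernel_power[OF nf])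
    then have cN: "continuous_on UNIV (\<lambda>z. f z * cos_kernel UNIV z ^ N)" and "torus_fourier (\<lambda>z. f z * cos_kernel UNIV z ^ N) 0 = 0"
      by (auto simp: null_fourier_def)
    then have "torus_integral (\<lambda>z. f z * cos_kernel UNIV z ^ N) = 0" by (simp add: torus_fourier_def)
    then have 0: "torus_integral (\<lambda>z. Re (f z) * q z ^ N) = 0"
      using Re_torus_integral[OF cN] by (simp add: kq flip: of_real_power)
    have "A * \<rho>' ^ N * V - M * \<rho> ^ N * (2 * pi) ^ CARD('n)
       = (LINT z|lborel. indicator (ball (0::real^'n) e) z * (A * \<rho>' ^ N) - indicator (torus_cell :: (real^'n) set) z * (M * \<rho> ^ N))"
      by (subst Bochner_Integration.integral_diff[OF iV iC]) (simp add: V_def measure_torus_cell)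
    \<comment> \<open>Pointwise: on the small ball the integrand is at least A \<rho>'^N, on the
      rest of the box it is nonnegative, and elsewhere in the cell it is at least - M
      \<rho>^N.\<close>
    also have "\<dots> \<le> torus_integral (\<lambda>z. Re (f z) * q z ^ N)"
      unfolding set_lebesgue_integral_def
    proof (rule integral_mono)
      show "integrable lborel (\<lambda>z. indicator (ball (0::real^'n) e) z * (A * \<rho>' ^ N) - indicator (torus_cell :: (real^'n) set) z * (M * \<rho> ^ N))"
        by (intro Bochner_Integration.integrable_diff iV iC)
      show "integrable lborel (\<lambda>z. indicator torus_cell z *\<^sub>R (Re (f z) * q z ^ N))"
        unfolding set_integrable_def[symmetric] by (intro set_integrable_torus_continuous continuous_intros c cq)
      fix z :: "real ^ 'n"
      show "indicator (ball 0 e) z * (A * \<rho>' ^ N) - indicator torus_cell z * (M * \<rho> ^ N) \<le> indicator torus_cell z *\<^sub>R (Re (f z) * q z ^ N)"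
      proof (cases "z \<in> torus_cell")
        case False
        then show ?thesis using ballcell by (auto simp: indicator_def)
      next
        case cell: True
        have M0: "M * \<rho> ^ N \<ge> 0" using M \<rho> by simp
        show ?thesis
        proof (cases "\<forall>i. \<bar>z $ i\<bar> \<le> d")
          case True
          then have Az: "Re (f z) \<ge> A" using nearbox near by blast
          have "indicator (ball 0 e) z * (A * \<rho>' ^ N) \<le> Re (f z) * q z ^ N"
          proof (cases "z \<in> ball 0 e")
            case True
            then show ?thesis using Az A peak(1)[OF True] \<rho> \<rho>' by (auto intro!: mult_mono power_mono)
          next
            case False
            then show ?thesis using Az A q0[of z] by simp
          qed
          then show ?thesis using M0 cell by simp
        next
          case False
          then obtain i where i: "\<not> \<bar>z $ i\<bar> \<le> d" by blast
          then have nb: "z \<notin> ball 0 e" using peak(2) by blast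
          have "\<bar>Re (f z) * q z ^ N\<bar> \<le> M * \<rho> ^ N"
            unfolding abs_mult
          proof (rule mult_mono)
            show "\<bar>Re (f z)\<bar> \<le> M" using abs_Re_le_cmod M(2) order_trans by blast
            show "\<bar>q z ^ N\<bar> \<le> \<rho> ^ N" using power_mono[OF far[OF cell i] q0] q0[of z] by simp
          qed (use M in auto)
          then show ?thesis using nb cell by (simp add: abs_le_iff)
        qed
      qed
    qed
    finally show ?thesis using 0 by simp
  qed
  \<comment> \<open>After division by \<rho>'^N the left side of the bound is the fixed positive
    number A V, while the right side tends to 0.\<close>
  have lim: "(\<lambda>N. M * (\<rho> / \<rho>') ^ N * (2 * pi) ^ CARD('n)) \<longlonglongrightarrow> M * 0 * (2 * pi) ^ CARD('n)"
    using \<rho> \<rho>' by (intro tendsto_intros LIMSEQ_power_zero) auto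
  moreover have "A * V \<le> M * (\<rho> / \<rho>') ^ N * (2 * pi) ^ CARD('n)" for N
    using bound[of N] \<rho> \<rho>' by (simp add: power_divide field_simps)
  ultimately have "A * V \<le> M * 0 * (2 * pi) ^ CARD('n)"
    using LIMSEQ_le_const[OF lim] by blast
  then show False using A V by (simp add: mult_le_0_iff)
qed

text \<open>Translating x to the origin and multiplying by the conjugate of f x makes the value at
  the origin |f x|^2, so the one-sided sign statement is enough.\<close>

lemma null_fourier_eq_0:
  fixes f :: "real ^ 'n \<Rightarrow> complex"
  assumes nf: "null_fourier f" and p: "torus_periodic f"
  shows "f x = 0"
proof -
  have c: "continuous_on UNIV f" using nf by (simp add: null_fourier_def)
  define g where "g z = cnj (f x) * f (z + x)" for z
  have cg: "continuous_on UNIV (\<lambda>z. f (z + x))"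
    by (intro continuous_on_compose2[OF c] continuous_intros) auto
  have "torus_fourier (\<lambda>z. f (z + x)) k = 0" for k
  proof -
    have "0 = torus_integral (\<lambda>z. f z * torus_char (- k) z)" using nf by (simp add: null_fourier_def torus_fourier_def)
    also have "\<dots> = torus_integral (\<lambda>z. f (z + x) * torus_char (- k) (z + x))"
      by (rule torus_integral_shift[symmetric]) (use p torus_char_periodic[of "- k"] in \<open>auto intro!: continuous_intros c simp: torus_periodic_iff\<close>)
    also have "\<dots> = torus_char (- k) x * torus_integral (\<lambda>z. f (z + x) * torus_char (- k) z)"
      by (simp add: torus_char_add_arg set_lebesgue_integral_def mult_ac flip: integral_mult_right_zero)
    finally have "torus_char (- k) x * torus_fourier (\<lambda>z. f (z + x)) k = 0" by (simp add: torus_fourier_def)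
    moreover have "torus_char (- k) x \<noteq> 0" using norm_torus_char[of "- k" x] by (metis norm_zero zero_neq_one)
    ultimately show ?thesis by simp
  qed
  then have "null_fourier g"
    unfolding g_def using cg by (intro null_fourier_cmult) (simp add: null_fourier_def)
  moreover have "torus_periodic g"
    using p by (auto simp: torus_periodic_iff g_def algebra_simps) (metis add.commute add.left_commute)
  ultimately have "Re (g 0) \<le> 0" by (rule null_fourier_Re_at_0)
  moreover have "Re (g 0) = (norm (f x))\<^sup>2"
    unfolding cmod_power2 by (simp add: g_def power2_eq_square)
  ultimately show ?thesis by simp
qed

text \<open>The absolutely convergent series defines a continuous function with the coefficients of
  f; uniqueness identifies the two.\<close>

theorem fourier_inversion:
  fixes f :: "real ^ 'n \<Rightarrow> complex"
  assumes f: "f \<in> C_infinity_torus"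
  shows "f z = (\<Sum>\<^sub>\<infinity>k. fourier_coeff f k * torus_char k z)"
proof -
  note c = C_infinity_torusD(2)[OF f]
  define S where "S = (\<lambda>z. \<Sum>\<^sub>\<infinity>k. fourier_coeff f k * torus_char k z)"
  have "(\<lambda>k. 1 / (2 * pi) ^ CARD('n) * ((1 + norm (int_to_real_vec k) powr 0) * norm (torus_fourier f k))) summable_on UNIV"
    by (intro summable_on_cmult_right torus_fourier_decay[OF f]) auto
  then have sm: "(\<lambda>k. norm (fourier_coeff f k)) summable_on UNIV"
    by (rule summable_on_comparison_test) (auto simp: fourier_coeff_eq[OF c] norm_divide norm_power norm_mult intro!: divide_right_mono mult_right_mono)
  have cS: "continuous_on UNIV S"
    unfolding S_def by (rule Weierstrass_torus(1)[OF _ _ sm]) (auto intro!: continuous_intros simp: norm_mult)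
  have pS: "torus_periodic S"
    unfolding torus_periodic_iff S_def by (simp add: torus_periodicD[OF torus_char_periodic])
  have coeff: "torus_fourier S l = torus_fourier f l" for l
  proof -
    have "((\<lambda>k. torus_integral (\<lambda>z. fourier_coeff f k * torus_char k z * torus_char (- l) z)) has_sum
       torus_integral (\<lambda>z. \<Sum>\<^sub>\<infinity>k. fourier_coeff f k * torus_char k z * torus_char (- l) z)) UNIV"
      by (rule Weierstrass_torus(2)[OF _ _ sm]) (auto intro!: continuous_intros simp: norm_mult)
    also have "(\<lambda>z. \<Sum>\<^sub>\<infinity>k. fourier_coeff f k * torus_char k z * torus_char (- l) z) = (\<lambda>z. S z * torus_char (- l) z)"
      unfolding S_def by (simp add: infsum_cmult_left')
    also have "torus_integral \<dots> = torus_fourier S l" by (simp add: torus_fourier_def)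
    also have "(\<lambda>k. torus_integral (\<lambda>z. fourier_coeff f k * torus_char k z * torus_char (- l) z))
      = (\<lambda>k. fourier_coeff f k * (if k = l then (2 * pi) ^ CARD('n) else 0))"
    proof
      fix k
      have "torus_integral (\<lambda>z. fourier_coeff f k * torus_char k z * torus_char (- l) z) = fourier_coeff f k * torus_integral (torus_char (k - l))"
        by (simp add: mult.assoc set_lebesgue_integral_def flip: torus_char_add mult_scaleR_right)
      then show "torus_integral (\<lambda>z. fourier_coeff f k * torus_char k z * torus_char (- l) z) = fourier_coeff f k * (if k = l then (2 * pi) ^ CARD('n) else 0)"
        by (simp add: torus_integral_char)
    qed
    finally have "((\<lambda>k. fourier_coeff f k * (if k = l then (2 * pi) ^ CARD('n) else 0)) has_sum torus_fourier S l) UNIV" .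
    moreover have "((\<lambda>k. fourier_coeff f k * (if k = l then (2 * pi) ^ CARD('n) else 0)) has_sum torus_fourier f l) UNIV"
      by (rule has_sum_finite_neutralI[of "{l}"]) (auto simp: fourier_coeff_eq[OF c])
    ultimately show ?thesis by (rule has_sum_unique)
  qed
  have "null_fourier (\<lambda>z. f z - S z)"
  proof -
    have "torus_fourier (\<lambda>z. f z - S z) k = torus_fourier f k - torus_fourier S k" for k
      unfolding torus_fourier_def left_diff_distrib
      by (intro set_integral_diff set_integrable_torus_continuous continuous_intros c cS)
    then show ?thesis using coeff c cS by (auto simp: null_fourier_def intro!: continuous_intros)
  qed
  moreover have "torus_periodic (\<lambda>z. f z - S z)"
    using pS C_infinity_torusD(1)[OF f] by (simp add: torus_periodic_iff)
  ultimately have "f z - S z = 0" by (rule null_fourier_eq_0)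
  then show ?thesis by (simp add: S_def)
qed

section \<open>Hoelder continuity and second differences\<close>

text \<open>Moves the seminorm from the cell to the whole space: pass to representatives and use
  that the torus distance is at most the Euclidean one.\<close>

lemma Hoelder_periodic_bound:
  fixes g :: "real ^ 'n \<Rightarrow> real"
  assumes p: "torus_periodic g" and "\<alpha> > 0"
    and bdd: "bdd_above {\<bar>g x - g y\<bar> / torus_dist x y powr \<alpha> | x y. x \<in> torus_cell \<and> y \<in> torus_cell \<and> x \<noteq> y}"
  obtains C where "C \<ge> 0" "\<And>x y. \<bar>g x - g y\<bar> \<le> C * norm (x - y) powr \<alpha>"
proof -
  obtain B where B: "\<And>x y. x \<in> torus_cell \<Longrightarrow> y \<in> torus_cell \<Longrightarrow> x \<noteq> y \<Longrightarrow> \<bar>g x - g y\<bar> / torus_dist x y powr \<alpha> \<le> B"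
    using bdd unfolding bdd_above_def by blast
  show ?thesis
  proof (rule that[of "max 0 B"])
    fix x y :: "real ^ 'n"
    obtain k where k: "x - torus_period k \<in> torus_cell" using ex1_period_cell[of x] by blast
    obtain l where l: "y - torus_period l \<in> torus_cell" using ex1_period_cell[of y] by blast
    define x' y' where "x' = x - torus_period k" and "y' = y - torus_period l"
    have gx: "g x' = g x" "g y' = g y"
      using torus_periodicD[OF p, of x' k] torus_periodicD[OF p, of y' l] by (auto simp: x'_def y'_def)
    show "\<bar>g x - g y\<bar> \<le> max 0 B * norm (x - y) powr \<alpha>"
    proof (cases "x' = y'")
      case True
      then show ?thesis using gx by simp
    next
      case False
      \<comment> \<open>Distinct representatives are not congruent, so their distance is positive
        and the quotient in the seminorm is a genuine one.\<close>
      have "x' - y' + torus_period j \<noteq> 0" for j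
      proof
        assume "x' - y' + torus_period j = 0"
        then have "y' - torus_period j = x'" by (simp add: algebra_simps)
        then have "y' - torus_period j \<in> torus_cell" using k by (simp add: x'_def)
        moreover have "y' - torus_period 0 \<in> torus_cell" using l by (simp add: y'_def)
        ultimately have "j = 0" using ex1_period_cell[of y'] by blast
        then show False using \<open>x' - y' + torus_period j = 0\<close> False by simp
      qed
      then have pos: "torus_dist x' y' > 0" by (rule torus_dist_pos)
      have le: "torus_dist x' y' \<le> norm (x - y)"
        using torus_dist_le[of x' y' "k - l"] by (simp add: x'_def y'_def torus_period_diff algebra_simps)
      have "\<bar>g x' - g y'\<bar> \<le> B * torus_dist x' y' powr \<alpha>"
        using B[of x' y'] k l False pos by (simp add: x'_def y'_def pos_divide_le_eq)
      also have "\<dots> \<le> max 0 B * norm (x - y) powr \<alpha>"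
        using le pos \<open>\<alpha> > 0\<close> by (intro mult_mono powr_mono2) auto
      finally show ?thesis using gx by simp
    qed
  qed simp
qed

text \<open>Only coordinate derivatives are given, so the increment y is built up one coordinate at
  a time, with the one-dimensional mean value theorem in each step. A step costs at most |y| C
  |y|^\<alpha>, which explains the factor \<open>CARD('n)\<close>.\<close>

lemma Hoelder_Taylor_bound:
  fixes v :: "real ^ 'n \<Rightarrow> real" and C \<alpha> :: real
  assumes d: "\<And>i x. (\<lambda>t. v (x + t *\<^sub>R axis i 1)) differentiable (at 0)"
    and C: "C \<ge> 0" "\<And>i x y. \<bar>partial_deriv i v x - partial_deriv i v y\<bar> \<le> C * norm (x - y) powr \<alpha>" and "\<alpha> > 0"
  shows "\<bar>v (x + y) - v x - (\<Sum>i\<in>UNIV. partial_deriv i v x * y $ i)\<bar> \<le> CARD('n) * C * norm y powr (1 + \<alpha>)"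
proof -
  define r where "r S = (\<chi> i. if i \<in> S then y $ i else 0)" for S :: "'n set"
  have "\<bar>v (x + r S) - v x - (\<Sum>i\<in>S. partial_deriv i v x * y $ i)\<bar> \<le> card S * (C * norm y powr (1 + \<alpha>))" for S
    using finite[of S]
  proof induction
    case empty
    have "r {} = 0" by (simp add: r_def vec_eq_iff)
    then show ?case by simp
  next
    case (insert i S)
    let ?e = "axis i 1 :: real ^ 'n"
    have rS: "r (insert i S) = r S + y $ i *\<^sub>R ?e"
      using insert.hyps by (auto simp: r_def vec_eq_iff axis_def)
    have der: "((\<lambda>s. v ((x + r S) + (s * y $ i) *\<^sub>R ?e)) has_real_derivative y $ i * partial_deriv i v (x + r S + (s * y $ i) *\<^sub>R ?e)) (at s)" for s
    proof -
      have 1: "((\<lambda>t. v ((x + r S) + t *\<^sub>R ?e)) has_real_derivative partial_deriv i v (x + r S + (s * y $ i) *\<^sub>R ?e)) (at (s * y $ i))"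
        unfolding has_real_derivative_iff_has_vector_derivative by (rule partial_deriv_has_vector_derivative[OF d])
      have 2: "((\<lambda>s. s * y $ i) has_real_derivative y $ i) (at s)" by (auto intro!: derivative_eq_intros)
      show ?thesis using DERIV_chain2[OF 1 2] by (simp add: mult.commute)
    qed
    have "\<exists>s. 0 < s \<and> s < 1 \<and> v ((x + r S) + (1 * y $ i) *\<^sub>R ?e) - v ((x + r S) + (0 * y $ i) *\<^sub>R ?e)
       = (1 - 0) * (y $ i * partial_deriv i v (x + r S + (s * y $ i) *\<^sub>R ?e))"
      using MVT2[of 0 1 "\<lambda>s. v ((x + r S) + (s * y $ i) *\<^sub>R ?e)" "\<lambda>s. y $ i * partial_deriv i v (x + r S + (s * y $ i) *\<^sub>R ?e)"] der by simp
    then obtain s where s: "0 < s" "s < 1" and eq: "v (x + r (insert i S)) - v (x + r S) = y $ i * partial_deriv i v (x + r S + (s * y $ i) *\<^sub>R ?e)"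
      by (auto simp: rS add.assoc)
    \<comment> \<open>The offset of the mean value point. As i is not in S, each of its components
      is at most that of y in modulus, so the Hoelder bound may be taken with |y|.\<close>
    define u where "u = r S + (s * y $ i) *\<^sub>R ?e"
    have "norm u \<le> norm y"
    proof (rule norm_le_componentwise_cart)
      fix j
      show "norm (u $ j) \<le> norm (y $ j)"
        using s insert.hyps by (auto simp: u_def r_def axis_def abs_mult mult_left_le_one_le)
    qed
    have "\<bar>y $ i * (partial_deriv i v (x + u) - partial_deriv i v x)\<bar> \<le> norm y * (C * norm y powr \<alpha>)"
      unfolding abs_mult
    proof (rule mult_mono)
      show "\<bar>y $ i\<bar> \<le> norm y" by (rule component_le_norm_cart)
      have "\<bar>partial_deriv i v (x + u) - partial_deriv i v x\<bar> \<le> C * norm (x + u - x) powr \<alpha>" by (rule C)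
      also have "\<dots> \<le> C * norm y powr \<alpha>"
        using \<open>norm u \<le> norm y\<close> C \<open>\<alpha> > 0\<close> by (intro mult_left_mono powr_mono2) auto
      finally show "\<bar>partial_deriv i v (x + u) - partial_deriv i v x\<bar> \<le> C * norm y powr \<alpha>" .
    qed auto
    also have "\<dots> = C * norm y powr (1 + \<alpha>)"
      by (cases "norm y = 0") (simp_all add: powr_add)
    finally have step: "\<bar>y $ i * (partial_deriv i v (x + u) - partial_deriv i v x)\<bar> \<le> C * norm y powr (1 + \<alpha>)" .
    have "v (x + r (insert i S)) - v x - (\<Sum>j\<in>insert i S. partial_deriv j v x * y $ j)
      = (v (x + r S) - v x - (\<Sum>j\<in>S. partial_deriv j v x * y $ j)) + y $ i * (partial_deriv i v (x + u) - partial_deriv i v x)"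
      using eq insert.hyps by (simp add: u_def algebra_simps)
    also have "\<bar>\<dots>\<bar> \<le> card S * (C * norm y powr (1 + \<alpha>)) + C * norm y powr (1 + \<alpha>)"
      using insert.IH step by linarith
    finally show ?case using insert.hyps by (simp add: algebra_simps)
  qed
  from this[of UNIV] show ?thesis by (simp add: r_def mult.assoc)
qed

lemma min_one_bound:
  fixes t :: real
  assumes "t \<le> A" "t \<le> B * s" "A \<ge> 0" "B \<ge> 0" "s \<ge> 0"
  shows "t \<le> (A + B) * min 1 s"
proof (cases "s \<le> 1")
  case True
  then have "t \<le> A * s + B * s" using assms by (simp add: add_increasing)
  then show ?thesis using True by (simp add: distrib_right min_def)
qed (use assms in auto)

lemma Hoelder_torus_0_bound:
  fixes v :: "real ^ 'n \<Rightarrow> real"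
  assumes v: "v \<in> Hoelder_torus 0 \<beta>" and "\<beta> > 0"
  obtains C where "C \<ge> 0" "\<And>x y. \<bar>v x - v y\<bar> \<le> C * min 1 (norm (x - y) powr \<beta>)"
proof -
  have p: "torus_periodic v" and c: "continuous_on UNIV v"
    and bdd: "bdd_above {\<bar>v x - v y\<bar> / torus_dist x y powr \<beta> | x y. x \<in> torus_cell \<and> y \<in> torus_cell \<and> x \<noteq> y}"
    using v by (auto simp: Hoelder_torus_def)
  obtain B where B: "B \<ge> 0" "\<And>x y. \<bar>v x - v y\<bar> \<le> B * norm (x - y) powr \<beta>"
    using Hoelder_periodic_bound[OF p \<open>\<beta> > 0\<close> bdd] by blast
  obtain M where M: "M > 0" "\<And>z. norm (v z) \<le> M" using continuous_periodic_bounded[OF c p] by blast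
  show ?thesis
  proof (rule that[of "2 * M + B"])
    fix x y
    have "\<bar>v x - v y\<bar> \<le> 2 * M" using M(2)[of x] M(2)[of y] by (simp add: abs_le_iff)
    then show "\<bar>v x - v y\<bar> \<le> (2 * M + B) * min 1 (norm (x - y) powr \<beta>)"
      using B M by (intro min_one_bound) auto
  qed (use B M in auto)
qed

lemma second_difference_bound_0:
  fixes v :: "real ^ 'n \<Rightarrow> real"
  assumes v: "v \<in> Hoelder_torus 0 \<beta>" and "\<beta> > 0"
  obtains C where "C \<ge> 0" "\<And>x y. \<bar>2 * v x - v (x + y) - v (x - y)\<bar> \<le> C * min 1 (norm y powr \<beta>)"
proof -
  obtain C where C: "C \<ge> 0" "\<And>x y. \<bar>v x - v y\<bar> \<le> C * min 1 (norm (x - y) powr \<beta>)"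
    using Hoelder_torus_0_bound[OF assms] by blast
  show ?thesis
  proof (rule that[of "2 * C"])
    fix x y
    have "\<bar>v x - v (x + y)\<bar> \<le> C * min 1 (norm y powr \<beta>)" "\<bar>v x - v (x - y)\<bar> \<le> C * min 1 (norm y powr \<beta>)"
      using C(2)[of x "x + y"] C(2)[of x "x - y"] by simp_all
    then show "\<bar>2 * v x - v (x + y) - v (x - y)\<bar> \<le> 2 * C * min 1 (norm y powr \<beta>)" by linarith
  qed (use C in auto)
qed

text \<open>The linear Taylor terms at y and -y cancel, which raises the order from 1 to 1 +
  \<alpha>. For \<sigma> \<ge> 1/2 this is indispensable: a first difference of order |y| is not
  absolutely integrable against |y|^(-n-2\<sigma>) at the origin.\<close>

lemma second_difference_bound_1:
  fixes v :: "real ^ 'n \<Rightarrow> real"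
  assumes v: "v \<in> Hoelder_torus 1 \<alpha>" and "\<alpha> > 0"
  obtains C where "C \<ge> 0" "\<And>x y. \<bar>2 * v x - v (x + y) - v (x - y)\<bar> \<le> C * min 1 (norm y powr (1 + \<alpha>))"
proof -
  have p: "torus_periodic v" and ck: "C_k (Suc 0) v"
    and bdd: "\<And>ds. length ds = 1 \<Longrightarrow> bdd_above {\<bar>foldr partial_deriv ds v x - foldr partial_deriv ds v y\<bar> / torus_dist x y powr \<alpha> | x y. x \<in> torus_cell \<and> y \<in> torus_cell \<and> x \<noteq> y}"
    using v by (auto simp: Hoelder_torus_def)
  have c: "continuous_on UNIV v" and d: "\<And>i x. (\<lambda>t. v (x + t *\<^sub>R axis i 1)) differentiable (at 0)"
    using ck by auto
  have "\<exists>C. C \<ge> 0 \<and> (\<forall>x y. \<bar>partial_deriv i v x - partial_deriv i v y\<bar> \<le> C * norm (x - y) powr \<alpha>)" for i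
  proof -
    have "bdd_above {\<bar>partial_deriv i v x - partial_deriv i v y\<bar> / torus_dist x y powr \<alpha> | x y. x \<in> torus_cell \<and> y \<in> torus_cell \<and> x \<noteq> y}"
      using bdd[of "[i]"] by simp
    from Hoelder_periodic_bound[OF torus_periodic_partial_deriv[OF p] \<open>\<alpha> > 0\<close> this] show ?thesis by metis
  qed
  then obtain B where B: "\<And>i. B i \<ge> 0" "\<And>i x y. \<bar>partial_deriv i v x - partial_deriv i v y\<bar> \<le> B i * norm (x - y) powr \<alpha>"
    by metis
  define D where "D = (\<Sum>i\<in>UNIV. B i)"
  have D: "D \<ge> 0" "\<bar>partial_deriv i v x - partial_deriv i v y\<bar> \<le> D * norm (x - y) powr \<alpha>" for i x y
  proof -
    show "D \<ge> 0" unfolding D_def by (intro sum_nonneg B)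
    have "B i \<le> D" unfolding D_def by (intro member_le_sum) (use B in auto)
    then have "B i * norm (x - y) powr \<alpha> \<le> D * norm (x - y) powr \<alpha>" by (intro mult_right_mono) auto
    then show "\<bar>partial_deriv i v x - partial_deriv i v y\<bar> \<le> D * norm (x - y) powr \<alpha>" using B(2)[of i x y] by linarith
  qed
  obtain M where M: "M > 0" "\<And>z. norm (v z) \<le> M" using continuous_periodic_bounded[OF c p] by blast
  define E where "E = CARD('n) * D"
  have E: "E \<ge> 0" using D by (simp add: E_def)
  show ?thesis
  proof (rule that[of "4 * M + 2 * E"])
    fix x y
    have 1: "\<bar>v (x + y) - v x - (\<Sum>i\<in>UNIV. partial_deriv i v x * y $ i)\<bar> \<le> E * norm y powr (1 + \<alpha>)"
      unfolding E_def by (rule Hoelder_Taylor_bound[OF d D \<open>\<alpha> > 0\<close>])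
    have 2: "\<bar>v (x + - y) - v x - (\<Sum>i\<in>UNIV. partial_deriv i v x * (- y) $ i)\<bar> \<le> E * norm (- y) powr (1 + \<alpha>)"
      unfolding E_def by (rule Hoelder_Taylor_bound[OF d D \<open>\<alpha> > 0\<close>])
    have "\<bar>2 * v x - v (x + y) - v (x - y)\<bar> \<le> 2 * E * norm y powr (1 + \<alpha>)"
      using 1 2 by (simp add: sum_negf)
    moreover have "\<bar>2 * v x - v (x + y) - v (x - y)\<bar> \<le> 4 * M"
      using M(2)[of x] M(2)[of "x + y"] M(2)[of "x - y"] by (simp add: abs_le_iff)
    ultimately show "\<bar>2 * v x - v (x + y) - v (x - y)\<bar> \<le> (4 * M + 2 * E) * min 1 (norm y powr (1 + \<alpha>))"
      using M E by (intro min_one_bound) auto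
  qed (use M E in auto)
qed

section \<open>The fractional Laplacian as an integral of second differences\<close>

text \<open>Covers translations (c = 1) and point reflections (c = -1) at once.\<close>

lemma lborel_distr_isometry:
  fixes t :: "'a::euclidean_space"
  assumes "\<bar>c\<bar> = 1"
  shows "distr lborel borel (\<lambda>x. t + c *\<^sub>R x) = lborel"
proof -
  have "c \<noteq> 0" using assms by auto
  from lborel_affine[OF this, of t] have "lborel = density (distr lborel borel (\<lambda>x. t + c *\<^sub>R x)) (\<lambda>_. 1)"
    using assms by simp
  then show ?thesis by (simp add: density_1)
qed

lemma
  fixes f :: "'a::euclidean_space \<Rightarrow> 'b::{banach, second_countable_topology}"
  assumes "\<bar>c\<bar> = 1" and [measurable]: "f \<in> borel_measurable borel"
  shows integrable_lborel_isometry: "integrable lborel (\<lambda>x. f (t + c *\<^sub>R x)) \<longleftrightarrow> integrable lborel f"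
    and integral_lborel_isometry: "(LINT x|lborel. f (t + c *\<^sub>R x)) = (LINT x|lborel. f x)"
proof -
  have "integrable lborel f \<longleftrightarrow> integrable (distr lborel borel (\<lambda>x. t + c *\<^sub>R x)) f"
    by (simp add: lborel_distr_isometry[OF assms(1)])
  also have "\<dots> \<longleftrightarrow> integrable lborel (\<lambda>x. f (t + c *\<^sub>R x))"
    by (subst integrable_distr_eq) auto
  finally show "integrable lborel (\<lambda>x. f (t + c *\<^sub>R x)) \<longleftrightarrow> integrable lborel f" ..
  have "(LINT x|lborel. f x) = (LINT x|distr lborel borel (\<lambda>x. t + c *\<^sub>R x). f x)"
    by (simp add: lborel_distr_isometry[OF assms(1)])
  also have "\<dots> = (LINT x|lborel. f (t + c *\<^sub>R x))"
    by (subst integral_distr) auto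
  finally show "(LINT x|lborel. f (t + c *\<^sub>R x)) = (LINT x|lborel. f x)" ..
qed

text \<open>The junk value \<open>0\<close> at the origin agrees with the one in \<open>frac_kernel\<close>, so that the
  periodization \<open>frac_kernel_eq\<close> below holds at the lattice points too.\<close>

definition riesz_kernel :: "real \<Rightarrow> real ^ 'n \<Rightarrow> real"
  where "riesz_kernel \<sigma> y = 1 / norm y powr (real CARD('n) + 2 * \<sigma>)"

definition frac_constant :: "nat \<Rightarrow> real \<Rightarrow> real"
  where "frac_constant n \<sigma> = 4 powr \<sigma> * Gamma (real n / 2 + \<sigma>) / (\<bar>Gamma (- \<sigma>)\<bar> * pi powr (real n / 2))"

definition second_difference :: "(real ^ 'n \<Rightarrow> real) \<Rightarrow> real ^ 'n \<Rightarrow> real ^ 'n \<Rightarrow> real"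
  where "second_difference v x y = 2 * v x - v (x + y) - v (x - y)"

definition frac_laplacian_pointwise :: "real \<Rightarrow> (real ^ 'n \<Rightarrow> real) \<Rightarrow> real ^ 'n \<Rightarrow> real"
  where "frac_laplacian_pointwise \<sigma> v x
    = frac_constant CARD('n) \<sigma> / 2 * (LINT y|lborel. second_difference v x y * riesz_kernel \<sigma> y)"

lemma riesz_kernel_nonneg [simp]: "riesz_kernel \<sigma> y \<ge> 0"
  by (simp add: riesz_kernel_def)

lemma riesz_kernel_minus: "riesz_kernel \<sigma> (- y) = riesz_kernel \<sigma> y"
  by (simp add: riesz_kernel_def)

lemma riesz_kernel_borel [measurable]: "riesz_kernel \<sigma> \<in> borel_measurable borel"
  unfolding riesz_kernel_def by measurable

lemma riesz_kernel_summable: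
  "\<sigma> > 0 \<Longrightarrow> (\<lambda>k. riesz_kernel \<sigma> (x + torus_period k)) summable_on UNIV"
  unfolding riesz_kernel_def by (rule lattice_sum_summable) simp

lemma frac_kernel_eq:
  fixes x :: "real ^ 'n"
  shows "frac_kernel \<sigma> x = frac_constant CARD('n) \<sigma> * (\<Sum>\<^sub>\<infinity>k. riesz_kernel \<sigma> (x + torus_period k))"
  by (simp add: frac_kernel_def frac_constant_def riesz_kernel_def torus_period_def)

lemma frac_kernel_minus: "frac_kernel \<sigma> (- x) = frac_kernel \<sigma> x"
proof -
  have "(\<Sum>\<^sub>\<infinity>k. riesz_kernel \<sigma> (- x + torus_period k)) = (\<Sum>\<^sub>\<infinity>k. riesz_kernel \<sigma> (- x + torus_period (- k)))"
    by (rule infsum_reindex_bij_betw[symmetric, of uminus UNIV UNIV]) (simp add: bij_betw_def inj_on_def)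
  also have "\<dots> = (\<Sum>\<^sub>\<infinity>k. riesz_kernel \<sigma> (x + torus_period k))"
  proof (rule infsum_cong)
    fix k
    show "riesz_kernel \<sigma> (- x + torus_period (- k)) = riesz_kernel \<sigma> (x + torus_period k)"
      using riesz_kernel_minus[of \<sigma> "x + torus_period k"] by (simp add: torus_period_minus)
  qed
  finally show ?thesis by (simp add: frac_kernel_eq)
qed

lemma frac_kernel_borel:
  assumes "\<sigma> > 0"
  shows "frac_kernel \<sigma> \<in> borel_measurable borel"
proof -
  have "(\<lambda>x::real^'n. \<Sum>\<^sub>\<infinity>k. riesz_kernel \<sigma> (x + torus_period k)) \<in> borel_measurable borel"
    by (rule borel_measurable_infsum_nonneg) (use riesz_kernel_summable[OF assms] in auto)
  then show ?thesis unfolding frac_kernel_eq by measurable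
qed

lemma frac_constant_pos:
  assumes "0 < \<sigma>" "\<sigma> < 1"
  shows "frac_constant n \<sigma> > 0"
proof -
  have "Gamma (real n / 2 + \<sigma>) > 0" using assms by (intro Gamma_real_pos add_nonneg_pos) auto
  moreover have "\<bar>Gamma (- \<sigma>)\<bar> > 0" using assms by (simp add: abs_Gamma_minus)
  ultimately show ?thesis by (simp add: frac_constant_def)
qed

text \<open>This identity is what the kernel constant is normalized for.\<close>

lemma integral_one_minus_cos_riesz:
  fixes \<xi> :: "real ^ 'n"
  assumes "0 < \<sigma>" "\<sigma> < 1"
  shows "frac_constant CARD('n) \<sigma> * (LINT y|lborel. (1 - cos (\<xi> \<bullet> y)) * riesz_kernel \<sigma> y) = norm \<xi> powr (2 * \<sigma>)"
proof -
  have e: "2 * (real CARD('n) / 2 + \<sigma>) = real CARD('n) + 2 * \<sigma>" by simp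
  have G: "Gamma (real CARD('n) / 2 + \<sigma>) > 0" using assms by (intro Gamma_real_pos add_nonneg_pos) auto
  have c: "frac_constant CARD('n) \<sigma> > 0" by (rule frac_constant_pos[OF assms])
  have "(\<integral>\<^sup>+y. ennreal ((1 - cos (\<xi> \<bullet> y)) * riesz_kernel \<sigma> y) \<partial>lborel) = ennreal (norm \<xi> powr (2 * \<sigma>) / frac_constant CARD('n) \<sigma>)"
    using nn_integral_one_minus_cos[OF assms, of \<xi>] by (simp add: riesz_kernel_def e frac_constant_def)
  then have "(LINT y|lborel. (1 - cos (\<xi> \<bullet> y)) * riesz_kernel \<sigma> y) = norm \<xi> powr (2 * \<sigma>) / frac_constant CARD('n) \<sigma>"
    by (intro integral_eq_nn_integral[THEN trans]) (use c in \<open>auto intro!: mult_nonneg_nonneg\<close>)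
  then show ?thesis using c by simp
qed

text \<open>Both Hoelder cases enter through this one bound. It is uniform in x, so
  \<open>C * G\<close> below dominates the integrands for all x simultaneously. The strict
  inequality 2 \<sigma> < \<beta> makes \<open>G\<close> integrable at the origin; the cap 1
  together with \<sigma> > 0 does so at infinity.\<close>

locale second_difference_bounded =
  fixes v :: "real ^ 'n \<Rightarrow> real" and \<sigma> \<beta> C :: real
  assumes \<sigma>: "0 < \<sigma>" "\<sigma> < 1" and \<beta>: "2 * \<sigma> < \<beta>"
    and cont: "continuous_on UNIV v" and per: "torus_periodic v"
    and C: "C \<ge> 0" "\<And>x y. \<bar>second_difference v x y\<bar> \<le> C * min 1 (norm y powr \<beta>)"
begin

abbreviation G :: "real ^ 'n \<Rightarrow> real" where "G y \<equiv> min 1 (norm y powr \<beta>) * riesz_kernel \<sigma> y"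
abbreviation h :: "real ^ 'n \<Rightarrow> real" where "h \<equiv> frac_laplacian_pointwise \<sigma> v"

lemma v_borel [measurable]: "v \<in> borel_measurable borel"
  by (rule borel_measurable_continuous_onI[OF cont])

lemma G_integrable: "integrable lborel G"
  using integrable_min_power[of "2 * \<sigma>" \<beta>, where 'a="real ^ 'n"] \<sigma> \<beta> by (simp add: riesz_kernel_def)

lemma second_difference_borel [measurable]:
  assumes [measurable]: "f \<in> borel_measurable M" "g \<in> borel_measurable M"
  shows "(\<lambda>x. second_difference v (f x) (g x)) \<in> borel_measurable M"
  unfolding second_difference_def by measurable

lemma integrand_bound: "\<bar>second_difference v x y * riesz_kernel \<sigma> y\<bar> \<le> C * G y"
  using mult_right_mono[OF C(2)[of x y] riesz_kernel_nonneg[of \<sigma> y]] by (simp add: abs_mult mult.assoc)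

lemma h_periodic: "torus_periodic h"
  unfolding torus_periodic_iff
proof (intro allI)
  fix x :: "real ^ 'n" and k
  have "second_difference v (x + torus_period k) y = second_difference v x y" for y
    using torus_periodicD[OF per, of x k] torus_periodicD[OF per, of "x + y" k] torus_periodicD[OF per, of "x - y" k]
    by (simp add: second_difference_def algebra_simps)
  then show "h (x + torus_period k) = h x" by (simp add: frac_laplacian_pointwise_def)
qed

lemma h_continuous: "continuous_on UNIV h"
  unfolding continuous_on_sequentially o_def frac_laplacian_pointwise_def
proof (intro allI ballI impI tendsto_mult tendsto_const)
  fix X :: "nat \<Rightarrow> real ^ 'n" and x
  assume "(\<forall>n. X n \<in> UNIV) \<and> X \<longlonglongrightarrow> x"
  then have X: "X \<longlonglongrightarrow> x" by simp
  show "(\<lambda>n. LINT y|lborel. second_difference v (X n) y * riesz_kernel \<sigma> y) \<longlonglongrightarrow> (LINT y|lborel. second_difference v x y * riesz_kernel \<sigma> y)"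
  proof (rule integral_dominated_convergence[where w="\<lambda>y. C * G y"])
    show "integrable lborel (\<lambda>y. C * G y)" by (rule integrable_mult_right[OF G_integrable])
    have lim: "(\<lambda>n. v (f (X n))) \<longlonglongrightarrow> v (f x)" if "continuous_on UNIV f" for f
      using continuous_on_tendsto_compose[OF continuous_on_compose2[OF cont that], of X x sequentially] X by simp
    show "AE y in lborel. (\<lambda>n. second_difference v (X n) y * riesz_kernel \<sigma> y) \<longlonglongrightarrow> second_difference v x y * riesz_kernel \<sigma> y"
      unfolding second_difference_def
      by (intro AE_I2 tendsto_intros lim[of "\<lambda>x. x"] lim[of "\<lambda>x. x + _"] lim[of "\<lambda>x. x - _"] continuous_intros)
    show "AE y in lborel. norm (second_difference v (X n) y * riesz_kernel \<sigma> y) \<le> C * G y" for n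
      using integrand_bound by (intro AE_I2) simp
  qed measurable
qed

text \<open>A translation by u multiplies the pairing with the character by
  \<open>torus_char (- k) u\<close>, and the translations by y and -y combine to twice the cosine.
  The pairing is with e^(i k x), the form in which the series of the test function supplies its
  terms.\<close>

lemma torus_integral_second_difference_char:
  "torus_integral (\<lambda>x. complex_of_real (second_difference v x y) * torus_char k x)
    = 2 * complex_of_real (1 - cos (int_to_real_vec k \<bullet> y)) * torus_integral (\<lambda>x. complex_of_real (v x) * torus_char k x)"
proof -
  let ?V = "torus_integral (\<lambda>x. complex_of_real (v x) * torus_char k x)"
  have sh: "torus_integral (\<lambda>x. complex_of_real (v (x + u)) * torus_char k x) = torus_char (- k) u * ?V" for u
  proof -
    have "?V = torus_integral (\<lambda>x. complex_of_real (v (x + u)) * torus_char k (x + u))"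
      by (rule torus_integral_shift[symmetric]) (use per torus_char_periodic[of k] in \<open>auto intro!: continuous_intros cont simp: torus_periodic_iff\<close>)
    also have "\<dots> = torus_char k u * torus_integral (\<lambda>x. complex_of_real (v (x + u)) * torus_char k x)"
      by (simp add: torus_char_add_arg set_lebesgue_integral_def mult_ac flip: integral_mult_right_zero)
    finally have "torus_char (- k) u * ?V = (torus_char k u * torus_char (- k) u) * torus_integral (\<lambda>x. complex_of_real (v (x + u)) * torus_char k x)"
      by (simp add: mult_ac)
    then show ?thesis by (simp add: torus_char_minus_mult)
  qed
  have c0: "continuous_on UNIV (\<lambda>x. complex_of_real (v (x + u)) * torus_char k x)" for u
    by (intro continuous_intros continuous_on_compose2[OF cont]) auto
  note si = set_integrable_torus_continuous[OF c0]
  have "torus_integral (\<lambda>x. complex_of_real (second_difference v x y) * torus_char k x)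
    = torus_integral (\<lambda>x. 2 * (complex_of_real (v (x + 0)) * torus_char k x) - complex_of_real (v (x + y)) * torus_char k x - complex_of_real (v (x + - y)) * torus_char k x)"
    by (simp add: second_difference_def algebra_simps)
  also have "\<dots> = 2 * torus_integral (\<lambda>x. complex_of_real (v (x + 0)) * torus_char k x)
     - torus_integral (\<lambda>x. complex_of_real (v (x + y)) * torus_char k x) - torus_integral (\<lambda>x. complex_of_real (v (x + - y)) * torus_char k x)"
    by (simp only: set_integral_diff[OF set_integral_diff(1)[OF set_integrable_mult_right[OF si] si] si] set_integral_diff[OF set_integrable_mult_right[OF si] si] set_integral_mult_right)
  also have "\<dots> = (2 - torus_char (- k) y - torus_char k y) * ?V"
    unfolding sh by (simp add: torus_char_minus_arg left_diff_distrib)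
  also have "torus_char (- k) y + torus_char k y = 2 * complex_of_real (cos (int_to_real_vec k \<bullet> y))"
    unfolding torus_char_minus_arg[symmetric] by (simp add: torus_char_def cos_exp_eq cos_of_real[symmetric])
  then have "2 - torus_char (- k) y - torus_char k y = 2 * complex_of_real (1 - cos (int_to_real_vec k \<bullet> y))"
    by (simp add: algebra_simps)
  finally show ?thesis .
qed

text \<open>After Fubini the second difference gives the factor 2 (1 - cos (k \<bullet> y)). The 2
  cancels the 1/2 in \<open>frac_laplacian_pointwise\<close>, and the remaining y-integral is the
  multiplier.\<close>

lemma torus_integral_h_char:
  "torus_integral (\<lambda>x. complex_of_real (h x) * torus_char k x)
    = complex_of_real (norm (int_to_real_vec k) powr (2 * \<sigma>)) * torus_integral (\<lambda>x. complex_of_real (v x) * torus_char k x)"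
proof -
  let ?V = "torus_integral (\<lambda>x. complex_of_real (v x) * torus_char k x)"
  let ?W = "\<lambda>x y. second_difference v x y * riesz_kernel \<sigma> y"
  define F where "F x y = indicator torus_cell x *\<^sub>R (complex_of_real (?W x y) * torus_char k x)" for x y
  have F_bound: "norm (F x y) \<le> indicator torus_cell x * (C * G y)" for x y
    using integrand_bound[of x y] by (auto simp: F_def norm_mult indicator_def simp del: of_real_mult)
  have [measurable]: "case_prod F \<in> borel_measurable (lborel \<Otimes>\<^sub>M lborel)"
    unfolding F_def by measurable
  have CG: "integrable lborel (\<lambda>y. C * G y)" by (rule integrable_mult_right[OF G_integrable])
  have intF: "integrable lborel (F x)" for x
    by (rule Bochner_Integration.integrable_bound[OF integrable_mult_right[OF CG, of "indicator torus_cell x"]])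
      (use F_bound[of x] C in \<open>auto simp: abs_mult\<close>)
  \<comment> \<open>The majorant is a product: the indicator of the cell in x, of finite volume,
    times the integrable \<open>C * G\<close> in y.\<close>
  have FF: "integrable (lborel \<Otimes>\<^sub>M lborel) (case_prod F)"
  proof (rule lborel_pair.Fubini_integrable)
    show "case_prod F \<in> borel_measurable (lborel \<Otimes>\<^sub>M lborel)" by measurable
    show "AE x in lborel. integrable lborel (\<lambda>y. case_prod F (x, y))" using intF by simp
    have "integrable lborel (\<lambda>x. LINT y|lborel. norm (F x y))"
    proof (rule Bochner_Integration.integrable_bound)
      show "integrable lborel (\<lambda>x. indicator (torus_cell :: (real ^ 'n) set) x * (LINT y|lborel. C * G y))"
        by (intro integrable_mult_left integrable_real_indicator) (use emeasure_torus_cell_finite in auto)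
      show "(\<lambda>x. LINT y|lborel. norm (F x y)) \<in> borel_measurable lborel" by measurable
      show "AE x in lborel. norm (LINT y|lborel. norm (F x y)) \<le> norm (indicator (torus_cell :: (real ^ 'n) set) x * (LINT y|lborel. C * G y))"
      proof (intro AE_I2)
        fix x :: "real ^ 'n"
        have "(LINT y|lborel. norm (F x y)) \<le> (LINT y|lborel. indicator torus_cell x * (C * G y))"
          by (intro integral_mono integrable_norm intF integrable_mult_right CG F_bound)
        also have "\<dots> = indicator torus_cell x * (LINT y|lborel. C * G y)" by simp
        finally show "norm (LINT y|lborel. norm (F x y)) \<le> norm (indicator (torus_cell :: (real ^ 'n) set) x * (LINT y|lborel. C * G y))"
          by simp
      qed
    qed
    then show "integrable lborel (\<lambda>x. LINT y|lborel. norm (case_prod F (x, y)))" by simp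
  qed
  have "torus_integral (\<lambda>x. complex_of_real (h x) * torus_char k x) = (LINT x|lborel. complex_of_real (frac_constant CARD('n) \<sigma> / 2) * (LINT y|lborel. F x y))"
    unfolding set_lebesgue_integral_def
  proof (rule Bochner_Integration.integral_cong[OF refl])
    fix x :: "real ^ 'n"
    have "(LINT y|lborel. F x y) = (LINT y|lborel. indicator torus_cell x *\<^sub>R (torus_char k x * complex_of_real (?W x y)))"
      by (simp only: F_def mult.commute)
    also have "\<dots> = indicator torus_cell x *\<^sub>R (torus_char k x * complex_of_real (LINT y|lborel. ?W x y))"
      by (simp only: integral_scaleR_right integral_mult_right_zero integral_complex_of_real)
    finally show "indicator torus_cell x *\<^sub>R (complex_of_real (h x) * torus_char k x) = complex_of_real (frac_constant CARD('n) \<sigma> / 2) * (LINT y|lborel. F x y)"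
      by (simp add: frac_laplacian_pointwise_def scaleR_conv_of_real)
  qed
  also have "\<dots> = complex_of_real (frac_constant CARD('n) \<sigma> / 2) * (LINT x|lborel. LINT y|lborel. F x y)" by simp
  also have "(LINT x|lborel. LINT y|lborel. F x y) = (LINT y|lborel. LINT x|lborel. F x y)"
    by (rule lborel_pair.Fubini_integral[OF FF, symmetric])
  also have "(\<lambda>y. LINT x|lborel. F x y) = (\<lambda>y. 2 * ?V * complex_of_real ((1 - cos (int_to_real_vec k \<bullet> y)) * riesz_kernel \<sigma> y))"
  proof
    fix y
    have eq: "(LINT x|lborel. F x y) = complex_of_real (riesz_kernel \<sigma> y) * torus_integral (\<lambda>x. complex_of_real (second_difference v x y) * torus_char k x)"
      unfolding set_lebesgue_integral_def F_def
      by (subst integral_mult_right_zero[symmetric]) (simp add: mult_ac)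
    show "(LINT x|lborel. F x y) = 2 * ?V * complex_of_real ((1 - cos (int_to_real_vec k \<bullet> y)) * riesz_kernel \<sigma> y)"
      unfolding eq torus_integral_second_difference_char by (simp add: mult_ac)
  qed
  also have "(LINT y|lborel. 2 * ?V * complex_of_real ((1 - cos (int_to_real_vec k \<bullet> y)) * riesz_kernel \<sigma> y))
     = 2 * ?V * complex_of_real (LINT y|lborel. (1 - cos (int_to_real_vec k \<bullet> y)) * riesz_kernel \<sigma> y)"
    by (simp only: integral_mult_right_zero integral_complex_of_real)
  also have "complex_of_real (frac_constant CARD('n) \<sigma> / 2) * \<dots> = complex_of_real (frac_constant CARD('n) \<sigma> * (LINT y|lborel. (1 - cos (int_to_real_vec k \<bullet> y)) * riesz_kernel \<sigma> y)) * ?V"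
    by simp
  finally show ?thesis unfolding integral_one_minus_cos_riesz[OF \<sigma>] .
qed

lemma distr_coincides: "distr_coincides_with (frac_laplacian_distr \<sigma> v) h"
  unfolding distr_coincides_with_def
proof
  fix \<phi> :: "real ^ 'n \<Rightarrow> complex" assume \<phi>: "\<phi> \<in> C_infinity_torus"
  note c\<phi> = C_infinity_torusD(2)[OF \<phi>]
  let ?r = "\<lambda>k::int^'n. norm (int_to_real_vec k) powr (2 * \<sigma>)"
  let ?c = "fourier_coeff \<phi>"
  let ?V = "\<lambda>k::int^'n. torus_integral (\<lambda>x. complex_of_real (v x) * torus_char k x)"
  have "(\<lambda>k. 1 / (2 * pi) ^ CARD('n) * ((1 + ?r k) * norm (torus_fourier \<phi> k))) summable_on UNIV"
    by (intro summable_on_cmult_right torus_fourier_decay[OF \<phi>]) (use \<sigma> in auto)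
  then have sm: "(\<lambda>k. (1 + ?r k) * norm (?c k)) summable_on UNIV"
    by (simp add: fourier_coeff_eq[OF c\<phi>] norm_divide norm_power norm_mult)
  \<comment> \<open>Two majorants for the two exchanges: \<open>sm2\<close> for the series of the
    fractional Laplacian of \<phi> paired with v, \<open>sm1\<close> for the series of \<phi> itself
    paired with h.\<close>
  have sm1: "(\<lambda>k. B * norm (?c k)) summable_on UNIV" and sm2: "(\<lambda>k. B * (?r k * norm (?c k))) summable_on UNIV" for B
    by (intro summable_on_cmult_right summable_on_comparison_test[OF sm]; simp add: algebra_simps)+
  obtain M where M: "M > 0" "\<And>z. norm (v z) \<le> M" using continuous_periodic_bounded[OF cont per] by blast
  obtain H where H: "H > 0" "\<And>z. norm (h z) \<le> H" using continuous_periodic_bounded[OF h_continuous h_periodic] by blast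
  have smooth: "frac_laplacian_smooth \<sigma> \<phi> z = (\<Sum>\<^sub>\<infinity>k. complex_of_real (?r k) * ?c k * torus_char k z)" for z
    by (simp add: frac_laplacian_smooth_def torus_char_def)
  have "continuous_on UNIV (frac_laplacian_smooth \<sigma> \<phi>)"
    unfolding smooth[abs_def]
    by (rule Weierstrass_torus(1)[OF _ _ sm2[of 1]]) (auto intro!: continuous_intros simp: norm_mult)
  then have meas: "frac_laplacian_smooth \<sigma> \<phi> \<in> borel_measurable borel" "\<phi> \<in> borel_measurable borel" "h \<in> borel_measurable borel"
    by (auto intro: borel_measurable_continuous_onI c\<phi> h_continuous)
  have "frac_laplacian_distr \<sigma> v \<phi> = torus_integral (\<lambda>z. complex_of_real (v z) * frac_laplacian_smooth \<sigma> \<phi> z)"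
    unfolding frac_laplacian_distr_def by (rule torus_integral_lebesgue) (use meas in measurable)
  also have "\<dots> = torus_integral (\<lambda>z. \<Sum>\<^sub>\<infinity>k. complex_of_real (v z) * (complex_of_real (?r k) * ?c k * torus_char k z))"
    unfolding smooth infsum_cmult_right' ..
  also have "\<dots> = (\<Sum>\<^sub>\<infinity>k. torus_integral (\<lambda>z. complex_of_real (v z) * (complex_of_real (?r k) * ?c k * torus_char k z)))"
  proof (rule infsumI[symmetric], rule Weierstrass_torus(2)[OF _ _ sm2[of M]])
    show "norm (complex_of_real (v z) * (complex_of_real (?r k) * ?c k * torus_char k z)) \<le> M * (?r k * norm (?c k))" for k z
      using M(2)[of z] by (simp add: norm_mult mult_right_mono)
  qed (intro continuous_intros cont)
  also have "\<dots> = (\<Sum>\<^sub>\<infinity>k. torus_integral (\<lambda>z. complex_of_real (h z) * (?c k * torus_char k z)))"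
  proof (rule infsum_cong)
    fix k :: "int ^ 'n"
    have pull: "torus_integral (\<lambda>z. complex_of_real (g z) * (a * torus_char k z)) = a * torus_integral (\<lambda>z. complex_of_real (g z) * torus_char k z)" for g a
      unfolding set_lebesgue_integral_def by (subst integral_mult_right_zero[symmetric]) (simp add: mult_ac)
    show "torus_integral (\<lambda>z. complex_of_real (v z) * (complex_of_real (?r k) * ?c k * torus_char k z)) = torus_integral (\<lambda>z. complex_of_real (h z) * (?c k * torus_char k z))"
      unfolding pull torus_integral_h_char by (simp add: mult_ac)
  qed
  also have "\<dots> = torus_integral (\<lambda>z. \<Sum>\<^sub>\<infinity>k. complex_of_real (h z) * (?c k * torus_char k z))"
  proof (rule infsumI, rule Weierstrass_torus(2)[OF _ _ sm1[of H]])
    show "norm (complex_of_real (h z) * (?c k * torus_char k z)) \<le> H * norm (?c k)" for k z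
      using H(2)[of z] by (simp add: norm_mult mult_right_mono)
  qed (intro continuous_intros h_continuous)
  also have "\<dots> = torus_integral (\<lambda>z. complex_of_real (h z) * \<phi> z)"
    unfolding infsum_cmult_right' fourier_inversion[OF \<phi>, symmetric] ..
  also have "\<dots> = (LINT z:torus_cell|lebesgue. complex_of_real (h z) * \<phi> z)"
    by (rule torus_integral_lebesgue[symmetric]) (use meas in measurable)
  finally show "frac_laplacian_distr \<sigma> v \<phi> = (LINT z:torus_cell|lebesgue. complex_of_real (h z) * \<phi> z)" .
qed

end

section \<open>Principal values\<close>

lemma frac_kernel_folded:
  fixes x z :: "real ^ 'n"
  shows "frac_kernel \<sigma> (x - z) = frac_constant CARD('n) \<sigma> * (\<Sum>\<^sub>\<infinity>k. riesz_kernel \<sigma> (z + torus_period k - x))"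
proof -
  have "frac_kernel \<sigma> (x - z) = frac_kernel \<sigma> (z - x)" using frac_kernel_minus[of \<sigma> "z - x"] by simp
  then show ?thesis by (simp add: frac_kernel_eq algebra_simps)
qed

text \<open>Unfolding with a periodic weight absorbs the lattice sum of the kernel. It is applied to
  the truncated difference for the principal value and to the full difference for absolute
  convergence.\<close>

lemma integral_frac_kernel:
  fixes w :: "real ^ 'n \<Rightarrow> real"
  assumes [measurable]: "w \<in> borel_measurable borel" and w: "torus_periodic w" and "\<sigma> > 0"
    and int: "integrable lborel (\<lambda>z. w z * riesz_kernel \<sigma> (z - x))"
  shows "set_integrable lebesgue torus_cell (\<lambda>z. w z * frac_kernel \<sigma> (x - z))"
    and "(LINT z:torus_cell|lebesgue. w z * frac_kernel \<sigma> (x - z)) = frac_constant CARD('n) \<sigma> * (LINT z|lborel. w z * riesz_kernel \<sigma> (z - x))"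
proof -
  have [measurable]: "frac_kernel \<sigma> \<in> borel_measurable (borel :: (real ^ 'n) measure)"
    by (rule frac_kernel_borel) fact
  have sm: "(\<lambda>k. riesz_kernel \<sigma> (z + torus_period k - x)) summable_on UNIV" for z
    using riesz_kernel_summable[OF \<open>\<sigma> > 0\<close>, of "z - x"] by (simp add: algebra_simps)
  note U = integral_periodic_unfold[of w "\<lambda>z. riesz_kernel \<sigma> (z - x)", OF _ _ w riesz_kernel_nonneg sm int]
  have eq: "w z * frac_kernel \<sigma> (x - z) = frac_constant CARD('n) \<sigma> * (w z * (\<Sum>\<^sub>\<infinity>k. riesz_kernel \<sigma> (z + torus_period k - x)))" for z
    by (simp add: frac_kernel_folded)
  have "set_integrable lborel torus_cell (\<lambda>z. w z * frac_kernel \<sigma> (x - z))"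
    unfolding eq by (intro set_integrable_mult_right U(1)) measurable
  then show "set_integrable lebesgue torus_cell (\<lambda>z. w z * frac_kernel \<sigma> (x - z))"
    unfolding set_integrable_def by (subst integrable_completion) auto
  have "(LINT z:torus_cell|lebesgue. w z * frac_kernel \<sigma> (x - z)) = torus_integral (\<lambda>z. w z * frac_kernel \<sigma> (x - z))"
    by (rule torus_integral_lebesgue) measurable
  also have "\<dots> = frac_constant CARD('n) \<sigma> * (LINT z|lborel. w z * riesz_kernel \<sigma> (z - x))"
    unfolding eq by (simp only: set_integral_mult_right) (subst U(2), measurable)
  finally show "(LINT z:torus_cell|lebesgue. w z * frac_kernel \<sigma> (x - z)) = frac_constant CARD('n) \<sigma> * (LINT z|lborel. w z * riesz_kernel \<sigma> (z - x))" .
qed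

text \<open>The truncation set is symmetric about x, so truncating and symmetrizing are
  compatible.\<close>

lemma torus_dist_reflect: "torus_dist x (x - y) = torus_dist x (x + y)"
  using torus_dist_commute[of "x - y" x] by (simp add: torus_dist_eq)

context second_difference_bounded
begin

lemma G_shift_integrable: "integrable lborel (\<lambda>z. G (z - x))"
  using integrable_lborel_isometry[of 1 G "- x"] G_integrable by simp

lemma truncated_integrable:
  assumes "\<delta> > 0"
  shows "integrable lborel (\<lambda>z. (v x - v z) * indicator {z. torus_dist x z > \<delta>} z * riesz_kernel \<sigma> (z - x))"
proof -
  obtain M where M: "M > 0" "\<And>z. norm (v z) \<le> M" using continuous_periodic_bounded[OF cont per] by blast
  \<comment> \<open>On the truncation set |z - x| > \<delta>, since the torus distance is the
    smaller one; hence min 1 (|z - x|^\<beta>) \<ge> m there. The factor 2 M / m then bounds the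
    bounded difference by the majorant \<open>G\<close>.\<close>
  define m where "m = min 1 (\<delta> powr \<beta>)"
  have m: "m > 0" using assms by (simp add: m_def)
  have [measurable]: "{z. torus_dist x z > \<delta>} \<in> sets borel"
    using measurable_sets[OF torus_dist_borel[of x], of "{\<delta><..}"] by (simp add: vimage_def)
  show ?thesis
  proof (rule Bochner_Integration.integrable_bound)
    show "integrable lborel (\<lambda>z. 2 * M / m * G (z - x))" by (intro integrable_mult_right G_shift_integrable)
    show "(\<lambda>z. (v x - v z) * indicator {z. torus_dist x z > \<delta>} z * riesz_kernel \<sigma> (z - x)) \<in> borel_measurable lborel"
      by measurable
    show "AE z in lborel. norm ((v x - v z) * indicator {z. torus_dist x z > \<delta>} z * riesz_kernel \<sigma> (z - x)) \<le> norm (2 * M / m * G (z - x))"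
    proof (intro AE_I2)
      fix z
      have "\<bar>(v x - v z) * indicator {z. torus_dist x z > \<delta>} z\<bar> \<le> 2 * M / m * min 1 (norm (z - x) powr \<beta>)"
      proof (cases "torus_dist x z > \<delta>")
        case True
        then have "\<delta> \<le> norm (z - x)" using torus_dist_le_norm[of x z] by (simp add: norm_minus_commute)
        then have "m \<le> min 1 (norm (z - x) powr \<beta>)"
          unfolding m_def using assms \<beta> \<sigma> by (intro min.mono powr_mono2) auto
        then have "2 * M / m * m \<le> 2 * M / m * min 1 (norm (z - x) powr \<beta>)"
          using M m by (intro mult_left_mono) auto
        moreover have "\<bar>v x - v z\<bar> \<le> 2 * M" using M(2)[of x] M(2)[of z] by (simp add: abs_le_iff)
        ultimately show ?thesis using True m by simp
      qed (use M m in auto)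
      from mult_right_mono[OF this riesz_kernel_nonneg[of \<sigma> "z - x"]]
      show "norm ((v x - v z) * indicator {z. torus_dist x z > \<delta>} z * riesz_kernel \<sigma> (z - x)) \<le> norm (2 * M / m * G (z - x))"
        using M m by (simp add: abs_mult mult.assoc)
    qed
  qed
qed

text \<open>The indicator of the truncation joins the weight; it is periodic because the torus
  distance is, so unfolding still applies. With the singularity cut off, the integrands at x + y and
  x - y are integrable separately and may be averaged.\<close>

lemma truncated_integral:
  assumes "\<delta> > 0"
  shows "set_integrable lebesgue {z \<in> torus_cell. torus_dist x z > \<delta>} (\<lambda>z. (v x - v z) * frac_kernel \<sigma> (x - z))"
    and "(LINT z:{z \<in> torus_cell. torus_dist x z > \<delta>}|lebesgue. (v x - v z) * frac_kernel \<sigma> (x - z))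
      = frac_constant CARD('n) \<sigma> / 2 * (LINT y|lborel. indicator {y. torus_dist x (x + y) > \<delta>} y * (second_difference v x y * riesz_kernel \<sigma> y))"
proof -
  define I where "I = (\<lambda>z. indicator {z. torus_dist x z > \<delta>} z :: real)"
  define w where "w z = (v x - v z) * I z" for z
  have "{z. torus_dist x z > \<delta>} \<in> sets borel"
    using measurable_sets[OF torus_dist_borel[of x], of "{\<delta><..}"] by (simp add: vimage_def)
  then have [measurable]: "I \<in> borel_measurable borel" unfolding I_def by simp
  have [measurable]: "w \<in> borel_measurable borel" unfolding w_def by measurable
  have pw: "torus_periodic w"
    using per by (simp add: torus_periodic_iff w_def I_def indicator_def torus_dist_shift_right)
  have iw: "integrable lborel (\<lambda>z. w z * riesz_kernel \<sigma> (z - x))"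
    using truncated_integrable[OF assms, of x] by (simp add: w_def I_def)
  note K = integral_frac_kernel[OF _ pw \<sigma>(1) iw]
  have eq: "indicator {z \<in> torus_cell. torus_dist x z > \<delta>} z *\<^sub>R ((v x - v z) * frac_kernel \<sigma> (x - z)) = indicator torus_cell z *\<^sub>R (w z * frac_kernel \<sigma> (x - z))" for z
    by (simp add: w_def I_def indicator_def)
  show "set_integrable lebesgue {z \<in> torus_cell. torus_dist x z > \<delta>} (\<lambda>z. (v x - v z) * frac_kernel \<sigma> (x - z))"
    using K(1) unfolding set_integrable_def eq by simp
  define F where "F z = w z * riesz_kernel \<sigma> (z - x)" for z
  have [measurable]: "F \<in> borel_measurable borel" unfolding F_def by measurable
  have iF: "integrable lborel F" using iw unfolding F_def .
  have p: "integrable lborel (\<lambda>y. F (x + y))" "(LINT y|lborel. F (x + y)) = (LINT z|lborel. F z)"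
    using integrable_lborel_isometry[of 1 F x] integral_lborel_isometry[of 1 F x] iF by simp_all
  have m: "integrable lborel (\<lambda>y. F (x - y))" "(LINT y|lborel. F (x - y)) = (LINT z|lborel. F z)"
    using integrable_lborel_isometry[of "-1" F x] integral_lborel_isometry[of "-1" F x] iF by simp_all
  have sum: "F (x + y) + F (x - y) = indicator {y. torus_dist x (x + y) > \<delta>} y * (second_difference v x y * riesz_kernel \<sigma> y)" for y
    by (simp add: F_def w_def I_def indicator_def torus_dist_reflect riesz_kernel_minus second_difference_def algebra_simps)
  have "(LINT z:{z \<in> torus_cell. torus_dist x z > \<delta>}|lebesgue. (v x - v z) * frac_kernel \<sigma> (x - z)) = frac_constant CARD('n) \<sigma> * (LINT z|lborel. F z)"
    using K(2) unfolding set_lebesgue_integral_def eq F_def by simp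
  also have "(LINT z|lborel. F z) = (LINT y|lborel. F (x + y) + F (x - y)) / 2"
    using p m by simp
  finally show "(LINT z:{z \<in> torus_cell. torus_dist x z > \<delta>}|lebesgue. (v x - v z) * frac_kernel \<sigma> (x - z))
      = frac_constant CARD('n) \<sigma> / 2 * (LINT y|lborel. indicator {y. torus_dist x (x + y) > \<delta>} y * (second_difference v x y * riesz_kernel \<sigma> y))"
    unfolding sum by simp
qed

text \<open>Lattice points y stay cut off for every \<delta>, so the truncation indicators do not
  tend to 1 there. The vanishing of the integrand saves the pointwise convergence.\<close>

lemma second_difference_period: "second_difference v x (torus_period k) = 0"
  using torus_periodicD[OF per, of x k] torus_periodicD[OF per, of x "- k"]
  by (simp add: second_difference_def torus_period_minus)

lemma has_pv_integral: "has_pv_integral_torus (\<lambda>z. (v x - v z) * frac_kernel \<sigma> (x - z)) x (h x)"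
  unfolding has_pv_integral_torus_def
proof (intro conjI allI impI)
  show "set_integrable lebesgue {z \<in> torus_cell. torus_dist x z > \<delta>} (\<lambda>z. (v x - v z) * frac_kernel \<sigma> (x - z))" if "\<delta> > 0" for \<delta>
    by (rule truncated_integral(1)[OF that])
  show "((\<lambda>\<delta>. LINT z:{z \<in> torus_cell. torus_dist x z > \<delta>}|lebesgue. (v x - v z) * frac_kernel \<sigma> (x - z)) \<longlongrightarrow> h x) (at_right 0)"
  \<comment> \<open>Dominated convergence is about sequences, so the one-sided limit is tested along
    sequences decreasing to 0; the number 1 merely bounds them.\<close>
  proof (rule tendsto_at_right_sequentially[of 0 1])
    fix S :: "nat \<Rightarrow> real"
    assume S: "\<And>n. 0 < S n" "S \<longlonglongrightarrow> 0"
    let ?g = "\<lambda>y. second_difference v x y * riesz_kernel \<sigma> y"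
    have [measurable]: "{y. torus_dist x (x + y) > \<delta>} \<in> sets borel" for \<delta>
    proof -
      have "(\<lambda>y. torus_dist x (x + y)) \<in> borel_measurable borel" by measurable
      from measurable_sets[OF this, of "{\<delta><..}"] show ?thesis by (simp add: vimage_def)
    qed
    have "(\<lambda>n. LINT y|lborel. indicator {y. torus_dist x (x + y) > S n} y * ?g y) \<longlonglongrightarrow> (LINT y|lborel. ?g y)"
    proof (rule integral_dominated_convergence[where w="\<lambda>y. C * G y"])
      show "integrable lborel (\<lambda>y. C * G y)" by (rule integrable_mult_right[OF G_integrable])
      show "AE y in lborel. (\<lambda>n. indicator {y. torus_dist x (x + y) > S n} y * ?g y) \<longlonglongrightarrow> ?g y"
      proof (intro AE_I2)
        fix y :: "real ^ 'n"
        show "(\<lambda>n. indicator {y. torus_dist x (x + y) > S n} y * ?g y) \<longlonglongrightarrow> ?g y"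
        proof (cases "\<exists>k. y = torus_period k")
          case True
          then show ?thesis by (auto simp: second_difference_period)
        next
          case False
          have "torus_dist x (x + y) > 0"
          proof (rule torus_dist_pos)
            show "x - (x + y) + torus_period k \<noteq> 0" for k
            proof
              assume "x - (x + y) + torus_period k = 0"
              then have "torus_period k = y" by simp
              then show False using False by blast
            qed
          qed
          then have "\<forall>\<^sub>F n in sequentially. S n < torus_dist x (x + y)"
            using S(2) by (simp add: order_tendsto_iff)
          then have "\<forall>\<^sub>F n in sequentially. indicator {y. torus_dist x (x + y) > S n} y * ?g y = ?g y"
            by eventually_elim simp
          then show ?thesis by (rule tendsto_eventually)
        qed
      qed
      show "AE y in lborel. norm (indicator {y. torus_dist x (x + y) > S n} y * ?g y) \<le> C * G y" for n
      proof (intro AE_I2)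
        fix y
        have "norm (indicator {y. torus_dist x (x + y) > S n} y * ?g y) \<le> \<bar>?g y\<bar>" by (simp add: indicator_def)
        also have "\<dots> \<le> C * G y" by (rule integrand_bound)
        finally show "norm (indicator {y. torus_dist x (x + y) > S n} y * ?g y) \<le> C * G y" .
      qed
    qed measurable
    then show "(\<lambda>n. LINT z:{z \<in> torus_cell. torus_dist x z > S n}|lebesgue. (v x - v z) * frac_kernel \<sigma> (x - z)) \<longlonglongrightarrow> h x"
      unfolding truncated_integral(2)[OF S(1)] frac_laplacian_pointwise_def by (intro tendsto_mult tendsto_const)
  qed simp
qed

text \<open>Here the first difference itself is dominated by a multiple of \<open>G\<close>, so
  neither truncation nor symmetrization is needed.\<close>

lemma absolutely_convergent:
  assumes B: "B \<ge> 0" "\<And>x y. \<bar>v x - v y\<bar> \<le> B * min 1 (norm (x - y) powr \<beta>)"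
  shows "set_integrable lebesgue torus_cell (\<lambda>z. (v x - v z) * frac_kernel \<sigma> (x - z))"
proof (rule integral_frac_kernel(1)[OF _ _ \<sigma>(1)])
  show "(\<lambda>z. v x - v z) \<in> borel_measurable borel" by measurable
  show "torus_periodic (\<lambda>z. v x - v z)" using per by (simp add: torus_periodic_iff)
  show "integrable lborel (\<lambda>z. (v x - v z) * riesz_kernel \<sigma> (z - x))"
  proof (rule Bochner_Integration.integrable_bound)
    show "integrable lborel (\<lambda>z. B * G (z - x))" by (intro integrable_mult_right G_shift_integrable)
    show "(\<lambda>z. (v x - v z) * riesz_kernel \<sigma> (z - x)) \<in> borel_measurable lborel" by measurable
    show "AE z in lborel. norm ((v x - v z) * riesz_kernel \<sigma> (z - x)) \<le> norm (B * G (z - x))"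
    proof (intro AE_I2)
      fix z
      show "norm ((v x - v z) * riesz_kernel \<sigma> (z - x)) \<le> norm (B * G (z - x))"
        using mult_right_mono[OF B(2)[of x z] riesz_kernel_nonneg[of \<sigma> "z - x"]] B(1)
        by (simp add: abs_mult mult.assoc norm_minus_commute)
    qed
  qed
qed

end

theorem theorem2p5:
  fixes v :: "real ^ 'n \<Rightarrow> real" and \<sigma> \<epsilon> :: real
  assumes "0 < \<sigma>" and "\<sigma> < 1" and "\<epsilon> > 0"
    and "if \<sigma> < 1 / 2
         then 2 * \<sigma> + \<epsilon> \<le> 1 \<and> v \<in> Hoelder_torus 0 (2 * \<sigma> + \<epsilon>)
         else 2 * \<sigma> + \<epsilon> - 1 \<le> 1 \<and> v \<in> Hoelder_torus 1 (2 * \<sigma> + \<epsilon> - 1)"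
  shows "\<exists>h :: real ^ 'n \<Rightarrow> real.
           torus_periodic h \<and> continuous_on UNIV h \<and>
           distr_coincides_with (frac_laplacian_distr \<sigma> v) h \<and>
           (\<forall>x. has_pv_integral_torus (\<lambda>z. (v x - v z) * frac_kernel \<sigma> (x - z)) x (h x)) \<and>
           (\<sigma> < 1 / 2 \<longrightarrow>
             (\<forall>x. set_integrable lebesgue torus_cell (\<lambda>z. (v x - v z) * frac_kernel \<sigma> (x - z))))"
proof -
  \<comment> \<open>The total order of smoothness. For \<sigma> \<ge> 1/2 one unit of it is the
    derivative and \<beta> - 1 > 0 is the Hoelder exponent, so both cases end with the same power
    \<beta>.\<close>
  define \<beta> where "\<beta> = 2 * \<sigma> + \<epsilon>"
  have \<beta>_gt: "2 * \<sigma> < \<beta>" and \<beta>_pos: "\<beta> > 0" using assms by (auto simp: \<beta>_def)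
  have "\<exists>C\<ge>0. \<forall>x y. \<bar>second_difference v x y\<bar> \<le> C * min 1 (norm y powr \<beta>)"
  proof (cases "\<sigma> < 1 / 2")
    case True
    then have "v \<in> Hoelder_torus 0 \<beta>" using assms by (simp add: \<beta>_def)
    then obtain C where "C \<ge> 0" "\<And>x y. \<bar>second_difference v x y\<bar> \<le> C * min 1 (norm y powr \<beta>)"
      using second_difference_bound_0 \<beta>_pos unfolding second_difference_def by blast
    then show ?thesis by blast
  next
    case False
    then have "v \<in> Hoelder_torus 1 (\<beta> - 1)" "\<beta> - 1 > 0" using assms by (simp_all add: \<beta>_def)
    then obtain C where "C \<ge> 0" "\<And>x y. \<bar>second_difference v x y\<bar> \<le> C * min 1 (norm y powr (1 + (\<beta> - 1)))"
      using second_difference_bound_1 unfolding second_difference_def by blast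
    then show ?thesis by auto
  qed
  then obtain C where C: "C \<ge> 0" "\<And>x y. \<bar>second_difference v x y\<bar> \<le> C * min 1 (norm y powr \<beta>)" by blast
  have v: "torus_periodic v" "continuous_on UNIV v"
    using assms(4) by (auto simp: Hoelder_torus_def split: if_splits)
  interpret second_difference_bounded v \<sigma> \<beta> C
    by unfold_locales (use assms \<beta>_gt C v in auto)
  have "set_integrable lebesgue torus_cell (\<lambda>z. (v x - v z) * frac_kernel \<sigma> (x - z))" if "\<sigma> < 1 / 2" for x
  proof -
    have "v \<in> Hoelder_torus 0 \<beta>" using assms that by (simp add: \<beta>_def)
    then obtain B where "B \<ge> 0" "\<And>x y. \<bar>v x - v y\<bar> \<le> B * min 1 (norm (x - y) powr \<beta>)"
      using Hoelder_torus_0_bound \<beta>_pos by blast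
    then show ?thesis by (rule absolutely_convergent)
  qed
  then show ?thesis
    using h_periodic h_continuous distr_coincides has_pv_integral by blast
qed

end
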